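(* Let $\gamma>0$. There is a constant $C_\gamma$ depending only on $\gamma$ such that the following holds. Let $f\in H^1(\mathbb{R})$ and let $u\in H^2(\mathbb{R})$ solve $-u_{xx}+\gamma u=f$ on $\mathbb{R}$ with $\lim_{|x|\to\infty}u(x)=0$. For an integer $N\ge1$ and $\beta>0$ let $u_N\in\widehat{P}_N^\beta$ be the solution of the Hermite–Galerkin problem \[ (\partial_xu_N,\partial_xv_N)+\gamma(u_N,v_N)=(\widehat{I}_N^\beta f,v_N)\quad\text{for all }v_N\in\widehat{P}_N^\beta. \] Then \[ \|u-u_N\|_1\le C_\gamma\Bigl(E_N^\beta(\partial_xu)+(1+\beta\sqrt N)E_N^\beta(u)+\beta^{-1}N^{-1/3}E_N^\beta(\partial_xf)+N^{1/6}E_N^\beta(f)\Bigr). \]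
   Context: $(\cdot,\cdot)$ and $\|\cdot\|$ are the $L^2(\mathbb{R})$ inner product and norm; $\|\cdot\|_1$ is the $H^1(\mathbb{R})$ norm. $\mathbb{I}_A$ is the indicator function of $A$ and $\mathcal{F}[w](k)=\frac{1}{\sqrt{2\pi}}\int w(x)e^{-ikx}dx$. Hermite functions: $\widehat{H}_n(x)=\frac{1}{\pi^{1/4}\sqrt{2^nn!}}e^{-x^2/2}H_n(x)$, with $H_n$ the Hermite polynomials. $\widehat{P}_N^\beta=\{e^{-\beta^2x^2/2}\psi(x):\ \psi\text{ a polynomial of degree}\le N\}$. If $x_0<\dots<x_N$ are the roots of $\widehat{H}_{N+1}$, then $\widehat{I}_N^\beta f$ is the unique element of $\widehat{P}_N^\beta$ agreeing with $f$ at the points $x_j/\beta$, $0\le j\le N$. For $w\in L^2(\mathbb{R})$, $E_N^\beta(w)=\|w\cdot\mathbb{I}_{\{|x|>\frac{1}{2\sqrt2}\sqrt N/\beta\}}\|+\|\mathcal{F}[w](k)\cdot\mathbb{I}_{\{|k|>\frac{1}{2\sqrt2}\sqrt N\beta\}}\|+\|w\|e^{-N/16}$. *)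

theory Defs
  imports "HOL-Analysis.Analysis" "HOL-Computational_Algebra.Polynomial"
begin

definition L2_space :: "(real \<Rightarrow> real) set" where
  "L2_space = {w. w \<in> borel_measurable lborel \<and> integrable lborel (\<lambda>x. (w x)^2)}"

definition L2_inner :: "(real \<Rightarrow> real) \<Rightarrow> (real \<Rightarrow> real) \<Rightarrow> real" where
  "L2_inner v w = (LINT x|lborel. v x * w x)"

definition L2_norm :: "(real \<Rightarrow> real) \<Rightarrow> real" where
  "L2_norm w = sqrt (LINT x|lborel. (w x)^2)"

definition L2_norm_c :: "(real \<Rightarrow> complex) \<Rightarrow> real" where
  "L2_norm_c w = sqrt (LINT x|lborel. (cmod (w x))^2)"

definition smooth_fun :: "(real \<Rightarrow> real) \<Rightarrow> bool" where
  "smooth_fun \<phi> \<longleftrightarrow> (\<forall>n x. ((deriv ^^ n) \<phi>) differentiable (at x))"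

definition test_fun :: "(real \<Rightarrow> real) \<Rightarrow> bool" where
  "test_fun \<phi> \<longleftrightarrow> smooth_fun \<phi> \<and> compact (closure {x. \<phi> x \<noteq> 0})"

definition weak_deriv :: "(real \<Rightarrow> real) \<Rightarrow> (real \<Rightarrow> real) \<Rightarrow> bool" where
  "weak_deriv w g \<longleftrightarrow> (\<forall>\<phi>. test_fun \<phi> \<longrightarrow>
      (LINT x|lborel. w x * deriv \<phi> x) = - (LINT x|lborel. g x * \<phi> x))"

definition H1_with :: "(real \<Rightarrow> real) \<Rightarrow> (real \<Rightarrow> real) \<Rightarrow> bool" where
  "H1_with w w' \<longleftrightarrow> w \<in> L2_space \<and> w' \<in> L2_space \<and> weak_deriv w w'"

definition H2_with :: "(real \<Rightarrow> real) \<Rightarrow> (real \<Rightarrow> real) \<Rightarrow> (real \<Rightarrow> real) \<Rightarrow> bool" where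
  "H2_with w w' w'' \<longleftrightarrow> H1_with w w' \<and> H1_with w' w''"

definition H1_norm :: "(real \<Rightarrow> real) \<Rightarrow> (real \<Rightarrow> real) \<Rightarrow> real" where
  "H1_norm w w' = sqrt ((L2_norm w)^2 + (L2_norm w')^2)"

definition fourier_int :: "(real \<Rightarrow> real) \<Rightarrow> real \<Rightarrow> complex" where
  "fourier_int w k = complex_of_real (1 / sqrt (2*pi)) *
     (LINT x|lborel. complex_of_real (w x) * cis (- k * x))"

text \<open>The L2 norm of F[w] restricted to {|k| > K}, for w in L2, where F is the Plancherel
  transform: F[w] is the L2-limit of the Fourier integrals of the truncations w * 1_[-R,R],
  hence this norm is the limit of the corresponding norms.\<close>
definition fourier_tail_norm :: "(real \<Rightarrow> real) \<Rightarrow> real \<Rightarrow> real" where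
  "fourier_tail_norm w K = Lim at_top (\<lambda>R::real.
      L2_norm_c (\<lambda>k. complex_of_real (indicator {k. \<bar>k\<bar> > K} k) *
                     fourier_int (\<lambda>x. w x * indicator {-R..R} x) k))"

fun hermite_poly :: "nat \<Rightarrow> real poly" where
  "hermite_poly 0 = 1"
| "hermite_poly (Suc 0) = [:0, 2:]"
| "hermite_poly (Suc (Suc n)) =
     [:0, 2:] * hermite_poly (Suc n) - smult (2 * real (Suc n)) (hermite_poly n)"

definition hermite_fun :: "nat \<Rightarrow> real \<Rightarrow> real" where
  "hermite_fun n x = 1 / (pi powr (1/4) * sqrt (2^n * fact n)) * exp (- (x^2) / 2) * poly (hermite_poly n) x"

definition P_hat :: "nat \<Rightarrow> real \<Rightarrow> (real \<Rightarrow> real) set" where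
  "P_hat N \<beta> = {g. \<exists>p. degree p \<le> N \<and> g = (\<lambda>x. exp (- (\<beta>^2 * x^2) / 2) * poly p x)}"

definition interp_hat :: "nat \<Rightarrow> real \<Rightarrow> (real \<Rightarrow> real) \<Rightarrow> (real \<Rightarrow> real)" where
  "interp_hat N \<beta> f = (THE g. g \<in> P_hat N \<beta> \<and>
      (\<forall>x. hermite_fun (Suc N) x = 0 \<longrightarrow> g (x / \<beta>) = f (x / \<beta>)))"

definition E_err :: "nat \<Rightarrow> real \<Rightarrow> (real \<Rightarrow> real) \<Rightarrow> real" where
  "E_err N \<beta> w =
     L2_norm (\<lambda>x. w x * indicator {x. \<bar>x\<bar> > 1 / (2 * sqrt 2) * sqrt (real N) / \<beta>} x)
   + fourier_tail_norm w (1 / (2 * sqrt 2) * sqrt (real N) * \<beta>)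
   + L2_norm w * exp (- real N / 16)"

end

theory Submission
  imports Defs "HOL-Probability.Probability" "HOL-Real_Asymp.Real_Asymp"
begin

text \<open>
  By coercivity the error is controlled by the projection error of \<open>u\<close> in \<open>H\<^sup>1\<close> and by the
  interpolation error of \<open>f\<close> in \<open>L\<^sup>2\<close>.

  Projection. For \<open>\<beta> = 1\<close> let \<open>M = sqrt (N / 8)\<close>. Restricting \<open>w\<close> to \<open>[-M, M]\<close> costs the tail in \<open>x\<close>;
  then applying the Fourier multiplier given by the indicator of \<open>[-2M, 2M]\<close> convolved with a
  Gaussian costs the tail in \<open>k\<close> plus \<open>exp (- N / 16)\<close>. The result is a superposition of coherent
  states centred at points \<open>(y, b)\<close> of phase space with \<open>(y\<^sup>2 + b\<^sup>2) / 2 \<le> 5 N / 16\<close>. The Hermite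
  coefficients of such a state are Poisson distributed with this mean, so those of index at least
  \<open>N\<close> are exponentially small.

  Interpolation. The norm of an interpolant is a Gauss quadrature sum with weights
  \<open>2 / h' (x\<^sub>j)\<^sup>2\<close> for \<open>h = h\<^sub>N\<^sub>+\<^sub>1\<close>. A Sonin function for the WKB form of
  \<open>h'' = (x\<^sup>2 - (2 N + 3)) h\<close> bounds \<open>h' (x\<^sub>j)\<^sup>2\<close> below by a multiple of \<open>sqrt (2 N + 3 - x\<^sub>j\<^sup>2)\<close>,
  and the last zero stays at distance of order \<open>N\<close> to the power \<open>-1/6\<close> from the turning point. Together
  with the gaps of order \<open>1 / sqrt N\<close> between the nodes this bounds the quadrature sum by
  integrals of the function and its derivative.
\<close>

section \<open>Square-integrable functions\<close>

text \<open>The factor 1 / (2 sqrt 2) is tuned to the rate exp (- N / 16). Doubling the band edge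
  leaves a margin M, and a unit Gaussian leaks exp (- M^2 / 2) = exp (- N / 16) across it. The
  Poisson mass of index at least N is at most exp (5 N / 16) / 2^N; as exp (7/16) < 2, its square
  root beats exp (- N / 16) even after polynomial factors from the size of the phase-space box.

  The interpolant is not compared with f directly. Interpolant minus projection of f is again a
  Gaussian-weighted polynomial of degree at most N, with the nodal values of the projection error,
  so the quadrature is exact for its norm. Differentiating that error costs \<beta> sqrt N, and
  \<beta>^(-1) N^(-1/3) times this is N^(1/6): the terms in f close up without new powers.

  Two encodings shape the analysis. Weak derivatives are tested against compactly supported
  functions, while Gaussians and indicators of intervals are wanted as test functions; cutoffs reach
  both. The transform of an L2 function is present only through limits over truncations, so
  identities are proved for integrable functions and carried over in norm.\<close>

lemma L2_spaceD:
  assumes "w \<in> L2_space"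
  shows L2_space_measurable: "w \<in> borel_measurable borel"
    and L2_space_integrable: "integrable lborel (\<lambda>x. (w x)^2)"
  using assms by (auto simp: L2_space_def)

lemma L2_space_mult_integrable:
  assumes "v \<in> L2_space" "w \<in> L2_space"
  shows "integrable lborel (\<lambda>x. v x * w x)"
proof (rule Bochner_Integration.integrable_bound)
  show "integrable lborel (\<lambda>x. (v x)^2 + (w x)^2)"
    using assms by (intro Bochner_Integration.integrable_add L2_space_integrable)
  show "(\<lambda>x. v x * w x) \<in> borel_measurable lborel"
    using assms by (auto dest!: L2_space_measurable)
  show "AE x in lborel. norm (v x * w x) \<le> norm ((v x)^2 + (w x)^2)"
  proof (intro AE_I2)
    fix x
    have "0 \<le> (\<bar>v x\<bar> - \<bar>w x\<bar>)^2" by simp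
    then have "2 * (\<bar>v x\<bar> * \<bar>w x\<bar>) \<le> (v x)^2 + (w x)^2"
      by (simp add: power2_diff algebra_simps)
    moreover have "0 \<le> \<bar>v x\<bar> * \<bar>w x\<bar>" by simp
    ultimately have "\<bar>v x\<bar> * \<bar>w x\<bar> \<le> (v x)^2 + (w x)^2" by linarith
    then show "norm (v x * w x) \<le> norm ((v x)^2 + (w x)^2)"
      by (simp add: abs_mult)
  qed
qed

lemma L2_space_add [intro]:
  assumes "v \<in> L2_space" "w \<in> L2_space"
  shows "(\<lambda>x. v x + w x) \<in> L2_space"
proof -
  have "integrable lborel (\<lambda>x. (v x)^2 + 2 * (v x * w x) + (w x)^2)"
    using assms
    by (intro Bochner_Integration.integrable_add integrable_mult_right L2_space_integrable L2_space_mult_integrable)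
  then show ?thesis
    using assms by (auto simp: L2_space_def power2_sum algebra_simps)
qed

lemma L2_space_scale [intro]: "w \<in> L2_space \<Longrightarrow> (\<lambda>x. c * w x) \<in> L2_space"
  by (auto simp: L2_space_def power_mult_distrib)

lemma L2_space_diff [intro]:
  "v \<in> L2_space \<Longrightarrow> w \<in> L2_space \<Longrightarrow> (\<lambda>x. v x - w x) \<in> L2_space"
  using L2_space_add[of v "\<lambda>x. (-1) * w x"] L2_space_scale[of w "-1"] by simp

lemma L2_space_zero [intro]: "(\<lambda>x. 0) \<in> L2_space"
  by (auto simp: L2_space_def)

lemma L2_space_sum [intro]:
  "(\<And>i. i \<in> I \<Longrightarrow> f i \<in> L2_space) \<Longrightarrow> (\<lambda>x. \<Sum>i\<in>I. f i x) \<in> L2_space"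
  by (induction I rule: infinite_finite_induct) auto

lemma L2_space_bound:
  assumes "w \<in> L2_space" "v \<in> borel_measurable borel" "\<And>x. \<bar>v x\<bar> \<le> \<bar>w x\<bar>"
  shows "v \<in> L2_space"
proof -
  have "integrable lborel (\<lambda>x. (v x)^2)"
    using assms by (intro Bochner_Integration.integrable_bound[OF L2_space_integrable[OF assms(1)]])
      (auto intro!: AE_I2 simp: abs_le_square_iff)
  then show ?thesis using assms(2) by (auto simp: L2_space_def)
qed

lemma L2_space_abs [intro]: "w \<in> L2_space \<Longrightarrow> (\<lambda>x. \<bar>w x\<bar>) \<in> L2_space"
  by (auto simp: L2_space_def)

lemma L2_space_indicator:
  assumes "w \<in> L2_space" "A \<in> sets borel"
  shows "(\<lambda>x. w x * indicator A x) \<in> L2_space"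
  using assms by (intro L2_space_bound[OF assms(1)])
    (auto dest!: L2_space_measurable simp: indicator_def)

lemma L2_norm_nonneg [simp]: "0 \<le> L2_norm w"
  by (simp add: L2_norm_def)

lemma L2_norm_squared: "(L2_norm w)^2 = (LINT x|lborel. (w x)^2)"
  by (simp add: L2_norm_def)

lemma L2_norm_inner: "(L2_norm w)^2 = L2_inner w w"
  by (simp add: L2_norm_squared L2_inner_def flip: power2_eq_square)

lemma L2_inner_commute: "L2_inner v w = L2_inner w v"
  by (simp add: L2_inner_def mult.commute)

lemma L2_inner_add_left:
  assumes "u \<in> L2_space" "v \<in> L2_space" "w \<in> L2_space"
  shows "L2_inner (\<lambda>x. u x + v x) w = L2_inner u w + L2_inner v w"
  using assms by (simp add: L2_inner_def distrib_right L2_space_mult_integrable)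

lemma L2_inner_diff_left:
  assumes "u \<in> L2_space" "v \<in> L2_space" "w \<in> L2_space"
  shows "L2_inner (\<lambda>x. u x - v x) w = L2_inner u w - L2_inner v w"
  using assms by (simp add: L2_inner_def left_diff_distrib L2_space_mult_integrable)

lemma L2_inner_scale_left: "L2_inner (\<lambda>x. c * v x) w = c * L2_inner v w"
  by (simp add: L2_inner_def mult.assoc)

lemma L2_inner_scale_right: "L2_inner v (\<lambda>x. c * w x) = c * L2_inner v w"
  by (subst (1 2) L2_inner_commute) (rule L2_inner_scale_left)

lemma L2_inner_sum_left:
  assumes "\<And>i. i \<in> I \<Longrightarrow> f i \<in> L2_space" "w \<in> L2_space"
  shows "L2_inner (\<lambda>x. \<Sum>i\<in>I. c i * f i x) w = (\<Sum>i\<in>I. c i * L2_inner (f i) w)"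
  using assms(1)
proof (induction I rule: infinite_finite_induct)
  case (insert i I)
  then show ?case
    using assms(2) by (simp add: L2_inner_add_left L2_inner_scale_left L2_space_sum L2_space_scale)
qed (auto simp: L2_inner_def)

lemma L2_inner_sum_right:
  assumes "\<And>i. i \<in> I \<Longrightarrow> f i \<in> L2_space" "w \<in> L2_space"
  shows "L2_inner w (\<lambda>x. \<Sum>i\<in>I. c i * f i x) = (\<Sum>i\<in>I. c i * L2_inner w (f i))"
  using L2_inner_sum_left[of I f w c] assms by (simp add: L2_inner_commute[of w])

text \<open>The squared norm of v - t w is nonnegative for every real t; evaluating it at the
  minimizing t gives the bound.\<close>

lemma L2_cauchy_schwarz:
  assumes "v \<in> L2_space" "w \<in> L2_space"
  shows "\<bar>L2_inner v w\<bar> \<le> L2_norm v * L2_norm w"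
proof -
  have q: "0 \<le> (L2_norm v)^2 - 2 * t * L2_inner v w + t^2 * (L2_norm w)^2" for t
  proof -
    have "0 \<le> L2_inner (\<lambda>x. v x - t * w x) (\<lambda>x. v x - t * w x)"
      by (simp add: L2_inner_def)
    also have "\<dots> = L2_inner v (\<lambda>x. v x - t * w x) - t * L2_inner w (\<lambda>x. v x - t * w x)"
      using assms by (subst L2_inner_diff_left) (auto simp: L2_inner_scale_left)
    also have "\<dots> = (L2_norm v)^2 - 2 * t * L2_inner v w + t^2 * (L2_norm w)^2"
      using assms
      by (subst (1 2) L2_inner_commute, subst (1 2) L2_inner_diff_left)
        (auto simp: L2_inner_scale_left L2_norm_inner L2_inner_commute[of w v] power2_eq_square[of t] algebra_simps)
    finally show ?thesis .
  qed
  show ?thesis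
  proof (cases "L2_norm w = 0")
    case True
    have "L2_inner v w = 0"
    proof (rule ccontr)
      assume n: "L2_inner v w \<noteq> 0"
      \<comment> \<open>For w of norm 0 the quadratic is affine in t; this t would make it equal to
        -1.\<close>
      have "0 \<le> (L2_norm v)^2 - 2 * (((L2_norm v)^2 + 1) / (2 * L2_inner v w)) * L2_inner v w"
        using q[of "((L2_norm v)^2 + 1) / (2 * L2_inner v w)"] True by simp
      then show False using n by (simp add: field_simps)
    qed
    then show ?thesis by simp
  next
    case False
    then have p: "L2_norm w > 0" using L2_norm_nonneg[of w] by linarith
    have "0 \<le> (L2_norm v)^2 - 2 * (L2_inner v w / (L2_norm w)^2) * L2_inner v w
        + (L2_inner v w / (L2_norm w)^2)^2 * (L2_norm w)^2"
      by (rule q)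
    also have "\<dots> = (L2_norm v)^2 - (L2_inner v w)^2 / (L2_norm w)^2"
      using p by (simp add: field_simps power2_eq_square)
    finally have "(L2_inner v w)^2 \<le> (L2_norm v * L2_norm w)^2"
      using p by (simp add: field_simps power_mult_distrib)
    then have "\<bar>L2_inner v w\<bar> \<le> \<bar>L2_norm v * L2_norm w\<bar>"
      using abs_le_square_iff by blast
    then show ?thesis by (simp add: abs_mult)
  qed
qed

lemma L2_norm_triangle:
  assumes "v \<in> L2_space" "w \<in> L2_space"
  shows "L2_norm (\<lambda>x. v x + w x) \<le> L2_norm v + L2_norm w"
proof -
  have "(L2_norm (\<lambda>x. v x + w x))^2 = (L2_norm v)^2 + 2 * L2_inner v w + (L2_norm w)^2"
    using assms unfolding L2_norm_inner
    by (subst L2_inner_add_left, simp_all add: L2_space_add,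
        subst (1 2) L2_inner_commute, subst (1 2) L2_inner_add_left)
       (auto simp: L2_inner_commute[of w v])
  also have "\<dots> \<le> (L2_norm v + L2_norm w)^2"
    using L2_cauchy_schwarz[OF assms] by (simp add: power2_sum abs_le_iff)
  finally show ?thesis
    by (rule power2_le_imp_le) simp
qed

lemma L2_norm_scale: "L2_norm (\<lambda>x. c * w x) = \<bar>c\<bar> * L2_norm w"
  by (simp add: L2_norm_def power_mult_distrib real_sqrt_mult)

lemma L2_norm_minus: "L2_norm (\<lambda>x. v x - w x) = L2_norm (\<lambda>x. w x - v x)"
  by (simp add: L2_norm_def power2_commute)

lemma L2_norm_triangle_diff:
  assumes "u \<in> L2_space" "v \<in> L2_space" "w \<in> L2_space"
  shows "L2_norm (\<lambda>x. u x - w x) \<le> L2_norm (\<lambda>x. u x - v x) + L2_norm (\<lambda>x. v x - w x)"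
  using L2_norm_triangle[of "\<lambda>x. u x - v x" "\<lambda>x. v x - w x"] assms by auto

lemma L2_norm_mono:
  assumes "w \<in> L2_space" "v \<in> borel_measurable borel" "\<And>x. \<bar>v x\<bar> \<le> \<bar>w x\<bar>"
  shows "L2_norm v \<le> L2_norm w"
  unfolding L2_norm_def
  using L2_space_bound[OF assms] assms
  by (intro real_sqrt_le_mono integral_mono L2_space_integrable) (auto simp: abs_le_square_iff)

lemma L2_norm_c_eq: "L2_norm_c w = L2_norm (\<lambda>x. cmod (w x))"
  by (simp add: L2_norm_c_def L2_norm_def)

lemma L2_norm_c_triangle_diff:
  assumes "v \<in> borel_measurable borel" "w \<in> borel_measurable borel"
    and "(\<lambda>x. cmod (v x)) \<in> L2_space" "(\<lambda>x. cmod (w x)) \<in> L2_space"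
  shows "\<bar>L2_norm_c v - L2_norm_c w\<bar> \<le> L2_norm_c (\<lambda>x. v x - w x)"
proof -
  have d: "(\<lambda>x. cmod (v x - w x)) \<in> L2_space"
    using assms by (intro L2_space_bound[OF L2_space_add[OF assms(3,4)]])
      (auto intro: norm_triangle_ineq4 order_trans)
  have le: "L2_norm_c a \<le> L2_norm_c b + L2_norm_c (\<lambda>x. v x - w x)"
    if "(a = v \<and> b = w) \<or> (a = w \<and> b = v)" for a b
  proof -
    have b: "(\<lambda>x. cmod (b x)) \<in> L2_space" "a \<in> borel_measurable borel" using that assms by auto
    have p: "cmod (a x) \<le> cmod (b x) + cmod (v x - w x)" for x
      using that norm_triangle_sub[of "v x" "w x"] norm_triangle_sub[of "w x" "v x"]
      by (auto simp: norm_minus_commute)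
    have "L2_norm_c a \<le> L2_norm (\<lambda>x. cmod (b x) + cmod (v x - w x))"
      unfolding L2_norm_c_eq using b d p
      by (intro L2_norm_mono L2_space_add) auto
    also have "\<dots> \<le> L2_norm (\<lambda>x. cmod (b x)) + L2_norm (\<lambda>x. cmod (v x - w x))"
      using b d by (intro L2_norm_triangle)
    finally show ?thesis by (simp add: L2_norm_c_eq)
  qed
  show ?thesis using le[of v w] le[of w v] by auto
qed

section \<open>Hermite functions\<close>

text \<open>Integrations by parts for classically differentiable functions below are instances of
  this, with F a product that decays at both ends.\<close>

lemma integral_derivative_zero:
  fixes F F' :: "real \<Rightarrow> real"
  assumes "\<And>x. (F has_real_derivative F' x) (at x)" "continuous_on UNIV F'"
    and "integrable lborel F'" "(F \<longlongrightarrow> 0) at_top" "(F \<longlongrightarrow> 0) at_bot"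
  shows "(LINT x|lborel. F' x) = 0"
proof -
  have "(LBINT x=-\<infinity>..\<infinity>. F' x) = 0 - 0"
  proof (rule interval_integral_FTC_integrable[where F=F])
    show "((F \<circ> real_of_ereal) \<longlongrightarrow> 0) (at_right (- \<infinity>))" "((F \<circ> real_of_ereal) \<longlongrightarrow> 0) (at_left \<infinity>)"
      using assms(4,5) by (auto simp: ereal_tendsto_simps)
    show "(F has_vector_derivative F' x) (at x)" for x
      using assms(1) by (simp add: has_real_derivative_iff_has_vector_derivative)
    show "isCont F' x" for x using assms(2) by (simp add: continuous_on_eq_continuous_at)
    show "set_integrable lborel (einterval (- \<infinity>) \<infinity>) F'"
      using assms(3) by (simp add: set_integrable_def einterval_def)
  qed auto
  then show ?thesis by (simp add: interval_lebesgue_integral_def set_lebesgue_integral_def einterval_def)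
qed

section \<open>Decay and integrability of Gaussians times polynomials\<close>

lemma exp_poly_tendsto_0_at_top:
  fixes p :: "real poly" and a :: real
  assumes "a > 0"
  shows "((\<lambda>x. exp (- a * x^2) * poly p x) \<longlongrightarrow> 0) at_top"
proof (induction p)
  case 0 then show ?case by simp
next
  case (pCons c p)
  have e: "((\<lambda>x. exp (- a * x^2) * x^k) \<longlongrightarrow> 0) at_top" for k :: nat
    using assms by real_asymp
  have "((\<lambda>x. exp (- a * x^2) * (\<Sum>i\<le>degree (pCons c p). coeff (pCons c p) i * x^i)) \<longlongrightarrow> 0) at_top"
    unfolding sum_distrib_left
  proof (rule tendsto_null_sum)
    fix i
    show "((\<lambda>x. exp (- a * x^2) * (coeff (pCons c p) i * x^i)) \<longlongrightarrow> 0) at_top"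
      using tendsto_mult_right[OF e[of i], of "coeff (pCons c p) i"] by (simp add: mult_ac)
  qed
  then show ?case by (simp only: poly_altdef)
qed

lemma exp_poly_tendsto_0_at_bot:
  fixes p :: "real poly" and a :: real
  assumes "a > 0"
  shows "((\<lambda>x. exp (- a * x^2) * poly p x) \<longlongrightarrow> 0) at_bot"
  using exp_poly_tendsto_0_at_top[OF assms, of "pcompose p [:0, -1:]"]
  by (simp add: filterlim_at_bot_mirror poly_pcompose)

lemma exp_poly_integrable:
  fixes p :: "real poly" and a :: real
  assumes "a > 0"
  shows "integrable lborel (\<lambda>x. exp (- a * x^2) * poly p x)"
proof -
  have s: "1 / sqrt (2 * a) > 0" using assms by simp
  have "integrable lborel (\<lambda>x. sqrt (pi / a) * (normal_density 0 (1 / sqrt (2 * a)) x * (x - 0)^k))" for k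
    using s by (intro integrable_mult_right integrable_normal_moment)
  moreover have "sqrt (pi / a) * (normal_density 0 (1 / sqrt (2 * a)) x * (x - 0)^k) = exp (- a * x^2) * x^k" for x k
    using assms by (simp add: normal_density_def power_divide real_sqrt_divide field_simps)
  ultimately have e: "integrable lborel (\<lambda>x. exp (- a * x^2) * x^k)" for k :: nat
    by (simp only:)
  have "integrable lborel (\<lambda>x. \<Sum>i\<le>degree p. coeff p i * (exp (- a * x^2) * x^i))"
    by (intro Bochner_Integration.integrable_sum integrable_mult_right e)
  then show ?thesis by (simp add: poly_altdef sum_distrib_left mult_ac)
qed

text \<open>Members of \<open>P_hat\<close> are indexed by their polynomial factor, so that
  derivatives, sums and dilations become operations on polynomials and degree counts are
  available.\<close>

definition gauss_poly :: "real \<Rightarrow> real poly \<Rightarrow> real \<Rightarrow> real" where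
  "gauss_poly \<beta> p x = exp (- (\<beta>^2 * x^2) / 2) * poly p x"

lemma P_hat_gauss_poly: "P_hat N \<beta> = {gauss_poly \<beta> p |p. degree p \<le> N}"
  by (auto simp: P_hat_def gauss_poly_def[abs_def])

lemma gauss_poly_measurable [measurable]: "gauss_poly \<beta> p \<in> borel_measurable borel"
  unfolding gauss_poly_def[abs_def] by (intro borel_measurable_continuous_onI continuous_intros) auto

lemma gauss_poly_mult_eq: "gauss_poly \<beta> p x * gauss_poly \<beta> q x = exp (- (\<beta>^2) * x^2) * poly (p * q) x"
proof -
  have "exp (- (\<beta>^2 * x^2) / 2) * exp (- (\<beta>^2 * x^2) / 2) = exp (- (\<beta>^2) * x^2)"
    by (simp flip: exp_add)
  then show ?thesis by (simp add: gauss_poly_def mult_ac)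
qed

lemma gauss_poly_L2 [intro]:
  assumes "\<beta> \<noteq> 0" shows "gauss_poly \<beta> p \<in> L2_space"
proof -
  have "integrable lborel (\<lambda>x. gauss_poly \<beta> p x * gauss_poly \<beta> p x)"
    unfolding gauss_poly_mult_eq using assms by (intro exp_poly_integrable) simp
  then show ?thesis by (simp add: L2_space_def power2_eq_square)
qed

text \<open>The derivative conjugated by the Gaussian. It can raise the degree by one, so
  differentiation leads out of \<open>P_hat N \<beta>\<close>.\<close>

definition gauss_deriv :: "real \<Rightarrow> real poly \<Rightarrow> real poly" where
  "gauss_deriv \<beta> p = pderiv p - smult (\<beta>^2) ([:0, 1:] * p)"

lemma gauss_poly_has_derivative:
  "(gauss_poly \<beta> p has_real_derivative gauss_poly \<beta> (gauss_deriv \<beta> p) x) (at x)"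
  unfolding gauss_poly_def[abs_def] gauss_deriv_def
  by (auto intro!: derivative_eq_intros simp: algebra_simps power2_eq_square)

lemma deriv_gauss_poly: "deriv (gauss_poly \<beta> p) = gauss_poly \<beta> (gauss_deriv \<beta> p)"
  using gauss_poly_has_derivative by (auto intro!: DERIV_imp_deriv ext)

lemma gauss_poly_continuous: "continuous_on A (gauss_poly \<beta> p)"
  by (intro continuous_at_imp_continuous_on ballI DERIV_isCont[OF gauss_poly_has_derivative])

lemma gauss_poly_add: "gauss_poly \<beta> (p + q) x = gauss_poly \<beta> p x + gauss_poly \<beta> q x"
  and gauss_poly_diff: "gauss_poly \<beta> (p - q) x = gauss_poly \<beta> p x - gauss_poly \<beta> q x"
  and gauss_poly_smult: "gauss_poly \<beta> (smult c p) x = c * gauss_poly \<beta> p x"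
  by (simp_all add: gauss_poly_def algebra_simps)

lemma gauss_poly_sum: "gauss_poly \<beta> (sum p A) x = (\<Sum>i\<in>A. gauss_poly \<beta> (p i) x)"
  by (simp add: gauss_poly_def poly_sum sum_distrib_left)

lemma gauss_deriv_inner:
  "L2_inner (gauss_poly 1 (gauss_deriv 1 p)) (gauss_poly 1 q) = - L2_inner (gauss_poly 1 p) (gauss_poly 1 (gauss_deriv 1 q))"
proof -
  let ?g = "gauss_poly 1"
  have "(LINT x|lborel. ?g (gauss_deriv 1 p) x * ?g q x + ?g p x * ?g (gauss_deriv 1 q) x) = 0"
  proof (rule integral_derivative_zero[where F="\<lambda>x. ?g p x * ?g q x"])
    show "((\<lambda>x. ?g p x * ?g q x) has_real_derivative
       ?g (gauss_deriv 1 p) x * ?g q x + ?g p x * ?g (gauss_deriv 1 q) x) (at x)" for x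
      by (auto intro!: derivative_eq_intros gauss_poly_has_derivative)
    show "((\<lambda>x. ?g p x * ?g q x) \<longlongrightarrow> 0) at_top" "((\<lambda>x. ?g p x * ?g q x) \<longlongrightarrow> 0) at_bot"
      using exp_poly_tendsto_0_at_top[of 1 "p * q"] exp_poly_tendsto_0_at_bot[of 1 "p * q"]
      by (simp_all add: gauss_poly_mult_eq)
  qed (intro continuous_intros gauss_poly_continuous Bochner_Integration.integrable_add
       L2_space_mult_integrable gauss_poly_L2; simp)+
  then show ?thesis
    by (simp add: L2_inner_def L2_space_mult_integrable gauss_poly_L2)
qed

section \<open>Normalized Hermite polynomials: recurrences, differential equation,
  orthonormality\<close>

definition hermite_normal :: "nat \<Rightarrow> real poly" where
  "hermite_normal n = smult (1 / (pi powr (1/4) * sqrt (2^n * fact n))) (hermite_poly n)"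

lemma hermite_fun_gauss_poly: "hermite_fun n = gauss_poly 1 (hermite_normal n)"
  by (simp add: fun_eq_iff hermite_fun_def gauss_poly_def hermite_normal_def)

lemma hermite_poly_Suc: "hermite_poly (Suc n) = [:0, 2:] * hermite_poly n - smult (2 * real n) (hermite_poly (n - 1))"
  by (cases n) auto

lemma pderiv_hermite_poly: "pderiv (hermite_poly n) = smult (2 * real n) (hermite_poly (n - 1))"
proof (induction n rule: less_induct)
  case (less n)
  show ?case
  proof (cases n)
    case 0 then show ?thesis by (simp add: pderiv_1)
  next
    case (Suc m)
    have IH: "pderiv (hermite_poly m) = smult (2 * real m) (hermite_poly (m - 1))"
      "pderiv (hermite_poly (m - 1)) = smult (2 * real (m - 1)) (hermite_poly (m - 2))"
      using less[of m] less[of "m - 1"] Suc by (auto simp: numeral_2_eq_2)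
    have "pderiv (hermite_poly n) = [:2:] * hermite_poly m + [:0, 2:] * smult (2 * real m) (hermite_poly (m - 1))
        - smult (2 * real m) (smult (2 * real (m - 1)) (hermite_poly (m - 2)))"
      unfolding Suc hermite_poly_Suc by (simp only: pderiv_diff pderiv_mult pderiv_smult IH, simp add: pderiv_pCons algebra_simps)
    also have "\<dots> = [:2:] * hermite_poly m + smult (2 * real m) ([:0, 2:] * hermite_poly (m - 1)
        - smult (2 * real (m - 1)) (hermite_poly (m - 2)))"
      by (simp add: smult_diff_right algebra_simps)
    also have "m > 0 \<Longrightarrow> [:0, 2:] * hermite_poly (m - 1) - smult (2 * real (m - 1)) (hermite_poly (m - 2)) = hermite_poly m"
      using hermite_poly_Suc[of "m - 1"] by (simp add: numeral_2_eq_2)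
    then have "[:2:] * hermite_poly m + smult (2 * real m) ([:0, 2:] * hermite_poly (m - 1)
        - smult (2 * real (m - 1)) (hermite_poly (m - 2))) = [:2:] * hermite_poly m + smult (2 * real m) (hermite_poly m)"
      by (cases m) auto
    also have "\<dots> = smult (2 * real n) (hermite_poly m)"
      by (simp add: Suc algebra_simps flip: smult_add_left)
    finally show ?thesis by (simp add: Suc)
  qed
qed

lemma degree_hermite_poly_aux: "degree (hermite_poly n) \<le> n \<and> coeff (hermite_poly n) n = 2^n"
proof (induction n rule: hermite_poly.induct)
  case (3 n)
  have d: "degree (hermite_poly (Suc (Suc n))) \<le> Suc (Suc n)"
    unfolding hermite_poly.simps
    by (intro degree_diff_le order_trans[OF degree_mult_le] order_trans[OF degree_smult_le]) (use 3 in auto)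
  have "coeff (hermite_poly n) (Suc (Suc n)) = 0"
    using 3 by (intro coeff_eq_0) auto
  moreover have "coeff (hermite_poly (Suc n)) (Suc (Suc n)) = 0"
    using 3 by (intro coeff_eq_0) auto
  ultimately show ?case using d 3 by (simp add: mult_pCons_left)
qed auto

lemma hermite_normal_coeff: "coeff (hermite_normal n) n > 0"
  and degree_hermite_normal_le: "degree (hermite_normal n) \<le> n"
  using degree_hermite_poly_aux[of n] by (auto simp: hermite_normal_def)

lemma degree_hermite_normal: "degree (hermite_normal n) = n"
  using le_degree[of "hermite_normal n" n] hermite_normal_coeff[of n] degree_hermite_normal_le[of n] by auto

lemma two_sqrt_half: "2 * sqrt (t / 2) = sqrt (2 * t)"
  using real_sqrt_mult[of 4 "t / 2"] by simp

text \<open>Written with \<open>2 * sqrt ((n + 1) / 2)\<close> because sqrt ((n + 1) / 2) is the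
  coefficient that appears in the normalized recurrences.\<close>

lemma hermite_normalization:
  "1 / (pi powr (1/4) * sqrt (2^n * fact n))
     = 2 * sqrt ((real n + 1) / 2) * (1 / (pi powr (1/4) * sqrt (2^Suc n * fact (Suc n))))"
proof -
  have "(2::real)^Suc n * fact (Suc n) = 2 * (real n + 1) * (2^n * fact n)"
    by (simp add: algebra_simps)
  then have "sqrt (2^Suc n * fact (Suc n)) = sqrt (2 * (real n + 1)) * sqrt (2^n * fact n)"
    by (simp only: real_sqrt_mult)
  then show ?thesis unfolding two_sqrt_half by simp
qed

text \<open>The recurrence for the Hermite polynomials after normalization. At n = 0 the truncated
  \<open>n - 1\<close> is harmless because its coefficient sqrt (n / 2) vanishes; later recurrences
  rely on the same convention.\<close>

lemma hermite_normal_x: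
  "[:0, 1:] * hermite_normal n = smult (sqrt ((real n + 1) / 2)) (hermite_normal (Suc n))
     + smult (sqrt (real n / 2)) (hermite_normal (n - 1))"
proof -
  let ?K = "\<lambda>n. 1 / (pi powr (1/4) * sqrt (2^n * fact n))"
  note K = hermite_normalization
  have e1: "sqrt ((real n + 1) / 2) * ?K (Suc n) = ?K n / 2"
    by (subst K) simp
  have e2: "sqrt (real n / 2) * ?K (n - 1) = real n * ?K n"
  proof (cases n)
    case (Suc m)
    have "sqrt (real n / 2) * ?K (n - 1) = sqrt (real n / 2) * sqrt (real n / 2) * 2 * ?K n"
      unfolding Suc diff_Suc_1 K[of m] by (simp only: mult_ac of_nat_Suc add.commute)
    moreover have "sqrt (real n / 2) * sqrt (real n / 2) * 2 = real n" by simp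
    ultimately show ?thesis by (simp only:)
  qed simp
  have "[:0, 2:] * hermite_poly n = hermite_poly (Suc n) + smult (2 * real n) (hermite_poly (n - 1))"
    using hermite_poly_Suc[of n] by simp
  then have "smult (1/2) ([:0, 2:] * hermite_poly n) = smult (1/2) (hermite_poly (Suc n)) + smult (real n) (hermite_poly (n - 1))"
    by (simp add: smult_add_right)
  then have "smult (?K n) ([:0, 1:] * hermite_poly n) = smult (?K n) (smult (1/2) (hermite_poly (Suc n)) + smult (real n) (hermite_poly (n - 1)))"
    by simp
  also have "\<dots> = smult (?K n / 2) (hermite_poly (Suc n)) + smult (real n * ?K n) (hermite_poly (n - 1))"
    by (simp add: smult_add_right mult.commute)
  finally show ?thesis
    unfolding hermite_normal_def smult_smult e1 e2 by simp
qed

lemma hermite_normal_pderiv: "pderiv (hermite_normal n) = smult (2 * sqrt (real n / 2)) (hermite_normal (n - 1))"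
proof (cases n)
  case (Suc m)
  let ?K = "\<lambda>n. 1 / (pi powr (1/4) * sqrt (2^n * fact n))"
  have "2 * sqrt (real n / 2) * ?K m = 2 * (sqrt (real n / 2) * sqrt (real n / 2)) * 2 * ?K n"
    unfolding hermite_normalization[of m] by (simp add: Suc add.commute)
  then have "1 / (pi powr (1/4) * sqrt (2^n * fact n)) * (2 * real n) = 2 * sqrt (real n / 2) * (1 / (pi powr (1/4) * sqrt (2^m * fact m)))"
    by simp
  then show ?thesis by (simp add: hermite_normal_def pderiv_smult pderiv_hermite_poly Suc)
qed (simp add: hermite_normal_def pderiv_smult pderiv_1)

lemma hermite_normal_gauss_deriv:
  "gauss_deriv 1 (hermite_normal n) = smult (sqrt (real n / 2)) (hermite_normal (n - 1))
     - smult (sqrt ((real n + 1) / 2)) (hermite_normal (Suc n))"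
proof -
  have "gauss_deriv 1 (hermite_normal n) = pderiv (hermite_normal n) - [:0, 1:] * hermite_normal n"
    by (simp add: gauss_deriv_def)
  also have "\<dots> = smult (2 * sqrt (real n / 2)) (hermite_normal (n - 1)) - (smult (sqrt ((real n + 1) / 2)) (hermite_normal (Suc n))
     + smult (sqrt (real n / 2)) (hermite_normal (n - 1)))"
    unfolding hermite_normal_x hermite_normal_pderiv ..
  finally show ?thesis
    by (simp only: mult_2 smult_add_left diff_add_eq_diff_diff_swap add_diff_cancel_left')
qed

lemma gauss_deriv_x: "gauss_deriv 1 ([:0, 1:] * p) = p + [:0, 1:] * gauss_deriv 1 p"
proof -
  have "pderiv ([:0, 1:] * p) = p + [:0, 1:] * pderiv p"
    by (simp add: pderiv_mult pderiv_pCons algebra_simps)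
  then show ?thesis by (simp add: gauss_deriv_def algebra_simps)
qed

lemma gauss_deriv_diff: "gauss_deriv \<beta> (p - q) = gauss_deriv \<beta> p - gauss_deriv \<beta> q"
  by (simp add: gauss_deriv_def pderiv_diff algebra_simps smult_diff_right)

text \<open>With D the conjugated derivative, x - D raises and x + D lowers the index. Their product
  (x + D)(x - D) = x^2 + 1 - D^2 acts on the n-th polynomial as multiplication by 2 (n + 1).\<close>

lemma hermite_normal_ode:
  "gauss_deriv 1 (gauss_deriv 1 (hermite_normal n)) = [:- (2 * real n + 1), 0, 1:] * hermite_normal n"
proof -
  let ?h = "hermite_normal" and ?x = "[:0, 1:] :: real poly"
  have up: "?x * ?h n - gauss_deriv 1 (?h n) = smult (2 * sqrt ((real n + 1) / 2)) (?h (Suc n))"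
    unfolding hermite_normal_x hermite_normal_gauss_deriv mult_2 smult_add_left by simp
  have down: "?x * p + gauss_deriv 1 p = pderiv p" for p
    by (simp add: gauss_deriv_def)
  let ?q = "?x * ?h n - gauss_deriv 1 (?h n)"
  have "?x * ?q + gauss_deriv 1 ?q = ?x * (?x * ?h n) + ?h n - gauss_deriv 1 (gauss_deriv 1 (?h n))"
    unfolding gauss_deriv_diff gauss_deriv_x by (simp add: algebra_simps)
  moreover have "?x * ?q + gauss_deriv 1 ?q = smult (2 * (real n + 1)) (?h n)"
    unfolding down up two_sqrt_half by (simp add: pderiv_smult hermite_normal_pderiv two_sqrt_half add.commute)
  ultimately have "gauss_deriv 1 (gauss_deriv 1 (?h n)) = ?x * (?x * ?h n) + ?h n - smult (2 * (real n + 1)) (?h n)"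
    by (simp add: algebra_simps)
  moreover have "smult (2 * (real n + 1)) (?h n) = smult (2 * real n + 1) (?h n) + ?h n"
  proof -
    have "2 * (real n + 1) = (2 * real n + 1) + 1" by simp
    then show ?thesis by (simp only: smult_add_left smult_1_left)
  qed
  ultimately have "gauss_deriv 1 (gauss_deriv 1 (?h n)) = ?x * (?x * ?h n) - smult (2 * real n + 1) (?h n)"
    by (simp only:)
  then show ?thesis using smult_minus_left[of "2 * real n + 1" "?h n"] by simp
qed

lemma hermite_fun_L2 [intro, simp]: "hermite_fun n \<in> L2_space"
  by (simp add: hermite_fun_gauss_poly gauss_poly_L2)

text \<open>The raising operator x - d/dx on one factor is the adjoint of the lowering operator x +
  d/dx on the other. Stripping one index from each side drives the induction for
  orthonormality.\<close>

lemma hermite_ladder: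
  "sqrt (real (Suc n)) * L2_inner (hermite_fun (Suc n)) (hermite_fun m) = sqrt (real m) * L2_inner (hermite_fun n) (hermite_fun (m - 1))"
proof -
  let ?h = "hermite_normal" and ?x = "[:0, 1:] :: real poly" and ?g = "gauss_poly 1"
  have L: "?g p \<in> L2_space" for p by auto
  have s: "2 * sqrt (a / 2) = sqrt 2 * sqrt a" for a
    by (simp add: real_sqrt_divide field_simps)
  have up: "?g (?x * ?h n) x - ?g (gauss_deriv 1 (?h n)) x = sqrt 2 * sqrt (real n + 1) * hermite_fun (Suc n) x" for x
    unfolding hermite_normal_x hermite_normal_gauss_deriv hermite_fun_gauss_poly s[symmetric]
    by (simp add: gauss_poly_add gauss_poly_diff gauss_poly_smult)
  have down: "?g (?x * ?h m) x + ?g (gauss_deriv 1 (?h m)) x = sqrt 2 * sqrt (real m) * hermite_fun (m - 1) x" for x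
    unfolding hermite_normal_x hermite_normal_gauss_deriv hermite_fun_gauss_poly s[symmetric]
    by (simp add: gauss_poly_add gauss_poly_diff gauss_poly_smult)
  have "sqrt 2 * sqrt (real n + 1) * L2_inner (hermite_fun (Suc n)) (?g (?h m))
      = L2_inner (\<lambda>x. ?g (?x * ?h n) x - ?g (gauss_deriv 1 (?h n)) x) (?g (?h m))"
    unfolding up by (simp add: L2_inner_scale_left)
  also have "\<dots> = L2_inner (?g (?x * ?h n)) (?g (?h m)) - L2_inner (?g (gauss_deriv 1 (?h n))) (?g (?h m))"
    by (rule L2_inner_diff_left[OF L L L])
  also have "L2_inner (?g (?x * ?h n)) (?g (?h m)) = L2_inner (?g (?x * ?h m)) (?g (?h n))"
    by (simp add: L2_inner_def gauss_poly_def mult_ac)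
  also have "L2_inner (?g (gauss_deriv 1 (?h n))) (?g (?h m)) = - L2_inner (?g (gauss_deriv 1 (?h m))) (?g (?h n))"
    by (simp add: gauss_deriv_inner L2_inner_commute[of "?g (?h n)"])
  also have "L2_inner (?g (?x * ?h m)) (?g (?h n)) - - L2_inner (?g (gauss_deriv 1 (?h m))) (?g (?h n))
     = L2_inner (\<lambda>x. ?g (?x * ?h m) x + ?g (gauss_deriv 1 (?h m)) x) (?g (?h n))"
    by (subst L2_inner_add_left[OF L L L]) simp
  also have "\<dots> = sqrt 2 * sqrt (real m) * L2_inner (hermite_fun (m - 1)) (?g (?h n))"
    unfolding down by (simp add: L2_inner_scale_left)
  finally have "sqrt 2 * (sqrt (real n + 1) * L2_inner (hermite_fun (Suc n)) (hermite_fun m))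
     = sqrt 2 * (sqrt (real m) * L2_inner (hermite_fun n) (hermite_fun (m - 1)))"
    by (simp only: hermite_fun_gauss_poly[symmetric] mult.assoc L2_inner_commute)
  then show ?thesis by (simp add: add.commute)
qed

lemma hermite_fun_0_norm: "L2_inner (hermite_fun 0) (hermite_fun 0) = 1"
proof -
  have "hermite_fun 0 x * hermite_fun 0 x = normal_density 0 (1 / sqrt 2) x" for x
  proof -
    have "pi powr (1/4) * pi powr (1/4) = sqrt pi"
      by (simp add: powr_half_sqrt flip: powr_add)
    then show ?thesis
      by (simp add: hermite_fun_def normal_density_def field_simps power_divide flip: exp_add)
  qed
  then show ?thesis by (simp add: L2_inner_def)
qed

lemma hermite_orthonormal: "L2_inner (hermite_fun m) (hermite_fun n) = (if m = n then 1 else 0)"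
proof (induction n arbitrary: m)
  case 0
  show ?case
  proof (cases m)
    case (Suc k) then show ?thesis using hermite_ladder[of k 0] by simp
  qed (simp add: hermite_fun_0_norm)
next
  case (Suc n)
  show ?case
  proof (cases m)
    case 0 then show ?thesis using hermite_ladder[of n 0] by (simp add: L2_inner_commute)
  next
    case (Suc k)
    then show ?thesis using hermite_ladder[of k "Suc n"] Suc.IH[of k] by (auto split: if_splits)
  qed
qed

lemma hermite_normal_expansion:
  assumes "degree p \<le> N"
  shows "\<exists>a. p = (\<Sum>k\<le>N. smult (a k) (hermite_normal k))"
  using assms
proof (induction N arbitrary: p)
  case 0
  then obtain c where "p = [:c:]" using degree_eq_zeroE by blast
  moreover obtain d where "hermite_normal 0 = [:d:]"
    using degree_hermite_normal[of 0] degree_eq_zeroE by blast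
  ultimately show ?case
    using hermite_normal_coeff[of 0] by (auto intro!: exI[of _ "\<lambda>_. c / d"])
next
  case (Suc N)
  define c where "c = coeff p (Suc N) / coeff (hermite_normal (Suc N)) (Suc N)"
  have "degree (p - smult c (hermite_normal (Suc N))) \<le> N"
  proof (rule degree_le, intro allI impI)
    fix i assume "N < i"
    then consider "i = Suc N" | "i > Suc N" by linarith
    then show "coeff (p - smult c (hermite_normal (Suc N))) i = 0"
    proof cases
      case 1 then show ?thesis using hermite_normal_coeff[of "Suc N"] by (simp add: c_def)
    next
      case 2 then show ?thesis using Suc.prems degree_hermite_normal[of "Suc N"] by (simp add: coeff_eq_0)
    qed
  qed
  then obtain a where a: "p - smult c (hermite_normal (Suc N)) = (\<Sum>k\<le>N. smult (a k) (hermite_normal k))"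
    using Suc.IH by blast
  have "p = (\<Sum>k\<le>N. smult (a k) (hermite_normal k)) + smult c (hermite_normal (Suc N))"
    using a by (simp add: algebra_simps)
  also have "\<dots> = (\<Sum>k\<le>Suc N. smult ((a(Suc N := c)) k) (hermite_normal k))"
    by (auto intro!: sum.cong)
  finally show ?case by blast
qed

lemma hermite_fun_orthogonal_lower:
  assumes "degree p < n"
  shows "L2_inner (gauss_poly 1 p) (hermite_fun n) = 0"
proof -
  obtain a where "p = (\<Sum>k\<le>n - 1. smult (a k) (hermite_normal k))"
    using hermite_normal_expansion[of p "n - 1"] assms by (metis Suc_pred' less_Suc_eq_le not_less_zero gr0I)
  then have "gauss_poly 1 p = (\<lambda>x. \<Sum>k\<le>n - 1. a k * hermite_fun k x)"
    by (auto simp: gauss_poly_sum gauss_poly_smult hermite_fun_gauss_poly)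
  then show ?thesis
    using assms by (subst \<open>gauss_poly 1 p = _\<close>, subst L2_inner_sum_left) (auto simp: hermite_orthonormal intro!: sum.neutral)
qed

lemma hermite_fun_x:
  "x * hermite_fun n x = sqrt ((real n + 1) / 2) * hermite_fun (Suc n) x + sqrt (real n / 2) * hermite_fun (n - 1) x"
proof -
  have "x * hermite_fun n x = gauss_poly 1 ([:0, 1:] * hermite_normal n) x"
    by (simp add: hermite_fun_gauss_poly gauss_poly_def)
  then show ?thesis
    unfolding hermite_normal_x by (simp add: gauss_poly_add gauss_poly_smult hermite_fun_gauss_poly)
qed

lemma hermite_fun_deriv:
  "deriv (hermite_fun n) x = sqrt (real n / 2) * hermite_fun (n - 1) x - sqrt ((real n + 1) / 2) * hermite_fun (Suc n) x"
  unfolding hermite_fun_gauss_poly deriv_gauss_poly hermite_normal_gauss_deriv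
  by (simp add: gauss_poly_diff gauss_poly_smult)

lemma hermite_fun_has_derivative: "(hermite_fun n has_real_derivative deriv (hermite_fun n) x) (at x)"
  unfolding hermite_fun_gauss_poly deriv_gauss_poly by (rule gauss_poly_has_derivative)

lemma hermite_fun_has_derivative2:
  "(deriv (hermite_fun n) has_real_derivative (x^2 - (2 * real n + 1)) * hermite_fun n x) (at x)"
proof -
  have "(deriv (hermite_fun n) has_real_derivative gauss_poly 1 (gauss_deriv 1 (gauss_deriv 1 (hermite_normal n))) x) (at x)"
    unfolding hermite_fun_gauss_poly deriv_gauss_poly by (rule gauss_poly_has_derivative)
  then show ?thesis
    unfolding hermite_normal_ode by (simp add: gauss_poly_def hermite_fun_gauss_poly power2_eq_square algebra_simps)
qed

section \<open>Zeros of Hermite functions\<close>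

text \<open>By the recurrence a common zero would descend to \<open>hermite_fun 0\<close>, which
  never vanishes. Since h_n' is a multiple of h_(n-1) at a zero of h_n, all zeros turn out
  simple.\<close>

lemma hermite_fun_consecutive_nonzero: "hermite_fun n x \<noteq> 0 \<or> hermite_fun (Suc n) x \<noteq> 0"
proof (induction n)
  case 0
  show ?case by (simp add: hermite_fun_def)
next
  case (Suc n)
  then show ?case using hermite_fun_x[of x "Suc n"] by (auto simp: add_nonneg_eq_0_iff)
qed

lemma hermite_fun_deriv_at_zero:
  assumes "hermite_fun n x = 0"
  shows "deriv (hermite_fun n) x = sqrt (2 * real n) * hermite_fun (n - 1) x"
  unfolding two_sqrt_half[symmetric]
  using hermite_fun_x[of x n, unfolded assms mult_zero_right] hermite_fun_deriv[of n x] by linarith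

lemma hermite_fun_simple_zero:
  assumes "hermite_fun n x = 0"
  shows "deriv (hermite_fun n) x \<noteq> 0"
proof (cases n)
  case 0
  then show ?thesis using assms by (simp add: hermite_fun_def)
next
  case (Suc m)
  then show ?thesis
    using hermite_fun_consecutive_nonzero[of m x] assms by (simp add: hermite_fun_deriv_at_zero)
qed

definition hermite_zeros :: "nat \<Rightarrow> real set" where
  "hermite_zeros n = {x. hermite_fun n x = 0}"

lemma hermite_zeros_poly: "hermite_zeros n = {x. poly (hermite_normal n) x = 0}"
  by (simp add: hermite_zeros_def hermite_fun_gauss_poly gauss_poly_def)

lemma hermite_normal_nonzero: "hermite_normal n \<noteq> 0"
  using hermite_normal_coeff[of n] by auto

lemma finite_hermite_zeros [simp]: "finite (hermite_zeros n)"
  unfolding hermite_zeros_poly by (rule poly_roots_finite[OF hermite_normal_nonzero])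

lemma hermite_fun_minus: "hermite_fun n (- x) = (-1)^n * hermite_fun n x"
proof (induction n rule: less_induct)
  case (less n)
  consider "n = 0" | m where "n = Suc m" by (cases n) auto
  then show ?case
  proof cases
    case 1 then show ?thesis by (simp add: hermite_fun_def)
  next
    case 2
    have IH: "hermite_fun m (- x) = (-1)^m * hermite_fun m x"
      "sqrt (real m / 2) * hermite_fun (m - 1) (- x) = - sqrt (real m / 2) * ((-1)^m * hermite_fun (m - 1) x)"
      using less[of m] less[of "m - 1"] 2 by (auto, cases m) auto
    have "sqrt ((real m + 1) / 2) * hermite_fun (Suc m) (- x) = - x * hermite_fun m (- x) - sqrt (real m / 2) * hermite_fun (m - 1) (- x)"
      using hermite_fun_x[of "-x" m] by simp
    also have "\<dots> = - ((-1)^m) * (x * hermite_fun m x - sqrt (real m / 2) * hermite_fun (m - 1) x)"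
      unfolding IH by (simp add: algebra_simps)
    also have "\<dots> = sqrt ((real m + 1) / 2) * ((-1)^Suc m * hermite_fun (Suc m) x)"
      using hermite_fun_x[of x m] by simp
    finally show ?thesis unfolding 2 by (subst (asm) mult_cancel_left) (auto simp: add_nonneg_eq_0_iff)
  qed
qed

lemma hermite_zeros_minus: "x \<in> hermite_zeros n \<Longrightarrow> - x \<in> hermite_zeros n"
  by (simp add: hermite_zeros_def hermite_fun_minus)

lemma hermite_fun_tendsto_0: "(hermite_fun n \<longlongrightarrow> 0) at_top"
  using exp_poly_tendsto_0_at_top[of "1/2" "hermite_normal n"]
  by (simp add: hermite_fun_gauss_poly gauss_poly_def[abs_def])

lemma hermite_fun_continuous: "continuous_on A (hermite_fun n)"
  unfolding hermite_fun_gauss_poly by (rule gauss_poly_continuous)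

(* If the last zero were closer to the turning point sqrt (2 n + 1) than the bound allows, the
   function would still be increasing at the turning point, and convexity beyond it would
   contradict the decay at infinity. *)
lemma hermite_largest_zero:
  assumes "hermite_zeros n \<noteq> {}"
  defines "a \<equiv> Max (hermite_zeros n)" and "l \<equiv> 2 * real n + 1"
  shows "0 \<le> a" "2 * l \<le> (l - a^2)^3"
proof -
  have aZ: "a \<in> hermite_zeros n" unfolding a_def using assms(1) by (intro Max_in) auto
  have max: "x \<le> a" if "x \<in> hermite_zeros n" for x unfolding a_def using that by simp
  show a0: "0 \<le> a" using max[OF hermite_zeros_minus[OF aZ]] by simp
  have l1: "l \<ge> 1" by (simp add: l_def)
  show "2 * l \<le> (l - a^2)^3"
  proof (rule ccontr)
    assume contra: "\<not> 2 * l \<le> (l - a^2)^3"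
    \<comment> \<open>q dominates l - t^2 for t beyond a. b is the turning point, or a itself if a
      lies past it, a case not yet excluded here.\<close>
    define q where "q = max 0 (l - a^2)"
    define b where "b = max a (sqrt l)"
    define s where "s = sgn (deriv (hermite_fun n) a)"
    define Y where "Y x = s * hermite_fun n x" for x
    define Y' where "Y' x = s * deriv (hermite_fun n) x" for x
    have dY: "(Y has_real_derivative Y' x) (at x)" for x
      unfolding Y_def[abs_def] Y'_def by (intro DERIV_cmult hermite_fun_has_derivative)
    have dY': "(Y' has_real_derivative (x^2 - l) * Y x) (at x)" for x
      unfolding Y_def Y'_def[abs_def] l_def
      using DERIV_cmult[OF hermite_fun_has_derivative2[of n x], of s] by (simp add: mult_ac)
    have Ya: "Y a = 0" using aZ by (simp add: Y_def hermite_zeros_def)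
    have s0: "s \<noteq> 0" using hermite_fun_simple_zero[of n a] aZ by (simp add: s_def hermite_zeros_def sgn_eq_0_iff)
    have Y'a: "Y' a > 0" using s0 unfolding Y'_def s_def by (simp add: sgn_real_def split: if_splits)
    have contY: "continuous_on A Y" for A
      unfolding Y_def[abs_def] by (intro continuous_intros hermite_fun_continuous)
    have Ypos: "Y x > 0" if "x > a" for x
    proof (rule ccontr)
      assume "\<not> Y x > 0"
      then have "Y x \<le> 0" by simp
      obtain d where d: "d > 0" "\<And>h. 0 < h \<Longrightarrow> h < d \<Longrightarrow> Y a < Y (a + h)"
        using DERIV_pos_inc_right[OF dY Y'a] by blast
      define h where "h = min (d/2) ((x - a)/2)"
      have h: "0 < h" "h < d" "a + h < x" using d(1) that by (auto simp: h_def min_def field_simps)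
      have "Y (a + h) > 0" using d(2)[OF h(1,2)] Ya by simp
      then obtain z where "a + h \<le> z" "z \<le> x" "Y z = 0"
        using IVT2'[of Y x 0 "a + h"] \<open>Y x \<le> 0\<close> h contY by force
      then show False using max[of z] h s0 by (simp add: Y_def hermite_zeros_def)
    qed
    have Ynn: "Y x \<ge> 0" if "x \<ge> a" for x
      using that Ya Ypos[of x] by (cases "x = a") auto
    have sq: "(sqrt l)^2 = l" using l1 by simp
    \<comment> \<open>From (b - a)(b + a) = q and b + a \<ge> sqrt l follows b - a \<le> q / sqrt l,
      so q (b - a)^2 \<le> q^3 / l < 2 by the negated claim. This is the origin of the cube and of
      the factor 2.\<close>
    have qb: "q * (b - a)^2 < 2"
    proof (cases "a < sqrt l")
      case True
      have "a^2 < l" using power_strict_mono[of a "sqrt l" 2] a0 True sq by simp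
      then have q: "q = l - a^2" "q > 0" by (auto simp: q_def)
      have b: "b = sqrt l" using True by (simp add: b_def)
      have "(b - a) * (b + a) = q" unfolding b q using sq by (simp add: power2_eq_square algebra_simps)
      moreover have "(b - a) * sqrt l \<le> (b - a) * (b + a)"
        using True a0 b by (intro mult_left_mono) auto
      ultimately have "(b - a) * sqrt l \<le> q" by simp
      moreover have "0 \<le> (b - a) * sqrt l" using True l1 by (simp add: b)
      ultimately have "((b - a) * sqrt l)^2 \<le> q^2" by (rule power_mono)
      then have "(b - a)^2 * l \<le> q^2" using sq by (simp add: power_mult_distrib)
      then have "q * ((b - a)^2 * l) \<le> q * q^2" using q by (intro mult_left_mono) auto
      also have "\<dots> < 2 * l" using contra q by (simp add: power3_eq_cube power2_eq_square)
      finally have "(q * (b - a)^2) * l < 2 * l" by (simp add: mult_ac)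
      then show ?thesis using l1 by simp
    qed (auto simp: b_def)
    have Y'le: "Y' x \<le> Y' a" if "a \<le> x" "x \<le> b" for x
    proof (rule DERIV_nonpos_imp_nonincreasing[OF that(1)], intro exI conjI)
      fix t assume t: "a \<le> t" "t \<le> x"
      show "(Y' has_real_derivative (t^2 - l) * Y t) (at t)" by (rule dY')
      show "(t^2 - l) * Y t \<le> 0"
      proof (cases "a < sqrt l")
        case True
        then have "t \<le> sqrt l" using t that by (auto simp: b_def)
        then have "t^2 \<le> l" using a0 t sq power_mono[of t "sqrt l" 2] by auto
        then show ?thesis using Ynn[OF t(1)] by (simp add: mult_nonpos_nonneg)
      next
        case False
        then have "t = a" using t that by (auto simp: b_def)
        then show ?thesis using Ya by simp
      qed
    qed
    have Yle: "Y x \<le> Y' a * (x - a)" if x: "a \<le> x" "x \<le> b" for x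
    proof -
      have "Y x - Y' a * (x - a) \<le> Y a - Y' a * (a - a)"
      proof (rule DERIV_nonpos_imp_nonincreasing[OF x(1), where f="\<lambda>x. Y x - Y' a * (x - a)"], intro exI conjI)
        fix t assume t: "a \<le> t" "t \<le> x"
        show "((\<lambda>x. Y x - Y' a * (x - a)) has_real_derivative Y' t - Y' a) (at t)"
          by (auto intro!: derivative_eq_intros dY)
        show "Y' t - Y' a \<le> 0" using Y'le[of t] t x by simp
      qed
      then show ?thesis using Ya by simp
    qed
    \<comment> \<open>By the tangent bound on Y, Y'' \<ge> - q Y'(a) (t - a). Integrated, the slope
      loses at most q Y'(a) (b - a)^2 / 2 < Y'(a) on the way to b and is still positive
      there.\<close>
    have "Y' a + q * Y' a * (a - a)^2 / 2 \<le> Y' b + q * Y' a * (b - a)^2 / 2"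
    proof (rule DERIV_nonneg_imp_nondecreasing[where f="\<lambda>x. Y' x + q * Y' a * (x - a)^2 / 2"])
      show "a \<le> b" by (simp add: b_def)
      fix t assume t: "a \<le> t" "t \<le> b"
      have "(l - t^2) * Y t \<le> q * (Y' a * (t - a))"
      proof (cases "l - t^2 \<ge> 0")
        case True
        have "a^2 \<le> t^2" using t a0 by (intro power_mono) auto
        then have "l - t^2 \<le> q" by (simp add: q_def)
        then show ?thesis using True Yle[OF t] Ynn[OF t(1)] by (intro mult_mono) (auto simp: q_def)
      next
        case False
        then have "(l - t^2) * Y t \<le> 0" using Ynn[OF t(1)] by (intro mult_nonpos_nonneg) auto
        also have "0 \<le> q * (Y' a * (t - a))" using t Y'a by (auto simp: q_def)
        finally show ?thesis .
      qed
      then have nn: "0 \<le> (t^2 - l) * Y t + q * Y' a * (t - a)" by (simp add: algebra_simps)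
      have "((\<lambda>x. Y' x + q * Y' a * (x - a)^2 / 2) has_real_derivative (t^2 - l) * Y t + q * Y' a * (t - a)) (at t)"
        by (auto intro!: derivative_eq_intros dY' simp: field_simps)
      then show "\<exists>y. ((\<lambda>x. Y' x + q * Y' a * (x - a)^2 / 2) has_real_derivative y) (at t) \<and> 0 \<le> y"
        using nn by blast
    qed
    then have "Y' a * (1 - q * (b - a)^2 / 2) \<le> Y' b" by (simp add: algebra_simps)
    moreover have "0 < Y' a * (1 - q * (b - a)^2 / 2)" using Y'a qb by (intro mult_pos_pos) auto
    ultimately have Y'b: "Y' b > 0" by linarith
    have ab: "a \<le> b" "0 \<le> b" "sqrt l \<le> b" using a0 by (auto simp: b_def)
    have Y'x: "Y' x \<ge> 0" if "x \<ge> b" for x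
    proof -
      have "Y' b \<le> Y' x"
      proof (rule DERIV_nonneg_imp_nondecreasing[OF that], intro exI conjI)
        fix t assume t: "b \<le> t" "t \<le> x"
        show "(Y' has_real_derivative (t^2 - l) * Y t) (at t)" by (rule dY')
        have "sqrt l \<le> t" using t ab by auto
        then have "(sqrt l)^2 \<le> t^2" using l1 by (intro power_mono) auto
        then show "0 \<le> (t^2 - l) * Y t" using Ynn[of t] t ab sq by (intro mult_nonneg_nonneg) auto
      qed
      then show ?thesis using Y'b by simp
    qed
    have Yinc: "Y (b + 1) \<le> Y x" if "x \<ge> b + 1" for x
      using that Y'x by (intro DERIV_nonneg_imp_nondecreasing[OF that]) (auto intro!: exI dY)
    have "(Y \<longlongrightarrow> s * 0) at_top" unfolding Y_def[abs_def] by (intro tendsto_mult_left hermite_fun_tendsto_0)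
    then have "Y (b + 1) \<le> s * 0"
      by (rule tendsto_lowerbound) (auto intro!: eventually_at_top_linorderI Yinc)
    then show False using Ypos[of "b + 1"] ab by simp
  qed
qed

text \<open>Symmetry of the zero set puts every zero, in absolute value, below the largest one.
  Positivity of the cube gives positivity of its base, so the bound is monotone in x^2.\<close>

lemma hermite_zero_bound:
  assumes "x \<in> hermite_zeros n"
  shows "2 * (2 * real n + 1) \<le> (2 * real n + 1 - x^2)^3" "x^2 < 2 * real n + 1"
proof -
  let ?a = "Max (hermite_zeros n)" and ?l = "2 * real n + 1"
  have ne: "hermite_zeros n \<noteq> {}" using assms by auto
  have "x \<le> ?a" "- x \<le> ?a" using assms hermite_zeros_minus[OF assms] by auto
  then have "x^2 \<le> ?a^2" by (metis abs_le_iff abs_le_square_iff abs_of_nonneg hermite_largest_zero(1)[OF ne])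
  have p: "2 * ?l \<le> (?l - ?a^2)^3" by (rule hermite_largest_zero(2)[OF ne])
  have "0 < ?l - ?a^2"
  proof (rule ccontr)
    assume "\<not> ?thesis"
    then have "(?l - ?a^2)^3 \<le> 0" by (simp add: power3_eq_cube mult_nonneg_nonpos mult_nonpos_nonpos)
    from order_trans[OF p this] show False by simp
  qed
  then have "(?l - ?a^2)^3 \<le> (?l - x^2)^3" using \<open>x^2 \<le> ?a^2\<close> by (intro power_mono) auto
  with p show "2 * ?l \<le> (?l - x^2)^3" by linarith
  show "x^2 < ?l" using \<open>0 < ?l - ?a^2\<close> \<open>x^2 \<le> ?a^2\<close> by linarith
qed

text \<open>A replacement for Stirling's formula: h_(2m+2)(0)^2 = (2m+1)/(2m+2) h_(2m)(0)^2, and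
  (4m+1) h_(2m)(0)^4 is nondecreasing since (4m+5)(2m+1)^2 exceeds (4m+1)(2m+2)^2 by exactly 1. The
  factor 4m+1 is the energy 2n+1 at n = 2m.\<close>

lemma hermite_fun_even_at_0: "1 / pi \<le> (4 * real m + 1) * ((hermite_fun (2 * m) 0)^2)^2"
proof (induction m)
  case 0
  have "(1 / pi powr (1/4))^4 = 1 / pi"
    by (simp add: power_divide powr_power)
  then show ?case by (simp add: hermite_fun_def flip: power_mult)
next
  case (Suc m)
  let ?h = "\<lambda>n. hermite_fun n 0"
  have "sqrt ((2 * real m + 2) / 2) * ?h (2 * Suc m) = - sqrt ((2 * real m + 1) / 2) * ?h (2 * m)"
    using hermite_fun_x[of 0 "Suc (2 * m)"] by (simp add: add_ac)
  then have "(sqrt ((2 * real m + 2) / 2) * ?h (2 * Suc m))^2 = (- sqrt ((2 * real m + 1) / 2) * ?h (2 * m))^2"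
    by (rule arg_cong)
  then have e: "(?h (2 * Suc m))^2 = (2 * real m + 1) / (2 * real m + 2) * (?h (2 * m))^2"
    by (simp add: power_mult_distrib field_simps)
  have "(4 * real m + 1) * (2 * real m + 2)^2 \<le> (4 * real m + 5) * (2 * real m + 1)^2"
    by (simp add: power2_eq_square algebra_simps)
  then have c: "4 * real m + 1 \<le> (4 * real m + 5) * ((2 * real m + 1) / (2 * real m + 2))^2"
    by (simp add: power_divide pos_le_divide_eq)
  have "1 / pi \<le> (4 * real m + 1) * ((?h (2 * m))^2)^2" by (rule Suc.IH)
  also have "\<dots> \<le> (4 * real m + 5) * ((2 * real m + 1) / (2 * real m + 2))^2 * ((?h (2 * m))^2)^2"
    using c by (intro mult_right_mono) auto
  also have "\<dots> = (4 * real (Suc m) + 1) * ((?h (2 * Suc m))^2)^2"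
    unfolding e by (simp add: power_mult_distrib power_divide add_ac)
  finally show ?case .
qed

lemma hermite_fun_even_at_0': "1 / sqrt (pi * (4 * real m + 1)) \<le> (hermite_fun (2 * m) 0)^2"
proof -
  have "1 / (pi * (4 * real m + 1)) \<le> ((hermite_fun (2 * m) 0)^2)^2"
    using hermite_fun_even_at_0[of m]
    by (simp add: pos_divide_le_eq mult.commute flip: divide_divide_eq_left)
  then have "sqrt (1 / (pi * (4 * real m + 1))) \<le> (hermite_fun (2 * m) 0)^2"
    by (intro real_le_lsqrt) auto
  then show ?thesis by (simp add: real_sqrt_divide)
qed

text \<open>By parity only one of the two summands contributes. For odd n the derivative satisfies
  h_n'(0)^2 = 2 n h_(n-1)(0)^2, which returns to the even case.\<close>

lemma hermite_energy_at_0: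
  "sqrt (2 * real n + 1) / sqrt pi \<le> (deriv (hermite_fun n) 0)^2 + (2 * real n + 1) * (hermite_fun n 0)^2"
proof (cases "even n")
  case True
  then obtain m where n: "n = 2 * m" by auto
  let ?l = "4 * real m + 1"
  have "?l * (1 / sqrt (pi * ?l)) = (?l / sqrt ?l) / sqrt pi"
    by (simp add: real_sqrt_mult)
  then have "sqrt ?l / sqrt pi = ?l * (1 / sqrt (pi * ?l))"
    by (subst (asm) real_div_sqrt) auto
  also have "\<dots> \<le> ?l * (hermite_fun n 0)^2"
    unfolding n by (intro mult_left_mono hermite_fun_even_at_0') auto
  finally show ?thesis by (simp add: n add_increasing)
next
  case False
  then obtain m where n: "n = 2 * m + 1" using oddE by blast
  let ?l = "4 * real m + 3"
  have "hermite_fun n 0 = 0" using hermite_fun_minus[of n 0] False by simp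
  then have d: "(deriv (hermite_fun n) 0)^2 = (4 * real m + 2) * (hermite_fun (2 * m) 0)^2"
    by (simp add: hermite_fun_deriv_at_zero power_mult_distrib n)
  have "sqrt ?l * sqrt (4 * real m + 1) \<le> 4 * real m + 2"
    unfolding real_sqrt_mult[symmetric] by (rule real_le_lsqrt) (auto simp: power2_eq_square algebra_simps)
  then have "sqrt ?l \<le> (4 * real m + 2) / sqrt (4 * real m + 1)"
    by (subst pos_le_divide_eq) auto
  then have "sqrt ?l / sqrt pi \<le> (4 * real m + 2) / sqrt (4 * real m + 1) / sqrt pi"
    by (intro divide_right_mono) auto
  also have "\<dots> = (4 * real m + 2) * (1 / sqrt (pi * (4 * real m + 1)))"
    by (simp add: real_sqrt_mult)
  also have "(4 * real m + 2) * (1 / sqrt (pi * (4 * real m + 1))) \<le> (4 * real m + 2) * (hermite_fun (2 * m) 0)^2"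
    by (intro mult_left_mono hermite_fun_even_at_0') auto
  finally show ?thesis using d by (simp add: n add_increasing2 add_ac)
qed

(* The Sonin function of the Liouville (WKB) normal form of y'' = (x^2 - l) y: with Q = l - x^2,
   w = Q^(1/4) y and dt = Q^(1/2) dx one has w_tt + (1 + r) w = 0 where r is increasing in x >= 0,
   so w_t^2 + (1 + r) w^2 is nondecreasing. *)
lemma sonin_has_derivative:
  fixes y y' :: "real \<Rightarrow> real"
  assumes y: "(y has_real_derivative y' x) (at x)"
    and y': "(y' has_real_derivative (x^2 - l) * y x) (at x)" and x: "x^2 < l"
  shows "((\<lambda>x. ((y' x - x * y x / (2 * (l - x^2)))^2
            + (l - x^2 + 1 / (2 * (l - x^2)) + 5 * x^2 / (4 * (l - x^2)^2)) * (y x)^2) / sqrt (l - x^2))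
     has_real_derivative ((9 * x / (2 * (l - x^2)^2) + 15 * x^3 / (2 * (l - x^2)^3)) * (y x)^2 / sqrt (l - x^2))) (at x)"
proof -
  define Q where "Q = l - x^2"
  have Q: "Q > 0" using x by (simp add: Q_def)
  define u where "u = 1 / Q"
  have Qu: "Q * u = 1" using Q by (simp add: u_def)
  let ?A = "\<lambda>x. y' x - x * y x / (2 * (l - x^2))"
  let ?B = "\<lambda>x. l - x^2 + 1 / (2 * (l - x^2)) + 5 * x^2 / (4 * (l - x^2)^2)"
  let ?A' = "- Q * y x - (y x + x * y' x) * u / 2 - x^2 * y x * u^2"
  let ?B' = "- 2 * x + x * u^2 + 5 * x * u^2 / 2 + 5 * x^3 * u^3"
  have dQ: "((\<lambda>x. l - x^2) has_real_derivative - 2 * x) (at x)"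
    by (auto intro!: derivative_eq_intros)
  have nz: "2 * (l - x^2) \<noteq> 0" "4 * (l - x^2)^2 \<noteq> 0" using x by auto
  have d2: "((\<lambda>x. 2 * (l - x^2)) has_real_derivative 2 * (- 2 * x)) (at x)"
    by (rule DERIV_cmult[OF dQ])
  have d4: "((\<lambda>x. 4 * (l - x^2)^2) has_real_derivative 4 * (2 * (l - x^2) * (- 2 * x))) (at x)"
    by (auto intro!: derivative_eq_intros)
  have d5: "((\<lambda>x. 5 * x^2) has_real_derivative 10 * x) (at x)"
    by (auto intro!: derivative_eq_intros)
  have xl: "x^2 - l = - Q" by (simp add: Q_def)
  have "(?A has_real_derivative (x^2 - l) * y x
      - ((1 * y x + y' x * x) * (2 * (l - x^2)) - (x * y x) * (2 * (- 2 * x))) / ((2 * (l - x^2)) * (2 * (l - x^2)))) (at x)"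
    by (rule DERIV_diff[OF y' DERIV_divide[OF DERIV_mult[OF DERIV_ident y] d2 nz(1)]])
  also have "(x^2 - l) * y x
      - ((1 * y x + y' x * x) * (2 * (l - x^2)) - (x * y x) * (2 * (- 2 * x))) / ((2 * (l - x^2)) * (2 * (l - x^2))) = ?A'"
    unfolding Q_def[symmetric] xl u_def using Q by (simp add: field_simps power2_eq_square)
  finally have dA: "(?A has_real_derivative ?A') (at x)" .
  have "(?B has_real_derivative - 2 * x + (0 * (2 * (l - x^2)) - 1 * (2 * (- 2 * x))) / ((2 * (l - x^2)) * (2 * (l - x^2)))
     + (10 * x * (4 * (l - x^2)^2) - 5 * x^2 * (4 * (2 * (l - x^2) * (- 2 * x)))) / ((4 * (l - x^2)^2) * (4 * (l - x^2)^2))) (at x)"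
    by (intro DERIV_add dQ DERIV_divide d2 d4 d5 nz DERIV_const)
  also have "- 2 * x + (0 * (2 * (l - x^2)) - 1 * (2 * (- 2 * x))) / ((2 * (l - x^2)) * (2 * (l - x^2)))
     + (10 * x * (4 * (l - x^2)^2) - 5 * x^2 * (4 * (2 * (l - x^2) * (- 2 * x)))) / ((4 * (l - x^2)^2) * (4 * (l - x^2)^2)) = ?B'"
    unfolding Q_def[symmetric] u_def using Q by (simp add: field_simps power2_eq_square power3_eq_cube)
  finally have dB: "(?B has_real_derivative ?B') (at x)" .
  have dS: "((\<lambda>x. sqrt (l - x^2)) has_real_derivative - x / sqrt Q) (at x)"
    using Q unfolding Q_def by (auto intro!: derivative_eq_intros simp: field_simps)
  have s: "sqrt Q > 0" "sqrt Q * sqrt Q = Q" using Q by auto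
  \<comment> \<open>A polynomial identity up to a multiple of Q u - 1; u is therefore kept as a
    symbol of its own instead of 1 / Q.\<close>
  have alg: "(2 * A * ?A' + ?B' * Y^2 + 2 * B * Y * Y') + (A^2 + B * Y^2) * x * u = (9 * x * u^2 / 2 + 15 * x^3 * u^3 / 2) * Y^2"
    if "Y = y x" "Y' = y' x" "A = Y' - x * Y * u / 2" "B = Q + u / 2 + 5 * x^2 * u^2 / 4" for A B Y Y'
  proof -
    have "(2 * A * ?A' + ?B' * Y^2 + 2 * B * Y * Y') + (A^2 + B * Y^2) * x * u
        = (9 * x * u^2 / 2 + 15 * x^3 * u^3 / 2) * Y^2 + 2 * x * Y^2 * (Q * u - 1)"
      unfolding that(3,4) that(1,2)[symmetric]
      by (simp add: field_simps power2_eq_square power3_eq_cube)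
    then show ?thesis by (simp add: Qu)
  qed
  have "((\<lambda>x. ((?A x)^2 + ?B x * (y x)^2) / sqrt (l - x^2)) has_real_derivative
     ((2 * ?A x * ?A' + ?B' * (y x)^2 + 2 * ?B x * y x * y' x) * sqrt (l - x^2) - ((?A x)^2 + ?B x * (y x)^2) * (- x / sqrt Q))
        / (sqrt (l - x^2) * sqrt (l - x^2))) (at x)"
  proof -
    have "((\<lambda>x. (A x)^2 + B x * (y x)^2) has_real_derivative 2 * A x * A' + B' * (y x)^2 + 2 * B x * y x * y' x) (at x)"
      if "(A has_real_derivative A') (at x)" "(B has_real_derivative B') (at x)" for A B A' B'
      by (auto intro!: derivative_eq_intros that y simp: algebra_simps)
    from DERIV_divide[OF this[OF dA dB] dS] show ?thesis
      using s by (simp add: Q_def)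
  qed
  also have "((2 * ?A x * ?A' + ?B' * (y x)^2 + 2 * ?B x * y x * y' x) * sqrt (l - x^2) - ((?A x)^2 + ?B x * (y x)^2) * (- x / sqrt Q))
        / (sqrt (l - x^2) * sqrt (l - x^2))
     = ((2 * ?A x * ?A' + ?B' * (y x)^2 + 2 * ?B x * y x * y' x) + ((?A x)^2 + ?B x * (y x)^2) * x * u) / sqrt Q"
  proof -
    have "(D * r - G * (- x / r)) / (r * r) = (D + G * x * (1 / (r * r))) / r" if "r > 0" for D G r :: real
      using that by (simp add: field_simps)
    from this[OF s(1), unfolded s(2), folded u_def] show ?thesis
      unfolding Q_def[symmetric] s(2) .
  qed
  also have "\<dots> = (9 * x * u^2 / 2 + 15 * x^3 * u^3 / 2) * (y x)^2 / sqrt Q"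
    by (subst alg[OF refl refl]) (auto simp: u_def Q_def power_divide mult.commute)
  finally show ?thesis
    by (simp add: u_def Q_def power_divide mult.commute)
qed

text \<open>At a zero the Sonin function is h'(x)^2 / sqrt Q with Q = 2 n + 1 - x^2. At 0 it is at
  least the energy of \<open>hermite_energy_at_0\<close> divided by sqrt (2 n + 1), hence at least 1
  / sqrt pi. Negative zeros follow by parity.\<close>

lemma hermite_deriv_at_zero_lower:
  assumes "x \<in> hermite_zeros n"
  shows "sqrt (2 * real n + 1 - x^2) / sqrt pi \<le> (deriv (hermite_fun n) x)^2"
proof -
  have main: "sqrt (2 * real n + 1 - x^2) / sqrt pi \<le> (deriv (hermite_fun n) x)^2"
    if x: "x \<in> hermite_zeros n" "0 \<le> x" for x
  proof -
    let ?l = "2 * real n + 1" and ?y = "hermite_fun n" and ?y' = "deriv (hermite_fun n)"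
    let ?S = "\<lambda>x. ((?y' x - x * ?y x / (2 * (?l - x^2)))^2
            + (?l - x^2 + 1 / (2 * (?l - x^2)) + 5 * x^2 / (4 * (?l - x^2)^2)) * (?y x)^2) / sqrt (?l - x^2)"
    have xl: "x^2 < ?l" using hermite_zero_bound(2)[OF x(1)] .
    have "?S 0 \<le> ?S x"
    proof (rule DERIV_nonneg_imp_nondecreasing[OF x(2)], intro exI conjI)
      fix t assume t: "0 \<le> t" "t \<le> x"
      have tl: "t^2 < ?l" using t xl power_mono[of t x 2] by linarith
      show "(?S has_real_derivative ((9 * t / (2 * (?l - t^2)^2) + 15 * t^3 / (2 * (?l - t^2)^3)) * (?y t)^2 / sqrt (?l - t^2))) (at t)"
        by (rule sonin_has_derivative[OF hermite_fun_has_derivative hermite_fun_has_derivative2 tl])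
      show "0 \<le> (9 * t / (2 * (?l - t^2)^2) + 15 * t^3 / (2 * (?l - t^2)^3)) * (?y t)^2 / sqrt (?l - t^2)"
        using t tl by (intro divide_nonneg_nonneg mult_nonneg_nonneg add_nonneg_nonneg) auto
    qed
    also have "?S x = (?y' x)^2 / sqrt (?l - x^2)" using x by (simp add: hermite_zeros_def)
    finally have S: "?S 0 \<le> (?y' x)^2 / sqrt (?l - x^2)" .
    have "sqrt ?l / sqrt pi \<le> (?y' 0)^2 + ?l * (?y 0)^2" by (rule hermite_energy_at_0)
    also have "\<dots> \<le> (?y' 0)^2 + (?l + 1 / (2 * ?l)) * (?y 0)^2"
      by (intro add_left_mono mult_right_mono) auto
    finally have "1 / sqrt pi \<le> ((?y' 0)^2 + (?l + 1 / (2 * ?l)) * (?y 0)^2) / sqrt ?l"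
      by (subst pos_le_divide_eq) auto
    with S have "1 / sqrt pi \<le> (?y' x)^2 / sqrt (?l - x^2)" by simp
    then show ?thesis using xl by (subst (asm) pos_le_divide_eq) auto
  qed
  show ?thesis
  proof (cases "0 \<le> x")
    case True then show ?thesis using main assms by blast
  next
    case False
    have "(deriv (hermite_fun n) (- x))^2 = (deriv (hermite_fun n) x)^2"
      using assms hermite_zeros_minus[OF assms]
      by (simp add: hermite_fun_deriv_at_zero hermite_zeros_def hermite_fun_minus power_mult_distrib flip: power_mult)
    then show ?thesis using main[of "- x"] hermite_zeros_minus[OF assms] False by simp
  qed
qed

text \<open>The left side is the quadrature weight at x. \<open>hermite_zero_bound\<close> gives Q^3
  \<ge> n for Q = 2 n + 1 - x^2, so sqrt Q \<ge> n^(1/6) in the lower bound for h'(x)^2.\<close>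

lemma hermite_weight_bound:
  assumes "x \<in> hermite_zeros n" "n \<ge> 1"
  shows "2 / (deriv (hermite_fun n) x)^2 \<le> 2 * sqrt pi * real n powr (-1/6)"
proof -
  let ?q = "2 * real n + 1 - x^2"
  have q: "?q > 0" using hermite_zero_bound(2)[OF assms(1)] by simp
  have q3: "real n \<le> ?q^3" by (rule order_trans[OF _ hermite_zero_bound(1)[OF assms(1)]]) simp
  have "real n powr (1/6) \<le> (?q^3) powr (1/6)" using q3 by (intro powr_mono2) auto
  also have "\<dots> = ?q powr (3 * (1/6))" using q by (simp add: powr_powr flip: powr_numeral)
  also have "\<dots> = sqrt ?q" using q by (simp add: powr_half_sqrt)
  finally have a: "real n powr (1/6) / sqrt pi \<le> (deriv (hermite_fun n) x)^2"
    using hermite_deriv_at_zero_lower[OF assms(1)] by (smt (verit) divide_right_mono pi_ge_zero real_sqrt_ge_zero)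
  have "2 / (deriv (hermite_fun n) x)^2 \<le> 2 / (real n powr (1/6) / sqrt pi)"
    using assms a hermite_fun_simple_zero[of n x]
    by (intro divide_left_mono mult_pos_pos) (auto simp: hermite_zeros_def)
  also have "\<dots> = 2 * sqrt pi * real n powr (-1/6)" using assms by (simp add: powr_minus field_simps)
  finally show ?thesis .
qed

text \<open>Let S be the maximum of |h| on [a, b]. There |h''| \<le> (2 n + 1) S, so the slope,
  which vanishes at some interior point, is at most (2 n + 1) S (b - a). A second mean value step
  from the zero a to the maximizer gives S \<le> (2 n + 1) (b - a)^2 S.\<close>

lemma hermite_zero_gap:
  assumes "a \<in> hermite_zeros n" "b \<in> hermite_zeros n" "a < b"
  shows "1 \<le> (2 * real n + 1) * (b - a)^2"
proof -
  let ?l = "2 * real n + 1" and ?y = "hermite_fun n" and ?y' = "deriv (hermite_fun n)"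
  have ab: "?y a = 0" "?y b = 0" using assms by (auto simp: hermite_zeros_def)
  obtain m where m: "a \<le> m" "m \<le> b" "\<And>x. a \<le> x \<Longrightarrow> x \<le> b \<Longrightarrow> \<bar>?y x\<bar> \<le> \<bar>?y m\<bar>"
    using continuous_attains_sup[of "{a..b}" "\<lambda>x. \<bar>?y x\<bar>"] assms(3)
      continuous_on_rabs[OF hermite_fun_continuous[of "{a..b}" n]] by auto
  have "\<not> {a..b} \<subseteq> hermite_zeros n"
    using assms(3) infinite_Icc finite_subset[OF _ finite_hermite_zeros] by blast
  then have pos: "\<bar>?y m\<bar> > 0" using m(3) by (force simp: hermite_zeros_def subset_iff)
  have amb: "a < m" using m(1) ab pos by (cases "a = m") auto
  obtain c where c: "a < c" "c < b" "?y' c = 0"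
    using MVT2[OF assms(3) hermite_fun_has_derivative[of n]] ab assms(3) by auto
  have second: "\<bar>?y' x\<bar> \<le> ?l * \<bar>?y m\<bar> * (b - a)" if x: "a \<le> x" "x \<le> b" for x
  proof -
    have "norm (?y' x - ?y' c) \<le> (?l * \<bar>?y m\<bar>) * norm (x - c)"
    proof (rule field_differentiable_bound[of "{a..b}"])
      fix z assume z: "z \<in> {a..b}"
      show "(?y' has_field_derivative (z^2 - ?l) * ?y z) (at z within {a..b})"
        by (rule has_field_derivative_at_within[OF hermite_fun_has_derivative2])
      have "z^2 \<le> max (a^2) (b^2)"
      proof (cases "z \<ge> 0")
        case True
        then have "z^2 \<le> b^2" using z by (intro power_mono) auto
        then show ?thesis by simp
      next
        case False
        then have "(- z)^2 \<le> (- a)^2" using z by (intro power_mono) auto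
        then show ?thesis by simp
      qed
      then have "\<bar>z^2 - ?l\<bar> \<le> ?l"
        using hermite_zero_bound(2)[OF assms(1)] hermite_zero_bound(2)[OF assms(2)] by (auto simp: abs_le_iff)
      then show "norm ((z^2 - ?l) * ?y z) \<le> ?l * \<bar>?y m\<bar>"
        using m(3)[of z] z by (auto simp: abs_mult intro!: mult_mono)
    qed (use x c in auto)
    also have "\<dots> \<le> (?l * \<bar>?y m\<bar>) * (b - a)" using x c by (intro mult_left_mono) auto
    finally show ?thesis using c by simp
  qed
  have "norm (?y m - ?y a) \<le> (?l * \<bar>?y m\<bar> * (b - a)) * norm (m - a)"
  proof (rule field_differentiable_bound[of "{a..b}"])
    fix z assume z: "z \<in> {a..b}"
    show "(?y has_field_derivative ?y' z) (at z within {a..b})"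
      by (rule has_field_derivative_at_within[OF hermite_fun_has_derivative])
    show "norm (?y' z) \<le> ?l * \<bar>?y m\<bar> * (b - a)" using second[of z] z by simp
  qed (use m assms in auto)
  also have "\<dots> \<le> (?l * \<bar>?y m\<bar> * (b - a)) * (b - a)"
    using m assms(3) by (intro mult_left_mono mult_nonneg_nonneg) auto
  finally have "\<bar>?y m\<bar> * 1 \<le> \<bar>?y m\<bar> * (?l * (b - a)^2)"
    using ab by (simp add: power2_eq_square mult_ac)
  then show ?thesis using pos by (subst (asm) mult_le_cancel_left_pos) auto
qed

section \<open>Gauss-Hermite quadrature\<close>

lemma prod_roots_dvd:
  fixes p :: "real poly"
  assumes "finite Z" "\<And>z. z \<in> Z \<Longrightarrow> poly p z = 0"
  shows "(\<Prod>z\<in>Z. [:- z, 1:]) dvd p"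
  using assms
proof (induction Z rule: finite_induct)
  case (insert z Z)
  then obtain s where s: "p = (\<Prod>z\<in>Z. [:- z, 1:]) * s" by (auto elim: dvdE)
  have "poly (\<Prod>z\<in>Z. [:- z, 1:]) z \<noteq> 0" using insert by (auto simp: poly_prod)
  then have "poly s z = 0" using insert.prems[of z] s by simp
  then obtain t where t: "s = [:- z, 1:] * t" by (auto simp: poly_eq_0_iff_dvd elim: dvdE)
  have "p = (\<Prod>z\<in>insert z Z. [:- z, 1:]) * t"
    unfolding s t prod.insert[OF insert(1,2)] by (simp only: mult_ac)
  then show ?case by (rule dvdI)
qed simp

lemma degree_prod_linear: "degree (\<Prod>z\<in>Z. [:- z, 1 :: real:]) = card Z"
  by (cases "finite Z") (simp_all add: degree_prod_eq_sum_degree)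

lemma poly_no_roots_sign:
  fixes s :: "real poly"
  assumes "\<And>x. poly s x \<noteq> 0"
  shows "(\<forall>x. poly s x > 0) \<or> (\<forall>x. poly s x < 0)"
proof (rule ccontr)
  assume "\<not> ?thesis"
  then obtain x y where "poly s x < 0" "poly s y > 0" using assms by (meson linorder_neqE)
  then show False
    using poly_IVT_pos[of x y s] poly_IVT_neg[of y x s] assms by (cases x y rule: linorder_cases) auto
qed

text \<open>Since the zeros are simple, dividing h_n by q, the product of the x - z, leaves a factor
  of constant sign. If there were fewer than n zeros, q would have degree below n and be orthogonal
  to h_n, although q h_n has constant sign.\<close>

lemma card_hermite_zeros: "card (hermite_zeros n) = n"
proof (rule antisym)
  have "card (hermite_zeros n) \<le> degree (hermite_normal n)"
    unfolding hermite_zeros_poly by (rule card_poly_roots_bound[OF hermite_normal_nonzero])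
  then show "card (hermite_zeros n) \<le> n" by (simp add: degree_hermite_normal)
  show "n \<le> card (hermite_zeros n)"
  proof (rule ccontr)
    assume less: "\<not> n \<le> card (hermite_zeros n)"
    let ?Z = "hermite_zeros n" and ?H = "hermite_normal n"
    define q where "q = (\<Prod>z\<in>?Z. [:- z, 1 :: real:])"
    have "q dvd ?H" unfolding q_def by (rule prod_roots_dvd[OF finite_hermite_zeros]) (simp add: hermite_zeros_poly)
    then obtain s where s: "?H = q * s" by (auto elim: dvdE)
    have "poly s x \<noteq> 0" for x
    proof
      assume sx: "poly s x = 0"
      then have xZ: "x \<in> ?Z" by (simp add: hermite_zeros_poly s)
      then have "poly q x = 0" by (auto simp: q_def poly_prod)
      then have "poly (pderiv ?H) x = 0" using sx by (simp add: s pderiv_mult)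
      moreover have "poly ?H x = 0" using xZ by (simp add: hermite_zeros_poly)
      ultimately have "deriv (hermite_fun n) x = 0"
        by (simp add: hermite_fun_gauss_poly deriv_gauss_poly gauss_poly_def gauss_deriv_def)
      then show False using hermite_fun_simple_zero xZ by (simp add: hermite_zeros_def)
    qed
    from poly_no_roots_sign[OF this] obtain c :: real where c: "\<And>x. c * poly s x > 0"
    proof
      assume "\<forall>x. poly s x > 0" then show thesis using that[of 1] by simp
    next
      assume "\<forall>x. poly s x < 0" then show thesis using that[of "-1"] by simp
    qed
    have "degree (smult c q) < n"
      using degree_smult_le[of c q] less by (simp add: q_def degree_prod_linear)
    then have z: "L2_inner (gauss_poly 1 (smult c q)) (hermite_fun n) = 0"
      by (rule hermite_fun_orthogonal_lower)
    have i: "integrable lborel (\<lambda>x. gauss_poly 1 (smult c q) x * hermite_fun n x)"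
      by (rule L2_space_mult_integrable) auto
    have eq: "gauss_poly 1 (smult c q) x * hermite_fun n x = (exp (- (x^2 / 2)) * poly q x)^2 * (c * poly s x)" for x
      by (simp add: hermite_fun_gauss_poly gauss_poly_def s power2_eq_square mult_ac)
    have nn: "0 \<le> gauss_poly 1 (smult c q) x * hermite_fun n x" for x
      unfolding eq using c[of x] by (intro mult_nonneg_nonneg[OF zero_le_power2]) simp
    have "AE x in lborel. gauss_poly 1 (smult c q) x * hermite_fun n x = 0"
      using z integral_nonneg_eq_0_iff_AE[OF i] nn by (simp add: L2_inner_def)
    then have "AE x in lborel. poly q x = 0"
    proof eventually_elim
      case (elim x)
      then show ?case unfolding eq using c[of x] by (auto simp: less_le)
    qed
    moreover have "q \<noteq> 0" using s hermite_normal_nonzero[of n] by auto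
    then have "finite {x. poly q x = 0}" by (rule poly_roots_finite)
    then have "AE x in lborel. x \<notin> {x. poly q x = 0}"
      by (intro AE_not_in) (simp add: finite_imp_null_set_lborel)
    ultimately have "AE x in (lborel :: real measure). False" by eventually_elim auto
    then show False by (simp add: eventually_False ae_filter_eq_bot_iff)
  qed
qed

(* The functions h_n(x) / (x - z), z ranging over the zeros of h_n, form an orthogonal basis of the
   Gaussian-weighted polynomials of degree < n; this is Gauss-Hermite quadrature in disguise. *)
lemma hermite_lagrange:
  assumes z: "z \<in> hermite_zeros n"
  obtains l where "hermite_normal n = [:- z, 1:] * l" "degree l < n"
    "gauss_poly 1 l z = deriv (hermite_fun n) z"
    "\<And>y. y \<in> hermite_zeros n \<Longrightarrow> y \<noteq> z \<Longrightarrow> gauss_poly 1 l y = 0"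
    "L2_inner (gauss_poly 1 l) (gauss_poly 1 l) = 2"
proof -
  let ?H = "hermite_normal n" and ?g = "gauss_poly 1"
  have "poly ?H z = 0" using z by (simp add: hermite_zeros_poly)
  then obtain l where l: "?H = [:- z, 1:] * l" by (auto simp: poly_eq_0_iff_dvd elim: dvdE)
  have "l \<noteq> 0" using l hermite_normal_nonzero[of n] by auto
  then have "degree ?H = degree l + 1" unfolding l by (subst degree_mult_eq) auto
  then have dl: "degree l < n" by (simp add: degree_hermite_normal)
  have h: "hermite_fun n x = (x - z) * ?g l x" for x
    by (simp add: hermite_fun_gauss_poly gauss_poly_def l algebra_simps)
  have h': "deriv (hermite_fun n) x = ?g l x + (x - z) * ?g (gauss_deriv 1 l) x" for x
  proof -
    have "((\<lambda>x. (x - z) * ?g l x) has_real_derivative ?g l x + (x - z) * ?g (gauss_deriv 1 l) x) (at x)"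
      by (auto intro!: derivative_eq_intros gauss_poly_has_derivative)
    moreover have "hermite_fun n = (\<lambda>x. (x - z) * ?g l x)" by (rule ext) (rule h)
    ultimately show ?thesis by (simp only: DERIV_imp_deriv)
  qed
  have L: "?g p \<in> L2_space" for p by auto
  have xg: "(x - z) * ?g p x = ?g ([:- z, 1:] * p) x" for x p
    by (simp add: gauss_poly_def algebra_simps)
  have n: "n \<ge> 1" using dl by simp
  have o: "L2_inner (?g l) (hermite_fun k) = 0" if "k \<ge> n" for k
    using dl that by (intro hermite_fun_orthogonal_lower) auto
  \<comment> \<open>The factor x - z of one copy of h_n is moved to the other. The recurrence and
    the degree of l then leave only the h_(n-1) term.\<close>
  have "1 = L2_inner (hermite_fun n) (hermite_fun n)" by (simp add: hermite_orthonormal)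
  also have "\<dots> = L2_inner (?g l) (\<lambda>x. (x - z) * hermite_fun n x)"
    unfolding L2_inner_def by (rule Bochner_Integration.integral_cong) (simp_all add: h)
  also have "(\<lambda>x. (x - z) * hermite_fun n x) = (\<lambda>x. (sqrt ((real n + 1) / 2) * hermite_fun (Suc n) x
      + sqrt (real n / 2) * hermite_fun (n - 1) x) + (- z) * hermite_fun n x)"
    using hermite_fun_x[of _ n] by (auto simp: algebra_simps)
  also have "L2_inner (?g l) \<dots> = sqrt (real n / 2) * L2_inner (?g l) (hermite_fun (n - 1))"
  proof -
    have "L2_inner (\<lambda>x. (sqrt ((real n + 1) / 2) * hermite_fun (Suc n) x
        + sqrt (real n / 2) * hermite_fun (n - 1) x) + (- z) * hermite_fun n x) (?g l)
      = L2_inner (\<lambda>x. sqrt ((real n + 1) / 2) * hermite_fun (Suc n) x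
        + sqrt (real n / 2) * hermite_fun (n - 1) x) (?g l) + L2_inner (\<lambda>x. (- z) * hermite_fun n x) (?g l)"
      by (rule L2_inner_add_left[OF L2_space_add[OF L2_space_scale L2_space_scale] L2_space_scale L]) simp_all
    also have "L2_inner (\<lambda>x. sqrt ((real n + 1) / 2) * hermite_fun (Suc n) x
        + sqrt (real n / 2) * hermite_fun (n - 1) x) (?g l)
      = L2_inner (\<lambda>x. sqrt ((real n + 1) / 2) * hermite_fun (Suc n) x) (?g l)
        + L2_inner (\<lambda>x. sqrt (real n / 2) * hermite_fun (n - 1) x) (?g l)"
      by (rule L2_inner_add_left[OF L2_space_scale L2_space_scale L]) simp_all
    finally show ?thesis
      unfolding L2_inner_scale_left by (simp add: L2_inner_commute[of _ "?g l"] o)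
  qed
  finally have one: "sqrt (real n / 2) * L2_inner (?g l) (hermite_fun (n - 1)) = 1" by simp
  have "L2_inner (?g l) (deriv (hermite_fun n)) = L2_inner (?g l) (\<lambda>x. sqrt (real n / 2) * hermite_fun (n - 1) x - sqrt ((real n + 1) / 2) * hermite_fun (Suc n) x)"
    by (intro arg_cong[where f="L2_inner _"] ext hermite_fun_deriv)
  also have "\<dots> = 1"
    by (subst L2_inner_commute, subst L2_inner_diff_left)
       (auto simp: L2_inner_scale_left L2_inner_commute[of "hermite_fun _"] o one[unfolded One_nat_def])
  finally have d1: "L2_inner (?g l) (deriv (hermite_fun n)) = 1" .
  let ?l' = "gauss_deriv 1 l"
  have i1: "integrable lborel (\<lambda>x. ?g l x * ?g l x)" by (intro L2_space_mult_integrable L)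
  have i2: "integrable lborel (\<lambda>x. ?g l x * ((x - z) * ?g ?l' x))"
    unfolding xg by (intro L2_space_mult_integrable L)
  have "L2_inner (?g l) (deriv (hermite_fun n))
      = (LINT x|lborel. ?g l x * ?g l x) + (LINT x|lborel. ?g l x * ((x - z) * ?g ?l' x))"
    unfolding L2_inner_def h' by (subst Bochner_Integration.integral_add[symmetric, OF i1 i2]) (simp add: algebra_simps)
  moreover note d1
  \<comment> \<open>With g the weighted l, the integrals A of g^2 and B of (x - z) g g' satisfy A +
    B = 1 by the preceding facts and A + 2 B = 0 by this one; hence A = 2.\<close>
  moreover have "(LINT x|lborel. ?g l x * ?g l x + 2 * (?g l x * ((x - z) * ?g ?l' x))) = 0"
  proof (rule integral_derivative_zero[where F="\<lambda>x. (x - z) * ?g l x * ?g l x"])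
    show "((\<lambda>x. (x - z) * ?g l x * ?g l x) has_real_derivative
       ?g l x * ?g l x + 2 * (?g l x * ((x - z) * ?g ?l' x))) (at x)" for x
      by (auto intro!: derivative_eq_intros gauss_poly_has_derivative simp: algebra_simps)
    show "continuous_on UNIV (\<lambda>x. ?g l x * ?g l x + 2 * (?g l x * ((x - z) * ?g ?l' x)))"
      by (intro continuous_intros gauss_poly_continuous)
    show "integrable lborel (\<lambda>x. ?g l x * ?g l x + 2 * (?g l x * ((x - z) * ?g ?l' x)))"
      using i1 i2 by simp
    show "((\<lambda>x. (x - z) * ?g l x * ?g l x) \<longlongrightarrow> 0) at_top" "((\<lambda>x. (x - z) * ?g l x * ?g l x) \<longlongrightarrow> 0) at_bot"
      unfolding xg gauss_poly_mult_eq
      using exp_poly_tendsto_0_at_top[of 1 "[:- z, 1:] * l * l"] exp_poly_tendsto_0_at_bot[of 1 "[:- z, 1:] * l * l"]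
      by simp_all
  qed
  ultimately have "L2_inner (?g l) (?g l) = 2"
    using i1 i2 by (simp add: L2_inner_def)
  moreover have "?g l z = deriv (hermite_fun n) z" by (simp add: h')
  moreover have "?g l y = 0" if "y \<in> hermite_zeros n" "y \<noteq> z" for y
    using that h[of y] by (simp add: hermite_zeros_def)
  ultimately show ?thesis using that l dl by blast
qed

lemma gauss_poly_zero_at_nodes:
  assumes "degree p < n" "\<And>x. x \<in> hermite_zeros n \<Longrightarrow> gauss_poly 1 p x = 0"
  shows "p = 0"
proof (rule ccontr)
  assume "p \<noteq> 0"
  have "hermite_zeros n \<subseteq> {x. poly p x = 0}" using assms(2) by (auto simp: gauss_poly_def)
  then have "n \<le> card {x. poly p x = 0}"
    using card_mono[OF poly_roots_finite[OF \<open>p \<noteq> 0\<close>]] card_hermite_zeros[of n] by metis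
  then show False using card_poly_roots_bound[OF \<open>p \<noteq> 0\<close>] assms(1) by simp
qed

text \<open>In the Lagrange basis the coefficient at z is the nodal value over h_n'(z). The basis is
  orthogonal with squared norms 2, which produces the weight.\<close>

lemma hermite_quadrature:
  assumes "degree p < n"
  shows "L2_inner (gauss_poly 1 p) (gauss_poly 1 p)
    = (\<Sum>z\<in>hermite_zeros n. 2 / (deriv (hermite_fun n) z)^2 * (gauss_poly 1 p z)^2)"
proof -
  let ?Z = "hermite_zeros n" and ?g = "gauss_poly 1" and ?d = "deriv (hermite_fun n)"
  obtain l where l: "\<And>z. z \<in> ?Z \<Longrightarrow> hermite_normal n = [:- z, 1:] * l z \<and> degree (l z) < n \<and>
      ?g (l z) z = ?d z \<and> (\<forall>y\<in>?Z. y \<noteq> z \<longrightarrow> ?g (l z) y = 0) \<and> L2_inner (?g (l z)) (?g (l z)) = 2"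
  proof -
    have "\<exists>l. hermite_normal n = [:- z, 1:] * l \<and> degree l < n \<and>
      ?g l z = ?d z \<and> (\<forall>y\<in>?Z. y \<noteq> z \<longrightarrow> ?g l y = 0) \<and> L2_inner (?g l) (?g l) = 2" if "z \<in> ?Z" for z
      using hermite_lagrange[OF that] by metis
    then show ?thesis using that by metis
  qed
  have d: "?d z \<noteq> 0" if "z \<in> ?Z" for z using hermite_fun_simple_zero that by (auto simp: hermite_zeros_def)
  define c where "c z = ?g p z / ?d z" for z
  have n: "n > 0" using assms by simp
  have "p - (\<Sum>z\<in>?Z. smult (c z) (l z)) = 0"
  proof (rule gauss_poly_zero_at_nodes)
    have "degree (\<Sum>z\<in>?Z. smult (c z) (l z)) < n"
      using l n by (intro degree_sum_less) (auto intro: le_less_trans[OF degree_smult_le])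
    then show "degree (p - (\<Sum>z\<in>?Z. smult (c z) (l z))) < n"
      using assms degree_diff_less by blast
    fix x assume x: "x \<in> ?Z"
    have "(\<Sum>z\<in>?Z. c z * ?g (l z) x) = (\<Sum>z\<in>?Z. if z = x then ?g p x else 0)"
      using x l d by (intro sum.cong) (auto simp: c_def)
    then show "?g (p - (\<Sum>z\<in>?Z. smult (c z) (l z))) x = 0"
      using x by (simp add: gauss_poly_diff gauss_poly_sum gauss_poly_smult)
  qed
  then have p: "p = (\<Sum>z\<in>?Z. smult (c z) (l z))" by simp
  \<comment> \<open>For z \<noteq> w the polynomial l_z vanishes at w. With r = l_z / (x - w) the
    product l_z l_w is r times the n-th Hermite polynomial, and r has degree below n.\<close>
  have o: "L2_inner (?g (l z)) (?g (l w)) = (if z = w then 2 else 0)" if zw: "z \<in> ?Z" "w \<in> ?Z" for z w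
  proof (cases "z = w")
    case False
    have "poly (l z) w = 0" using l[OF zw(1)] zw(2) False by (auto simp: gauss_poly_def)
    then obtain r where r: "l z = [:- w, 1:] * r" by (auto simp: poly_eq_0_iff_dvd elim: dvdE)
    have "degree r < n"
    proof (cases "r = 0")
      case False
      then have "degree (l z) = 1 + degree r" unfolding r by (subst degree_mult_eq) auto
      then show ?thesis using l[OF zw(1)] by simp
    qed (use n in auto)
    then have "L2_inner (?g r) (hermite_fun n) = 0" by (rule hermite_fun_orthogonal_lower)
    moreover have "?g (l z) x * ?g (l w) x = ?g r x * hermite_fun n x" for x
    proof -
      have "poly (hermite_normal n) x = poly ([:- w, 1:] * l w) x" using l[OF zw(2)] by metis
      then have "poly (hermite_normal n) x = (x - w) * poly (l w) x" by (simp add: algebra_simps)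
      then show ?thesis by (simp add: r hermite_fun_gauss_poly gauss_poly_def) (simp add: algebra_simps)
    qed
    ultimately show ?thesis using False by (simp add: L2_inner_def)
  qed (use l zw in auto)
  have gp: "?g p = (\<lambda>x. \<Sum>z\<in>?Z. c z * ?g (l z) x)"
    by (subst p) (auto simp: gauss_poly_sum gauss_poly_smult)
  have "L2_inner (?g p) (?g p) = (\<Sum>z\<in>?Z. c z * (\<Sum>w\<in>?Z. c w * L2_inner (?g (l z)) (?g (l w))))"
    unfolding gp
    by (subst L2_inner_sum_left, (auto intro!: L2_space_sum L2_space_scale)[2], subst L2_inner_sum_right) auto
  also have "\<dots> = (\<Sum>z\<in>?Z. c z * (\<Sum>w\<in>?Z. if w = z then c z * 2 else 0))"
    by (intro sum.cong arg_cong2[where f="(*)"] refl) (auto simp: o)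
  also have "\<dots> = (\<Sum>z\<in>?Z. 2 / (?d z)^2 * (?g p z)^2)"
    by (intro sum.cong) (auto simp: c_def power2_eq_square)
  finally show ?thesis .
qed

section \<open>Weak derivatives\<close>

lemma smooth_funI:
  assumes "\<And>x. (f has_real_derivative g x) (at x)" "smooth_fun g"
  shows "smooth_fun f"
  unfolding smooth_fun_def
proof (intro allI)
  fix n x
  have d: "deriv f = g" using assms(1) by (auto intro!: ext DERIV_imp_deriv)
  show "(deriv ^^ n) f differentiable (at x)"
  proof (cases n)
    case 0
    then show ?thesis using assms(1) by (auto simp: real_differentiable_def)
  next
    case (Suc m)
    have "(deriv ^^ n) f = (deriv ^^ m) g" unfolding Suc funpow_Suc_right by (simp add: d)
    then show ?thesis using assms(2) by (simp add: smooth_fun_def)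
  qed
qed

text \<open>Smoothness by coinduction: exhibiting a set of functions closed under differentiation
  replaces formulas for n-th derivatives.\<close>

lemma smooth_fun_coinduct:
  assumes "f \<in> S" "\<And>f. f \<in> S \<Longrightarrow> \<exists>g\<in>S. \<forall>x. (f has_real_derivative g x) (at x)"
  shows "smooth_fun f"
  unfolding smooth_fun_def
proof (intro allI)
  fix n x
  have "\<exists>g\<in>S. (deriv ^^ n) f = g"
  proof (induction n)
    case (Suc n)
    then obtain g h where "g \<in> S" "(deriv ^^ n) f = g" "h \<in> S" "\<forall>x. (g has_real_derivative h x) (at x)"
      using assms(2) by blast
    then have "deriv g = h" by (auto intro!: ext DERIV_imp_deriv)
    then show ?case using \<open>(deriv ^^ n) f = g\<close> \<open>h \<in> S\<close> by simp
  qed (use assms(1) in auto)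
  then show "(deriv ^^ n) f differentiable (at x)"
    using assms(2) by (metis real_differentiable_def)
qed

lemma smooth_fun_has_derivative:
  assumes "smooth_fun f"
  shows "(f has_real_derivative deriv f x) (at x)"
  using assms[unfolded smooth_fun_def, rule_format, of 0 x]
  by (simp add: DERIV_deriv_iff_real_differentiable)

lemma smooth_fun_deriv: "smooth_fun f \<Longrightarrow> smooth_fun (deriv f)"
  unfolding smooth_fun_def by (metis funpow_Suc_right o_apply)

lemma smooth_fun_continuous: "smooth_fun f \<Longrightarrow> continuous_on A f"
  by (intro continuous_at_imp_continuous_on ballI DERIV_isCont[OF smooth_fun_has_derivative])

text \<open>Products alone are not stable under the Leibniz rule; their finite sums are.\<close>

inductive_set smooth_products :: "(real \<Rightarrow> real) set" where
  "smooth_fun f \<Longrightarrow> smooth_fun g \<Longrightarrow> (\<lambda>x. f x * g x) \<in> smooth_products"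
| "f \<in> smooth_products \<Longrightarrow> g \<in> smooth_products \<Longrightarrow> (\<lambda>x. f x + g x) \<in> smooth_products"

lemma smooth_products_derivative:
  "f \<in> smooth_products \<Longrightarrow> \<exists>g\<in>smooth_products. \<forall>x. (f has_real_derivative g x) (at x)"
proof (induction rule: smooth_products.induct)
  case (1 f g)
  have "(\<lambda>x. deriv f x * g x + f x * deriv g x) \<in> smooth_products"
    using 1 by (intro smooth_products.intros smooth_fun_deriv)
  moreover have "((\<lambda>x. f x * g x) has_real_derivative deriv f x * g x + f x * deriv g x) (at x)" for x
    using 1 by (auto intro!: derivative_eq_intros smooth_fun_has_derivative)
  ultimately show ?case by (intro bexI[of _ "\<lambda>x. deriv f x * g x + f x * deriv g x"]) auto
next
  case (2 f g)
  then obtain f' g' where "f' \<in> smooth_products" "\<forall>x. (f has_real_derivative f' x) (at x)"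
    "g' \<in> smooth_products" "\<forall>x. (g has_real_derivative g' x) (at x)" by blast
  then show ?case by (intro bexI[of _ "\<lambda>x. f' x + g' x"]) (auto intro: DERIV_add smooth_products.intros)
qed

lemma smooth_fun_mult: "smooth_fun f \<Longrightarrow> smooth_fun g \<Longrightarrow> smooth_fun (\<lambda>x. f x * g x)"
  by (rule smooth_fun_coinduct[of _ smooth_products]) (auto intro: smooth_products.intros smooth_products_derivative)

lemma smooth_fun_const: "smooth_fun (\<lambda>x. c)"
  by (rule smooth_fun_coinduct[of _ "range (\<lambda>c x. c)"]) (auto intro!: exI[of _ 0] derivative_eq_intros)

lemma smooth_fun_add:
  assumes "smooth_fun f" "smooth_fun g" shows "smooth_fun (\<lambda>x. f x + g x)"
proof -
  have "(\<lambda>x. f x * 1 + g x * 1) \<in> smooth_products"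
    using assms smooth_fun_const by (intro smooth_products.intros)
  then show ?thesis
    using smooth_fun_coinduct[of _ smooth_products] smooth_products_derivative by simp
qed

lemma smooth_fun_diff:
  assumes "smooth_fun f" "smooth_fun g" shows "smooth_fun (\<lambda>x. f x - g x)"
  using smooth_fun_add[OF assms(1) smooth_fun_mult[OF smooth_fun_const[of "-1"] assms(2)]] by simp

lemma smooth_fun_affine:
  assumes "smooth_fun f" shows "smooth_fun (\<lambda>x. f (c * x + d))"
proof (rule smooth_fun_coinduct[of _ "{\<lambda>x. k * g (c * x + d) |k g. smooth_fun g}"])
  show "(\<lambda>x. f (c * x + d)) \<in> {\<lambda>x. k * g (c * x + d) |k g. smooth_fun g}"
    using assms by (intro CollectI exI[of _ 1] exI[of _ f]) auto
  fix h assume "h \<in> {\<lambda>x. k * g (c * x + d) |k g. smooth_fun g}"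
  then obtain k g where h: "h = (\<lambda>x. k * g (c * x + d))" and g: "smooth_fun g" by blast
  have "(h has_real_derivative k * c * deriv g (c * x + d)) (at x)" for x
  proof -
    have "((\<lambda>x. g (c * x + d)) has_real_derivative deriv g (c * x + d) * c) (at x)"
      by (rule DERIV_chain2[OF smooth_fun_has_derivative[OF g]]) (auto intro!: derivative_eq_intros)
    from DERIV_cmult[OF this, of k] show ?thesis unfolding h by (simp add: mult_ac)
  qed
  then show "\<exists>g\<in>{\<lambda>x. k * g (c * x + d) |k g. smooth_fun g}. \<forall>x. (h has_real_derivative g x) (at x)"
    using smooth_fun_deriv[OF g] by (intro bexI[of _ "\<lambda>x. k * c * deriv g (c * x + d)"]) auto
qed

lemma smooth_fun_gauss_poly: "smooth_fun (gauss_poly \<beta> p)"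
  by (rule smooth_fun_coinduct[of _ "range (gauss_poly \<beta>)"]) (auto intro: gauss_poly_has_derivative)

definition flat :: "real poly \<Rightarrow> real \<Rightarrow> real" where
  "flat p x = (if x > 0 then poly p (1 / x) * exp (- 1 / x) else 0)"

lemma flat_tendsto_0: "(flat p \<longlongrightarrow> 0) (at_right 0)"
proof -
  have "((\<lambda>x::real. exp (- 1 * x) * (\<Sum>i\<le>degree p. coeff p i * x^i)) \<longlongrightarrow> 0) at_top"
    unfolding sum_distrib_left
  proof (rule tendsto_null_sum)
    fix i
    have "((\<lambda>x::real. exp (- 1 * x) * x^i) \<longlongrightarrow> 0) at_top" by real_asymp
    from tendsto_mult_right[OF this, of "coeff p i"]
    show "((\<lambda>x. exp (- 1 * x) * (coeff p i * x^i)) \<longlongrightarrow> 0) at_top" by (simp add: mult_ac)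
  qed
  then have "((\<lambda>x::real. exp (- x) * poly p x) \<longlongrightarrow> 0) at_top"
    by (simp add: poly_altdef)
  then have "((\<lambda>x::real. exp (- inverse x) * poly p (inverse x)) \<longlongrightarrow> 0) (at_right 0)"
    by (rule filterlim_compose) (rule filterlim_inverse_at_top_right)
  then show ?thesis
    by (rule Lim_transform_eventually)
      (auto simp: eventually_at_filter flat_def field_simps)
qed

text \<open>With t = 1 / x one has dt/dx = - t^2, so p(t) exp (- t) differentiates to t^2 (p -
  p')(t) exp (- t). At 0 the right difference quotient is the family member for t p(t), which tends
  to 0.\<close>

lemma flat_has_derivative: "(flat p has_real_derivative flat ([:0, 0, 1:] * (p - pderiv p)) x) (at x)"
proof (cases x "0 :: real" rule: linorder_cases)
  case less
  have "((\<lambda>x. 0 :: real) has_real_derivative 0) (at x)" by simp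
  then have "(flat p has_real_derivative 0) (at x)"
    by (rule has_field_derivative_transform_within_open[of _ _ _ "{..<0}"]) (use less in \<open>auto simp: flat_def\<close>)
  then show ?thesis using less by (simp add: flat_def)
next
  case equal
  have "((\<lambda>h. (flat p (0 + h) - flat p 0) / h) \<longlongrightarrow> 0) (at 0)"
  proof (subst filterlim_at_split, intro conjI)
    show "((\<lambda>h. (flat p (0 + h) - flat p 0) / h) \<longlongrightarrow> 0) (at_left 0)"
      by (rule tendsto_eventually) (auto simp: eventually_at_filter flat_def)
    show "((\<lambda>h. (flat p (0 + h) - flat p 0) / h) \<longlongrightarrow> 0) (at_right 0)"
      by (rule Lim_transform_eventually[OF flat_tendsto_0[of "[:0, 1:] * p"]])
         (auto simp: eventually_at_filter flat_def)
  qed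
  then show ?thesis using equal by (simp add: DERIV_def flat_def)
next
  case greater
  have "((\<lambda>x. poly p (1 / x) * exp (- 1 / x)) has_real_derivative flat ([:0, 0, 1:] * (p - pderiv p)) x) (at x)"
    using greater
    by (auto intro!: derivative_eq_intros simp: flat_def power2_eq_square field_simps)
  then show ?thesis
    by (rule has_field_derivative_transform_within_open[of _ _ _ "{0<..}"]) (use greater in \<open>auto simp: flat_def\<close>)
qed

lemma smooth_fun_flat: "smooth_fun (flat p)"
  by (rule smooth_fun_coinduct[of _ "range flat"]) (auto intro: flat_has_derivative)

section \<open>Bump, step and plateau functions\<close>

lemma smooth_bump_exists:
  obtains \<eta> :: "real \<Rightarrow> real" where "smooth_fun \<eta>" "\<And>x. 0 \<le> \<eta> x" "\<And>x. \<bar>x\<bar> \<ge> 1 \<Longrightarrow> \<eta> x = 0"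
    "integrable lborel \<eta>" "(LINT x|lborel. \<eta> x) = 1"
proof -
  define b where "b x = flat 1 (1 * x + 1) * flat 1 ((-1) * x + 1)" for x
  have sm: "smooth_fun b"
    unfolding b_def[abs_def] by (intro smooth_fun_mult smooth_fun_affine smooth_fun_flat)
  have nn: "0 \<le> b x" for x by (simp add: b_def flat_def)
  have z: "b x = 0" if "\<bar>x\<bar> \<ge> 1" for x using that by (auto simp: b_def flat_def)
  have cont: "continuous_on A b" for A by (rule smooth_fun_continuous[OF sm])
  have "integrable lborel (\<lambda>x. indicator {-1..1} x *\<^sub>R b x)"
    using borel_integrable_atLeastAtMost'[OF cont[of "{-1..1}"]] by (simp add: set_integrable_def)
  moreover have "indicator {-1..1} x *\<^sub>R b x = b x" for x using z[of x] by (force simp: indicator_def)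
  ultimately have i: "integrable lborel b" by (simp only:)
  have "(LINT x|lborel. b x) \<noteq> 0"
  proof
    assume "(LINT x|lborel. b x) = 0"
    then have "AE x in lborel. b x = 0"
      using integral_nonneg_eq_0_iff_AE[OF i] nn by auto
    then have "AE x in lborel. x \<notin> {-1<..<(1::real)}"
      by eventually_elim (auto simp: b_def flat_def)
    then have "emeasure lborel {-1<..<(1::real)} = 0"
      by (subst (asm) AE_iff_measurable[of "{-1<..<1}"]) auto
    then show False by simp
  qed
  moreover have "(LINT x|lborel. b x) \<ge> 0" using nn by simp
  ultimately have p: "(LINT x|lborel. b x) > 0" by simp
  show ?thesis
  proof (rule that[of "\<lambda>x. (1 / (LINT x|lborel. b x)) * b x"])
    show "smooth_fun (\<lambda>x. (1 / (LINT x|lborel. b x)) * b x)"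
      by (intro smooth_fun_mult smooth_fun_const sm)
  qed (use p nn z i in auto)
qed

definition bump :: "real \<Rightarrow> real" where
  "bump = (SOME \<eta>. smooth_fun \<eta> \<and> (\<forall>x. 0 \<le> \<eta> x) \<and> (\<forall>x. \<bar>x\<bar> \<ge> 1 \<longrightarrow> \<eta> x = 0)
      \<and> integrable lborel \<eta> \<and> (LINT x|lborel. \<eta> x) = 1)"

lemma bump_props:
  shows smooth_bump: "smooth_fun bump" and bump_nonneg: "0 \<le> bump x" and bump_zero: "\<bar>x\<bar> \<ge> 1 \<Longrightarrow> bump x = 0"
    and bump_integrable: "integrable lborel bump" and bump_integral: "(LINT x|lborel. bump x) = 1"
proof -
  have "\<exists>\<eta>. smooth_fun \<eta> \<and> (\<forall>x. 0 \<le> \<eta> x) \<and> (\<forall>x. \<bar>x\<bar> \<ge> 1 \<longrightarrow> \<eta> x = 0)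
      \<and> integrable lborel \<eta> \<and> (LINT x|lborel. \<eta> x) = 1"
    using smooth_bump_exists by metis
  from someI_ex[OF this, folded bump_def]
  show "smooth_fun bump" "0 \<le> bump x" "\<bar>x\<bar> \<ge> 1 \<Longrightarrow> bump x = 0" "integrable lborel bump" "(LINT x|lborel. bump x) = 1"
    by auto
qed

definition smooth_step :: "real \<Rightarrow> real" where
  "smooth_step x = (if x < -1 then 0 else integral {-1..x} bump)"

lemma bump_integrable_on: "bump integrable_on {a..b}"
  by (rule integrable_continuous_real[OF smooth_fun_continuous[OF smooth_bump]])

lemma bump_integral_low:
  assumes "x \<le> -1" shows "integral {a..x} bump = 0"
proof -
  have "integral {a..x} bump = integral {a..x} (\<lambda>_. 0)"
    using assms by (intro Henstock_Kurzweil_Integration.integral_cong bump_zero) auto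
  then show ?thesis by simp
qed

lemma smooth_step_has_derivative: "(smooth_step has_real_derivative bump x) (at x)"
proof -
  \<comment> \<open>A base point strictly left of x and of the support of \<open>bump\<close>:
    moving the base there does not change the primitive, and x becomes interior.\<close>
  define c where "c = min (-1) (x - 1) - 1"
  have eq: "smooth_step y = integral {c..y} bump" if "y > c" for y
  proof (cases "y < -1")
    case True
    then show ?thesis by (simp add: smooth_step_def bump_integral_low)
  next
    case False
    have "integral {c..y} bump = integral {c..-1} bump + integral {-1..y} bump"
      using False by (intro Henstock_Kurzweil_Integration.integral_combine[symmetric] bump_integrable_on) (auto simp: c_def)
    then show ?thesis using False by (simp add: smooth_step_def bump_integral_low)
  qed
  have "((\<lambda>y. integral {c..y} bump) has_real_derivative bump x) (at x within {c..x+1})"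
    by (rule integral_has_real_derivative[OF smooth_fun_continuous[OF smooth_bump]]) (auto simp: c_def)
  moreover have "at x within {c..x+1} = at x"
    by (rule at_within_Icc_at) (auto simp: c_def)
  ultimately have "((\<lambda>y. integral {c..y} bump) has_real_derivative bump x) (at x)" by simp
  then show ?thesis
    by (rule has_field_derivative_transform_within_open[of _ _ _ "{c<..}"]) (auto simp: eq, simp add: c_def)
qed

lemma smooth_smooth_step: "smooth_fun smooth_step"
  by (rule smooth_funI[OF smooth_step_has_derivative smooth_bump])

lemma smooth_step_mono: "x \<le> y \<Longrightarrow> smooth_step x \<le> smooth_step y"
  by (rule DERIV_nonneg_imp_nondecreasing) (auto intro: smooth_step_has_derivative bump_nonneg)

lemma smooth_step_low: "x \<le> -1 \<Longrightarrow> smooth_step x = 0"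
  by (auto simp: smooth_step_def bump_integral_low)

lemma smooth_step_high:
  assumes "x \<ge> 1" shows "smooth_step x = 1"
proof -
  have "smooth_step x = integral UNIV (\<lambda>t. if t \<in> {-1..x} then bump t else 0)"
    unfolding integral_restrict_UNIV using assms by (simp add: smooth_step_def)
  also have "(\<lambda>t. if t \<in> {-1..x} then bump t else 0) = bump"
    using assms by (auto simp: fun_eq_iff intro!: bump_zero)
  also have "integral UNIV bump = 1"
    using integral_lborel[OF bump_integrable] bump_integral by simp
  finally show ?thesis .
qed

lemma smooth_step_bounds: "0 \<le> smooth_step x" "smooth_step x \<le> 1"
  using smooth_step_mono[of "min x (-1)" x] smooth_step_mono[of x "max x 1"]
  by (auto simp: smooth_step_low smooth_step_high)

lemma bump_bounded: obtains B where "\<And>x. bump x \<le> B"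
proof -
  have "\<exists>x\<in>{-1..1}. \<forall>y\<in>{-1..1}. bump y \<le> bump x"
    by (rule continuous_attains_sup) (auto intro: smooth_fun_continuous[OF smooth_bump])
  then obtain x where "\<And>y. y \<in> {-1..1} \<Longrightarrow> bump y \<le> bump x" by blast
  then have "bump y \<le> bump x" for y
  proof (cases "\<bar>y\<bar> \<ge> 1")
    case False
    then have "y \<in> {-1..1}" by auto
    then show ?thesis by fact
  qed (simp add: bump_zero bump_nonneg)
  then show ?thesis using that by blast
qed

text \<open>A smooth indicator of [a, b] with ramps of half-width \<epsilon>. It serves as cutoff at
  infinity (\<epsilon> = 1, growing interval) and as approximation of the indicator (\<epsilon>
  tending to 0); its derivative is a difference of mollifiers at a and b.\<close>

definition plateau :: "real \<Rightarrow> real \<Rightarrow> real \<Rightarrow> real \<Rightarrow> real" where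
  "plateau \<epsilon> a b x = smooth_step ((x - a) / \<epsilon>) - smooth_step ((x - b) / \<epsilon>)"

definition plateau' :: "real \<Rightarrow> real \<Rightarrow> real \<Rightarrow> real \<Rightarrow> real" where
  "plateau' \<epsilon> a b x = bump ((x - a) / \<epsilon>) / \<epsilon> - bump ((x - b) / \<epsilon>) / \<epsilon>"

lemma plateau_has_derivative: "(plateau \<epsilon> a b has_real_derivative plateau' \<epsilon> a b x) (at x)"
proof -
  have "((\<lambda>x. smooth_step ((x - c) / \<epsilon>)) has_real_derivative bump ((x - c) / \<epsilon>) * (1 / \<epsilon>)) (at x)" for c
    by (rule DERIV_chain2[OF smooth_step_has_derivative], rule DERIV_cdivide) (auto intro!: derivative_eq_intros)
  from DERIV_diff[OF this[of a] this[of b]] show ?thesis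
    by (simp add: plateau_def[abs_def] plateau'_def)
qed

lemma smooth_plateau: "smooth_fun (plateau \<epsilon> a b)"
proof -
  have "smooth_fun (\<lambda>x. smooth_step ((1 / \<epsilon>) * x + - c / \<epsilon>))" for c
    by (rule smooth_fun_affine[OF smooth_smooth_step])
  from smooth_fun_diff[OF this[of a] this[of b]] show ?thesis
    by (simp add: plateau_def[abs_def] diff_divide_distrib)
qed

lemma plateau_support:
  assumes "0 < \<epsilon>" "a \<le> b" "x < a - \<epsilon> \<or> x > b + \<epsilon>"
  shows "plateau \<epsilon> a b x = 0"
  using assms unfolding plateau_def
  by (auto simp: smooth_step_low smooth_step_high field_simps)

lemma plateau_bounds:
  assumes "0 < \<epsilon>" "a \<le> b"
  shows "0 \<le> plateau \<epsilon> a b x" "plateau \<epsilon> a b x \<le> 1"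
  using assms smooth_step_mono[of "(x - b) / \<epsilon>" "(x - a) / \<epsilon>"] smooth_step_bounds[of "(x - b) / \<epsilon>"]
    smooth_step_bounds[of "(x - a) / \<epsilon>"]
  by (auto simp: plateau_def field_simps)

lemma plateau_inside:
  assumes "0 < \<epsilon>" "a + \<epsilon> \<le> x" "x \<le> b - \<epsilon>"
  shows "plateau \<epsilon> a b x = 1" "plateau' \<epsilon> a b x = 0"
proof -
  have ge: "(x - a) / \<epsilon> \<ge> 1" "(x - b) / \<epsilon> \<le> -1" using assms by (auto simp: field_simps)
  then have abs_ge: "\<bar>(x - a) / \<epsilon>\<bar> \<ge> 1" "\<bar>(x - b) / \<epsilon>\<bar> \<ge> 1" by linarith+
  from ge show "plateau \<epsilon> a b x = 1" "plateau' \<epsilon> a b x = 0"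
    using bump_zero[OF abs_ge(1)] bump_zero[OF abs_ge(2)]
    by (simp_all add: plateau_def plateau'_def smooth_step_low smooth_step_high)
qed

lemma test_fun_plateau_mult:
  assumes "smooth_fun v" "0 < \<epsilon>" "a \<le> b"
  shows "test_fun (\<lambda>x. v x * plateau \<epsilon> a b x)"
proof -
  have "{x. v x * plateau \<epsilon> a b x \<noteq> 0} \<subseteq> {a - \<epsilon>..b + \<epsilon>}"
  proof
    fix x assume "x \<in> {x. v x * plateau \<epsilon> a b x \<noteq> 0}"
    then have "\<not> (x < a - \<epsilon> \<or> x > b + \<epsilon>)" using plateau_support[OF assms(2,3), of x] by auto
    then show "x \<in> {a - \<epsilon>..b + \<epsilon>}" by auto
  qed
  then have "closure {x. v x * plateau \<epsilon> a b x \<noteq> 0} \<subseteq> {a - \<epsilon>..b + \<epsilon>}"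
    by (intro closure_minimal) auto
  then have "compact (closure {x. v x * plateau \<epsilon> a b x \<noteq> 0})"
    by (metis bounded_closed_interval bounded_subset closed_closure compact_eq_bounded_closed)
  then show ?thesis
    using smooth_fun_mult[OF assms(1) smooth_plateau] by (simp add: test_fun_def)
qed

lemma plateau'_measurable [measurable]: "plateau' \<epsilon> a b \<in> borel_measurable borel"
proof -
  have "bump \<in> borel_measurable borel"
    by (intro borel_measurable_continuous_onI smooth_fun_continuous smooth_bump)
  then show ?thesis unfolding plateau'_def[abs_def] by measurable
qed

lemma plateau_measurable [measurable]: "plateau \<epsilon> a b \<in> borel_measurable borel"
  by (intro borel_measurable_continuous_onI smooth_fun_continuous smooth_plateau)

text \<open>\<open>weak_deriv\<close> speaks only of compactly supported test functions. The
  Gaussian-weighted polynomial is multiplied by plateaus on growing intervals; the plateau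
  derivatives are uniformly bounded and eventually vanish at each point, so dominated convergence
  removes the cutoff.\<close>

lemma weak_deriv_gauss_poly:
  assumes w: "w \<in> L2_space" and g: "g \<in> L2_space" and wd: "weak_deriv w g" and \<beta>: "\<beta> \<noteq> 0"
  shows "L2_inner w (gauss_poly \<beta> (gauss_deriv \<beta> p)) = - L2_inner g (gauss_poly \<beta> p)"
proof -
  let ?v = "gauss_poly \<beta> p" and ?v' = "gauss_poly \<beta> (gauss_deriv \<beta> p)"
  let ?c = "\<lambda>n::nat. plateau 1 (- real n - 1) (real n + 1)" and ?c' = "\<lambda>n::nat. plateau' 1 (- real n - 1) (real n + 1)"
  note [measurable] = L2_space_measurable[OF w] L2_space_measurable[OF g]
  obtain B where B: "\<And>x. bump x \<le> B" using bump_bounded by blast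
  have B0: "0 \<le> B" using B[of 0] bump_nonneg[of 0] by linarith
  have in1: "eventually (\<lambda>n. ?c n x = 1 \<and> ?c' n x = 0) sequentially" for x
  proof -
    obtain n0 where "\<bar>x\<bar> < real n0" using reals_Archimedean2 by blast
    then show ?thesis
      by (intro eventually_sequentiallyI[of n0]) (auto intro!: plateau_inside)
  qed
  have b: "\<bar>?c n x\<bar> \<le> 1" "\<bar>?c' n x\<bar> \<le> B" for n x
    using plateau_bounds[of 1 "- real n - 1" "real n + 1" x]
      B[of "x + real n + 1"] B[of "x - real n - 1"] bump_nonneg[of "x + real n + 1"] bump_nonneg[of "x - real n - 1"]
    by (auto simp: plateau'_def abs_le_iff algebra_simps)
  have eq: "(LINT x|lborel. w x * (?v' x * ?c n x + ?v x * ?c' n x)) = - (LINT x|lborel. g x * (?v x * ?c n x))" for n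
  proof -
    have "deriv (\<lambda>x. ?v x * ?c n x) = (\<lambda>x. ?v' x * ?c n x + ?v x * ?c' n x)"
      by (auto intro!: ext DERIV_imp_deriv derivative_eq_intros gauss_poly_has_derivative plateau_has_derivative)
    then show ?thesis
      using wd[unfolded weak_deriv_def, rule_format, OF test_fun_plateau_mult[OF smooth_fun_gauss_poly[of \<beta> p], of 1 "- real n - 1" "real n + 1"]]
      by simp
  qed
  have l1: "(\<lambda>n. LINT x|lborel. w x * (?v' x * ?c n x + ?v x * ?c' n x)) \<longlonglongrightarrow> (LINT x|lborel. w x * ?v' x)"
  proof (rule integral_dominated_convergence[where w="\<lambda>x. \<bar>w x * ?v' x\<bar> + B * \<bar>w x * ?v x\<bar>"])
    show "integrable lborel (\<lambda>x. \<bar>w x * ?v' x\<bar> + B * \<bar>w x * ?v x\<bar>)"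
      using w \<beta> by (intro Bochner_Integration.integrable_add integrable_mult_right integrable_abs
          L2_space_mult_integrable gauss_poly_L2)
    show "AE x in lborel. (\<lambda>n. w x * (?v' x * ?c n x + ?v x * ?c' n x)) \<longlonglongrightarrow> w x * ?v' x"
    proof (intro AE_I2 tendsto_eventually)
      fix x show "\<forall>\<^sub>F n in sequentially. w x * (?v' x * ?c n x + ?v x * ?c' n x) = w x * ?v' x"
        using in1[of x] by eventually_elim simp
    qed
    show "AE x in lborel. norm (w x * (?v' x * ?c n x + ?v x * ?c' n x)) \<le> \<bar>w x * ?v' x\<bar> + B * \<bar>w x * ?v x\<bar>" for n
    proof (intro AE_I2)
      fix x
      have "norm (w x * (?v' x * ?c n x + ?v x * ?c' n x)) \<le> \<bar>w x * ?v' x\<bar> * \<bar>?c n x\<bar> + \<bar>?c' n x\<bar> * \<bar>w x * ?v x\<bar>"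
        using abs_triangle_ineq[of "w x * ?v' x * ?c n x" "w x * ?v x * ?c' n x"]
        by (simp add: abs_mult algebra_simps)
      also have "\<dots> \<le> \<bar>w x * ?v' x\<bar> * 1 + B * \<bar>w x * ?v x\<bar>"
        using b by (intro add_mono mult_left_mono mult_right_mono) auto
      finally show "norm (w x * (?v' x * ?c n x + ?v x * ?c' n x)) \<le> \<bar>w x * ?v' x\<bar> + B * \<bar>w x * ?v x\<bar>" by simp
    qed
  qed measurable
  have l2: "(\<lambda>n. - (LINT x|lborel. g x * (?v x * ?c n x))) \<longlonglongrightarrow> - (LINT x|lborel. g x * ?v x)"
  proof (intro tendsto_minus integral_dominated_convergence[where w="\<lambda>x. \<bar>g x * ?v x\<bar>"])
    show "integrable lborel (\<lambda>x. \<bar>g x * ?v x\<bar>)"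
      using g \<beta> by (intro integrable_abs L2_space_mult_integrable gauss_poly_L2)
    show "AE x in lborel. (\<lambda>n. g x * (?v x * ?c n x)) \<longlonglongrightarrow> g x * ?v x"
    proof (intro AE_I2 tendsto_eventually)
      fix x show "\<forall>\<^sub>F n in sequentially. g x * (?v x * ?c n x) = g x * ?v x"
        using in1[of x] by eventually_elim simp
    qed
    show "AE x in lborel. norm (g x * (?v x * ?c n x)) \<le> \<bar>g x * ?v x\<bar>" for n
    proof (intro AE_I2)
      fix x show "norm (g x * (?v x * ?c n x)) \<le> \<bar>g x * ?v x\<bar>"
        using mult_left_mono[OF b(1)[of n x], of "\<bar>g x * ?v x\<bar>"] by (simp add: abs_mult mult_ac)
    qed
  qed measurable
  show ?thesis
    using LIMSEQ_unique[OF l1[unfolded eq] l2] by (simp add: L2_inner_def)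
qed

lemma integrable_continuous_compact_support:
  fixes h :: "real \<Rightarrow> real"
  assumes "continuous_on UNIV h" "\<And>x. \<bar>x\<bar> > R \<Longrightarrow> h x = 0"
  shows "integrable lborel h"
proof -
  have "integrable lborel (\<lambda>x. indicator {-R..R} x *\<^sub>R h x)"
    using borel_integrable_atLeastAtMost'[OF continuous_on_subset[OF assms(1)], of "-R" R] by (simp add: set_integrable_def)
  moreover have "indicator {-R..R} x *\<^sub>R h x = h x" for x using assms(2)[of x] by (force simp: indicator_def)
  ultimately show ?thesis by (simp only:)
qed

lemma bump_approx_identity:
  fixes f :: "real \<Rightarrow> real"
  assumes "continuous_on UNIV f"
  shows "(\<lambda>n. LINT x|lborel. f x * (bump ((x - a) / (1 / (real n + 1))) / (1 / (real n + 1)))) \<longlonglongrightarrow> f a"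
proof -
  let ?e = "\<lambda>n::nat. 1 / (real n + 1)"
  have [measurable]: "f \<in> borel_measurable borel" "bump \<in> borel_measurable borel"
    using assms by (auto intro!: borel_measurable_continuous_onI smooth_fun_continuous smooth_bump)
  obtain K where K: "\<And>x. x \<in> {a - 1..a + 1} \<Longrightarrow> \<bar>f x\<bar> \<le> K"
  proof -
    have "\<exists>y\<in>{a - 1..a + 1}. \<forall>x\<in>{a - 1..a + 1}. \<bar>f x\<bar> \<le> \<bar>f y\<bar>"
      by (rule continuous_attains_sup) (auto intro: continuous_on_rabs continuous_on_subset[OF assms])
    then show ?thesis using that by blast
  qed
  have "(LINT x|lborel. f x * (bump ((x - a) / ?e n) / ?e n)) = (LINT s|lborel. f (a + ?e n * s) * bump s)" for n
    by (subst lborel_integral_real_affine[where c="?e n" and t=a]) (auto simp: mult.assoc[symmetric])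
  moreover have "(\<lambda>n. LINT s|lborel. f (a + ?e n * s) * bump s) \<longlonglongrightarrow> (LINT s|lborel. f a * bump s)"
  proof (rule integral_dominated_convergence[where w="\<lambda>s. K * bump s"])
    show "AE s in lborel. (\<lambda>n. f (a + ?e n * s) * bump s) \<longlonglongrightarrow> f a * bump s"
    proof (intro AE_I2 tendsto_mult_right)
      fix s :: real
      have "(\<lambda>n. a + ?e n * s) \<longlonglongrightarrow> a" by real_asymp
      then show "(\<lambda>n. f (a + ?e n * s)) \<longlonglongrightarrow> f a"
        by (rule continuous_on_tendsto_compose[OF assms]) auto
    qed
    show "AE s in lborel. norm (f (a + ?e n * s) * bump s) \<le> K * bump s" for n
    proof (intro AE_I2)
      fix s :: real
      show "norm (f (a + ?e n * s) * bump s) \<le> K * bump s"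
      proof (cases "\<bar>s\<bar> \<ge> 1")
        case False
        have "\<bar>?e n * s\<bar> \<le> 1 * 1" using False unfolding abs_mult by (intro mult_mono) auto
        then have "a + ?e n * s \<in> {a - 1..a + 1}" unfolding atLeastAtMost_iff by linarith
        then have "\<bar>f (a + ?e n * s)\<bar> \<le> K" by (rule K)
        then show ?thesis using bump_nonneg[of s] by (simp add: abs_mult mult_right_mono)
      qed (simp add: bump_zero)
    qed
  qed (auto simp: bump_integrable)
  ultimately show ?thesis by (simp add: bump_integral)
qed

lemma L2_space_integrable_Icc:
  assumes "g \<in> L2_space"
  shows "integrable lborel (\<lambda>x. g x * indicator {a..b::real} x)"
proof (rule L2_space_mult_integrable[OF assms])
  show "indicator {a..b} \<in> L2_space"
  proof -
    have "(indicator {a..b} x :: real)^2 = indicator {a..b} x" for x by (simp add: indicator_def)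
    then show ?thesis by (auto simp: L2_space_def emeasure_lborel_Icc_eq intro!: integrable_real_indicator)
  qed
qed

text \<open>Tested against a plateau on [a, b], f is averaged by mollifiers at a and b; continuity
  turns the averages into point values as the ramps shrink. This is the link from nodal values of f
  to its weak derivative.\<close>

lemma weak_deriv_FTC:
  fixes f g :: "real \<Rightarrow> real"
  assumes f: "continuous_on UNIV f" and g: "g \<in> L2_space" and wd: "weak_deriv f g" and ab: "a \<le> b"
  shows "f b - f a = (LINT x|lborel. g x * indicator {a..b} x)"
proof -
  let ?e = "\<lambda>n::nat. 1 / (real n + 1)"
  note [measurable] = L2_space_measurable[OF g]
  have cb: "continuous_on UNIV (\<lambda>x. f x * (bump ((x - c) / \<epsilon>) / \<epsilon>))" if "\<epsilon> \<noteq> 0" for c \<epsilon>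
    using f that by (intro continuous_intros continuous_on_compose2[OF smooth_fun_continuous[OF smooth_bump, of UNIV]]) auto
  have i: "integrable lborel (\<lambda>x. f x * (bump ((x - c) / ?e n) / ?e n))" for c n
  proof (rule integrable_continuous_compact_support[OF cb])
    show "?e n \<noteq> 0" by simp
    fix x assume "\<bar>x\<bar> > \<bar>c\<bar> + 1"
    then have "1 \<le> \<bar>x - c\<bar>" by linarith
    also have "\<dots> = \<bar>x - c\<bar> * 1" by simp
    also have "\<dots> \<le> \<bar>x - c\<bar> * (real n + 1)" by (intro mult_left_mono) auto
    also have "\<dots> = \<bar>(x - c) / ?e n\<bar>" by (simp add: abs_mult)
    finally have "bump ((x - c) / ?e n) = 0" by (rule bump_zero)
    then show "f x * (bump ((x - c) / ?e n) / ?e n) = 0" by simp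
  qed
  have "(LINT x|lborel. f x * (bump ((x - a) / ?e n) / ?e n)) - (LINT x|lborel. f x * (bump ((x - b) / ?e n) / ?e n))
     = - (LINT x|lborel. g x * plateau (?e n) a b x)" for n
  proof -
    have "deriv (\<lambda>x. 1 * plateau (?e n) a b x) = plateau' (?e n) a b"
      using plateau_has_derivative by (auto intro!: ext DERIV_imp_deriv)
    then have "(LINT x|lborel. f x * plateau' (?e n) a b x) = - (LINT x|lborel. g x * plateau (?e n) a b x)"
      using wd[unfolded weak_deriv_def, rule_format, OF test_fun_plateau_mult[OF smooth_fun_const[of 1], of "?e n" a b]] ab
      by simp
    moreover have "(LINT x|lborel. f x * plateau' (?e n) a b x)
      = (LINT x|lborel. f x * (bump ((x - a) / ?e n) / ?e n) - f x * (bump ((x - b) / ?e n) / ?e n))"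
      by (simp add: plateau'_def algebra_simps)
    ultimately show ?thesis by (simp only: Bochner_Integration.integral_diff[OF i i])
  qed
  moreover have "(\<lambda>n. (LINT x|lborel. f x * (bump ((x - a) / ?e n) / ?e n)) - (LINT x|lborel. f x * (bump ((x - b) / ?e n) / ?e n))) \<longlonglongrightarrow> f a - f b"
    by (intro tendsto_diff bump_approx_identity f)
  moreover have "(\<lambda>n. - (LINT x|lborel. g x * plateau (?e n) a b x)) \<longlonglongrightarrow> - (LINT x|lborel. g x * indicator {a..b} x)"
  proof (intro tendsto_minus integral_dominated_convergence[where w="\<lambda>x. \<bar>g x * indicator {a - 1..b + 1} x\<bar>"])
    show "integrable lborel (\<lambda>x. \<bar>g x * indicator {a - 1..b + 1} x\<bar>)"
      by (intro integrable_abs L2_space_integrable_Icc g)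
    \<comment> \<open>At the endpoints the plateaus need not converge to the indicator; they are
      discarded as a null set.\<close>
    have fin: "finite {a, b}" by simp
    have "AE x in lborel. x \<notin> {a, b}" by (intro AE_not_in finite_imp_null_set_lborel fin)
    then show "AE x in lborel. (\<lambda>n. g x * plateau (?e n) a b x) \<longlonglongrightarrow> g x * indicator {a..b} x"
    proof eventually_elim
      case (elim x)
      define d where "d = min \<bar>x - a\<bar> \<bar>x - b\<bar>"
      have d: "d > 0" using elim by (auto simp: d_def)
      have "eventually (\<lambda>n. ?e n < d) sequentially"
      proof -
        have "?e \<longlonglongrightarrow> 0" by real_asymp
        then show ?thesis using d by (simp add: order_tendsto_iff)
      qed
      then have "eventually (\<lambda>n. g x * plateau (?e n) a b x = g x * indicator {a..b} x) sequentially"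
      proof eventually_elim
        case n: (elim n)
        have e: "?e n > 0" by simp
        consider "x < a" | "x > b" | "a < x" "x < b" using elim by fastforce
        then have "plateau (?e n) a b x = indicator {a..b} x"
        proof cases
          case 1 then show ?thesis using n ab by (subst plateau_support[OF e ab]) (auto simp: d_def)
        next
          case 2 then show ?thesis using n ab by (subst plateau_support[OF e ab]) (auto simp: d_def)
        next
          case 3 then show ?thesis using n by (subst plateau_inside(1)[OF e]) (auto simp: d_def)
        qed
        then show ?case by simp
      qed
      then show ?case by (rule tendsto_eventually)
    qed
    show "AE x in lborel. norm (g x * plateau (?e n) a b x) \<le> \<bar>g x * indicator {a - 1..b + 1} x\<bar>" for n
    proof (intro AE_I2)
      fix x
      have e: "?e n > 0" "?e n \<le> 1" by auto
      have "\<bar>plateau (?e n) a b x\<bar> \<le> indicator {a - 1..b + 1} x"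
      proof (cases "x \<in> {a - 1..b + 1}")
        case True
        then show ?thesis using plateau_bounds[OF e(1) ab, of x] by simp
      next
        case False
        then have "x < a - ?e n \<or> x > b + ?e n" using e(2) unfolding atLeastAtMost_iff by linarith
        then show ?thesis using False plateau_support[OF e(1) ab] by simp
      qed
      then show "norm (g x * plateau (?e n) a b x) \<le> \<bar>g x * indicator {a - 1..b + 1} x\<bar>"
        by (simp add: abs_mult mult_left_mono)
    qed
  qed measurable
  ultimately have "f a - f b = - (LINT x|lborel. g x * indicator {a..b} x)"
    using LIMSEQ_unique by auto
  then show ?thesis by simp
qed

section \<open>The Plancherel theorem\<close>

lemma borel_measurable_cis [measurable]: "cis \<in> borel_measurable borel"
  by (intro borel_measurable_continuous_onI) (auto simp: cis_conv_exp[abs_def] intro!: continuous_intros)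

lemma borel_measurable_cis' [measurable (raw)]:
  "f \<in> borel_measurable M \<Longrightarrow> (\<lambda>x. cis (f x)) \<in> borel_measurable M"
  by (rule measurable_compose[OF _ borel_measurable_cis])

lemma borel_measurable_cnj' [measurable (raw)]:
  "f \<in> borel_measurable M \<Longrightarrow> (\<lambda>x. cnj (f x)) \<in> borel_measurable M"
  by (rule measurable_compose[where g=cnj]) (auto intro!: borel_measurable_continuous_onI continuous_intros)

lemma integrable_mult_bounded:
  fixes f g :: "real \<Rightarrow> complex"
  assumes "integrable lborel f" "g \<in> borel_measurable borel" "\<And>x. cmod (g x) \<le> C"
  shows "integrable lborel (\<lambda>x. f x * g x)"
proof (rule Bochner_Integration.integrable_bound)
  show "integrable lborel (\<lambda>x. C * cmod (f x))" using assms(1) by auto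
  show "(\<lambda>x. f x * g x) \<in> borel_measurable lborel"
    using borel_measurable_integrable[OF assms(1)] assms(2) by simp
  have "0 \<le> C" using assms(3)[of 0] norm_ge_zero order_trans by blast
  then show "AE x in lborel. norm (f x * g x) \<le> norm (C * cmod (f x))"
    using assms(3) by (intro AE_I2) (auto simp: norm_mult mult.commute[of C] intro!: mult_left_mono)
qed

text \<open>Fubini in the shape to which the interchanges of complex integrals below are brought:
  two integrable factors and a bounded kernel. Where integrability or boundedness fails at first, a
  Gaussian is shifted between factor and kernel.\<close>

lemma bounded_kernel_swap:
  fixes a b :: "real \<Rightarrow> complex" and K :: "real \<Rightarrow> real \<Rightarrow> complex"
  assumes a: "integrable lborel a" and b: "integrable lborel b"
    and K[measurable]: "(\<lambda>(x, y). K x y) \<in> borel_measurable (borel \<Otimes>\<^sub>M borel)" and C: "\<And>x y. cmod (K x y) \<le> C"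
  shows "(LINT x|lborel. a x * (LINT y|lborel. b y * K x y)) = (LINT y|lborel. b y * (LINT x|lborel. a x * K x y))"
proof -
  have [measurable]: "a \<in> borel_measurable borel" "b \<in> borel_measurable borel"
    using a b by (auto dest: borel_measurable_integrable)
  have C0: "0 \<le> C" using C[of 0 0] norm_ge_zero order_trans by blast
  have i: "integrable (lborel \<Otimes>\<^sub>M lborel) (\<lambda>(x, y). a x * (b y * K x y))"
  proof (rule lborel_pair.Fubini_integrable)
    show "(\<lambda>(x, y). a x * (b y * K x y)) \<in> borel_measurable (lborel \<Otimes>\<^sub>M lborel)"
      by measurable
    show "AE x in lborel. integrable lborel (\<lambda>y. case (x, y) of (x, y) \<Rightarrow> a x * (b y * K x y))"
      using integrable_mult_bounded[OF b _ C] by (auto intro!: AE_I2 integrable_mult_right)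
    have "integrable lborel (\<lambda>x. cmod (a x) * (LINT y|lborel. cmod (b y * K x y)))"
    proof (rule Bochner_Integration.integrable_bound)
      show "integrable lborel (\<lambda>x. cmod (a x) * (C * (LINT y|lborel. cmod (b y))))"
        using a by auto
      have "(LINT y|lborel. cmod (b y * K x y)) \<le> (LINT y|lborel. C * cmod (b y))" for x
        using b integrable_norm[OF integrable_mult_bounded[OF b, of "K x" C]] C
        by (intro integral_mono) (auto simp: norm_mult mult.commute[of C] intro!: mult_left_mono)
      then show "AE x in lborel. norm (cmod (a x) * (LINT y|lborel. cmod (b y * K x y)))
          \<le> norm (cmod (a x) * (C * (LINT y|lborel. cmod (b y))))"
        using C0 by (intro AE_I2) (auto simp: abs_mult intro!: mult_left_mono)
    qed measurable
    then show "integrable lborel (\<lambda>x. LINT y|lborel. norm (case (x, y) of (x, y) \<Rightarrow> a x * (b y * K x y)))"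
      by (simp add: norm_mult mult.assoc)
  qed
  have "(LINT x|lborel. a x * (LINT y|lborel. b y * K x y)) = (LINT x|lborel. LINT y|lborel. a x * (b y * K x y))"
    by simp
  also have "\<dots> = (LINT y|lborel. LINT x|lborel. a x * (b y * K x y))"
    by (rule lborel_pair.Fubini_integral[symmetric, OF i])
  also have "\<dots> = (LINT y|lborel. LINT x|lborel. b y * (a x * K x y))"
    by (simp add: mult.left_commute)
  also have "\<dots> = (LINT y|lborel. b y * (LINT x|lborel. a x * K x y))"
    by simp
  finally show ?thesis .
qed

lemma gaussian_fourier:
  assumes "\<epsilon> > 0"
  shows "(LINT k|lborel. complex_of_real (exp (- \<epsilon> * k^2 / 2)) * cis (t * k))
     = complex_of_real (sqrt (2 * pi / \<epsilon>) * exp (- (t^2) / (2 * \<epsilon>)))"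
proof -
  have c: "(LINT x|lborel. std_normal_density x *\<^sub>R cis (s * x)) = complex_of_real (exp (- (s^2) / 2))" for s
    using fun_cong[OF char_std_normal_distribution, of s]
    by (simp add: char_def integral_density cis_conv_exp mult.commute)
  define r where "r = sqrt \<epsilon>"
  have r: "r > 0" "r^2 = \<epsilon>" "r * r = \<epsilon>" using assms by (auto simp: r_def)
  have "complex_of_real (exp (- ((t/r)^2) / 2)) = (LINT x|lborel. std_normal_density x *\<^sub>R cis ((t/r) * x))"
    by (rule c[symmetric])
  also have "\<dots> = r *\<^sub>R (LINT k|lborel. std_normal_density (0 + r * k) *\<^sub>R cis ((t/r) * (0 + r * k)))"
    using r by (subst lborel_integral_real_affine[where c=r and t=0]) auto
  also have "(\<lambda>k. std_normal_density (0 + r * k) *\<^sub>R cis ((t/r) * (0 + r * k)))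
      = (\<lambda>k. (1 / sqrt (2 * pi)) *\<^sub>R (complex_of_real (exp (- \<epsilon> * k^2 / 2)) * cis (t * k)))"
    using r by (auto simp: fun_eq_iff std_normal_density_def power_mult_distrib scaleR_conv_of_real)
  also have "r *\<^sub>R (LINT k|lborel. \<dots> k) = (r / sqrt (2 * pi)) *\<^sub>R (LINT k|lborel. complex_of_real (exp (- \<epsilon> * k^2 / 2)) * cis (t * k))"
    by simp
  finally have "(sqrt (2 * pi) / r) *\<^sub>R complex_of_real (exp (- ((t/r)^2) / 2))
     = (sqrt (2 * pi) / r) *\<^sub>R ((r / sqrt (2 * pi)) *\<^sub>R (LINT k|lborel. complex_of_real (exp (- \<epsilon> * k^2 / 2)) * cis (t * k)))"
    by simp
  also have "\<dots> = (LINT k|lborel. complex_of_real (exp (- \<epsilon> * k^2 / 2)) * cis (t * k))"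
    using r by simp
  finally show ?thesis
    using r by (simp add: real_sqrt_divide r_def[symmetric] scaleR_conv_of_real power_divide mult.commute)
qed

section \<open>The Fourier integral of integrable functions\<close>

definition cfourier :: "(real \<Rightarrow> complex) \<Rightarrow> real \<Rightarrow> complex" where
  "cfourier h k = complex_of_real (1 / sqrt (2 * pi)) * (LINT x|lborel. h x * cis (- k * x))"

lemma fourier_int_cfourier: "fourier_int w = cfourier (\<lambda>x. complex_of_real (w x))"
  by (simp add: fun_eq_iff fourier_int_def cfourier_def)

lemma cfourier_measurable [measurable (raw)]:
  assumes [measurable]: "h \<in> borel_measurable borel"
  shows "cfourier h \<in> borel_measurable borel"
  unfolding cfourier_def[abs_def] by measurable

lemma cfourier_bound:
  assumes "integrable lborel h"
  shows "cmod (cfourier h k) \<le> 1 / sqrt (2 * pi) * (LINT x|lborel. cmod (h x))"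
proof -
  have "cmod (LINT x|lborel. h x * cis (- k * x)) \<le> (LINT x|lborel. cmod (h x * cis (- k * x)))"
    by (rule integral_norm_bound)
  then show ?thesis by (simp add: cfourier_def norm_mult norm_divide divide_right_mono)
qed

lemma cfourier_diff:
  assumes "integrable lborel f" "integrable lborel g"
  shows "cfourier (\<lambda>x. f x - g x) k = cfourier f k - cfourier g k"
proof -
  have "integrable lborel (\<lambda>x. h x * cis (- k * x))" if "integrable lborel h" for h
    by (rule integrable_mult_bounded[OF that, where C=1]) auto
  then show ?thesis using assms by (simp add: cfourier_def left_diff_distrib right_diff_distrib)
qed

text \<open>The integrable weight m makes the frequency integral absolutely convergent, so the
  identity is pure Fubini. It is used with a Gaussian m for Plancherel and with m =
  \<open>soft_band\<close> for the band-limiting operator.\<close>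

lemma parseval_weight:
  fixes h g m :: "real \<Rightarrow> complex"
  assumes h: "integrable lborel h" and g: "integrable lborel g" and m: "integrable lborel m"
  shows "(LINT k|lborel. m k * (cfourier h k * cnj (cfourier g k)))
    = 1 / (2 * pi) * (LINT x|lborel. h x * (LINT y|lborel. cnj (g y) * (LINT k|lborel. m k * cis (- (x - y) * k))))"
proof -
  have [measurable]: "h \<in> borel_measurable borel" "g \<in> borel_measurable borel" "m \<in> borel_measurable borel"
    using h g m by (auto dest: borel_measurable_integrable)
  define A where "A k = (LINT x|lborel. h x * cis (- k * x))" for k
  define B where "B k = (LINT x|lborel. cnj (g x) * cis (k * x))" for k
  have [measurable]: "A \<in> borel_measurable borel" "B \<in> borel_measurable borel"
    unfolding A_def[abs_def] B_def[abs_def] by measurable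
  have g': "integrable lborel (\<lambda>x. cnj (g x))" using g by simp
  have Bb: "cmod (B k) \<le> (LINT x|lborel. cmod (g x))" for k
    using integral_norm_bound[of lborel "\<lambda>x. cnj (g x) * cis (k * x)"] by (simp add: B_def norm_mult)
  have "cnj (cfourier g k) = complex_of_real (1 / sqrt (2 * pi)) * B k" for k
  proof -
    have "cnj (LINT x|lborel. g x * cis (- k * x)) = B k"
      unfolding B_def Bochner_Integration.integral_cnj[symmetric] by (simp add: cis_cnj)
    then show ?thesis by (simp add: cfourier_def)
  qed
  then have "m k * (cfourier h k * cnj (cfourier g k)) = 1 / (2 * pi) * (m k * B k * A k)" for k
  proof -
    have "complex_of_real (1 / sqrt (2 * pi)) * complex_of_real (1 / sqrt (2 * pi)) = 1 / (2 * pi)"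
      by (simp flip: of_real_mult)
    then show ?thesis
      using \<open>cnj (cfourier g k) = _\<close> by (simp add: cfourier_def A_def mult_ac)
  qed
  then have "(LINT k|lborel. m k * (cfourier h k * cnj (cfourier g k))) = 1 / (2 * pi) * (LINT k|lborel. m k * B k * A k)"
    by simp
  also have "(LINT k|lborel. m k * B k * A k) = (LINT k|lborel. m k * B k * (LINT x|lborel. h x * cis (- k * x)))"
    by (simp add: A_def)
  also have "\<dots> = (LINT x|lborel. h x * (LINT k|lborel. m k * B k * cis (- k * x)))"
    by (rule bounded_kernel_swap[where C=1])
       (auto intro!: integrable_mult_bounded[OF m _ Bb] h)
  also have "\<dots> = (LINT x|lborel. h x * (LINT y|lborel. cnj (g y) * (LINT k|lborel. m k * cis (- (x - y) * k))))"
  proof (rule Bochner_Integration.integral_cong[OF refl], rule arg_cong[where f="(*) _"])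
    fix x
    have "(LINT k|lborel. m k * B k * cis (- k * x)) = (LINT k|lborel. (m k * cis (- k * x)) * (LINT y|lborel. cnj (g y) * cis (k * y)))"
      by (simp add: B_def mult_ac)
    also have "\<dots> = (LINT y|lborel. cnj (g y) * (LINT k|lborel. (m k * cis (- k * x)) * cis (k * y)))"
      by (rule bounded_kernel_swap[where C=1]) (auto intro!: integrable_mult_bounded[OF m, where C=1] g)
    also have "\<dots> = (LINT y|lborel. cnj (g y) * (LINT k|lborel. m k * cis (- (x - y) * k)))"
      by (simp add: mult.assoc cis_mult algebra_simps)
    finally show "(LINT k|lborel. m k * B k * cis (- k * x)) = \<dots>" .
  qed
  finally show ?thesis .
qed

lemma gaussian_parseval:
  assumes h: "integrable lborel h" and \<epsilon>: "\<epsilon> > 0"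
  shows "complex_of_real (LINT k|lborel. exp (- \<epsilon> * k^2 / 2) * (cmod (cfourier h k))^2)
    = (LINT x|lborel. h x * (LINT y|lborel. cnj (h y) * complex_of_real (normal_density 0 (sqrt \<epsilon>) (x - y))))"
proof -
  have m: "integrable lborel (\<lambda>k. exp (- \<epsilon> * k^2 / 2))"
    using exp_poly_integrable[of "\<epsilon> / 2" 1] \<epsilon> by simp
  have G: "(LINT k|lborel. complex_of_real (exp (- \<epsilon> * k^2 / 2)) * cis (- t * k)) = 2 * pi * complex_of_real (normal_density 0 (sqrt \<epsilon>) t)" for t
  proof -
    have "sqrt (2 * pi / \<epsilon>) = 2 * pi * (1 / sqrt (2 * pi * \<epsilon>))"
    proof -
      have "2 * pi * (1 / sqrt (2 * pi * \<epsilon>)) = (2 * pi / sqrt (2 * pi)) / sqrt \<epsilon>"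
        by (simp add: real_sqrt_mult)
      also have "\<dots> = sqrt (2 * pi) / sqrt \<epsilon>" by (subst real_div_sqrt) auto
      finally show ?thesis by (simp add: real_sqrt_divide)
    qed
    then show ?thesis
      unfolding gaussian_fourier[OF \<epsilon>] using \<epsilon> by (simp add: normal_density_def mult_ac)
  qed
  have "complex_of_real (LINT k|lborel. exp (- \<epsilon> * k^2 / 2) * (cmod (cfourier h k))^2)
     = (LINT k|lborel. complex_of_real (exp (- \<epsilon> * k^2 / 2)) * (cfourier h k * cnj (cfourier h k)))"
    unfolding integral_complex_of_real[symmetric] by (simp add: complex_norm_square[symmetric])
  also have "\<dots> = 1 / (2 * pi) * (LINT x|lborel. h x * (LINT y|lborel. cnj (h y) * (2 * pi * complex_of_real (normal_density 0 (sqrt \<epsilon>) (x - y)))))"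
    unfolding G[symmetric] using m by (intro parseval_weight h) auto
  also have "\<dots> = (LINT x|lborel. h x * (LINT y|lborel. cnj (h y) * complex_of_real (normal_density 0 (sqrt \<epsilon>) (x - y))))"
    by (simp add: mult.left_commute[of _ "2 * complex_of_real pi"])
  finally show ?thesis .
qed

lemma nn_integral_normal_density:
  assumes "\<sigma> > 0"
  shows "(\<integral>\<^sup>+ y. ennreal (normal_density 0 \<sigma> (x - y)) \<partial>lborel) = 1"
proof -
  have "normal_density 0 \<sigma> (x - y) = normal_density x \<sigma> y" for y
    by (simp add: normal_density_def power2_commute)
  then show ?thesis
    using assms nn_integral_eq_integral[OF integrable_normal_density[OF assms, of x]] by simp
qed

text \<open>Schur test: |h(x) h(y)| \<le> (|h(x)|^2 + |h(y)|^2) / 2, and the kernel has mass 1 in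
  either variable.\<close>

lemma gaussian_schur_bound:
  fixes h :: "real \<Rightarrow> complex"
  assumes h: "integrable lborel h" and h2: "integrable lborel (\<lambda>x. (cmod (h x))^2)" and \<sigma>: "\<sigma> > 0"
  shows "cmod (LINT x|lborel. h x * (LINT y|lborel. cnj (h y) * complex_of_real (normal_density 0 \<sigma> (x - y))))
    \<le> (LINT x|lborel. (cmod (h x))^2)"
proof -
  let ?G = "\<lambda>t. normal_density 0 \<sigma> t" and ?c = "\<lambda>x. cmod (h x)"
  let ?J = "\<lambda>x. LINT y|lborel. cnj (h y) * complex_of_real (?G (x - y))"
  have [measurable]: "h \<in> borel_measurable borel" using h by (auto dest: borel_measurable_integrable)
  have Gb: "?G t \<le> 1 / sqrt (2 * pi * \<sigma>^2)" for t
    using \<sigma> by (simp add: normal_density_def divide_right_mono)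
  have iy: "integrable lborel (\<lambda>y. cnj (h y) * complex_of_real (?G (x - y)))" for x
    using h Gb by (intro integrable_mult_bounded[where C="1 / sqrt (2 * pi * \<sigma>^2)"]) auto
  have Jb: "ennreal (cmod (?J x)) \<le> (\<integral>\<^sup>+ y. ennreal (?c y * ?G (x - y)) \<partial>lborel)" for x
    using integral_norm_bound_ennreal[OF iy[of x]] by (simp add: norm_mult)
  have Jc: "cmod (?J x) \<le> 1 / sqrt (2 * pi * \<sigma>^2) * (LINT y|lborel. ?c y)" for x
  proof -
    have "cmod (?J x) \<le> (LINT y|lborel. cmod (cnj (h y) * complex_of_real (?G (x - y))))"
      by (rule integral_norm_bound)
    also have "\<dots> \<le> (LINT y|lborel. 1 / sqrt (2 * pi * \<sigma>^2) * ?c y)"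
    proof (rule integral_mono)
      show "integrable lborel (\<lambda>y. cmod (cnj (h y) * complex_of_real (?G (x - y))))"
        by (rule integrable_norm[OF iy])
      show "integrable lborel (\<lambda>y. 1 / sqrt (2 * pi * \<sigma>^2) * ?c y)" using h by auto
      show "cmod (cnj (h y) * complex_of_real (?G (x - y))) \<le> 1 / sqrt (2 * pi * \<sigma>^2) * ?c y" for y
        using mult_left_mono[OF Gb[of "x - y"], of "?c y"] by (simp add: norm_mult mult.commute)
    qed
    finally show ?thesis by simp
  qed
  have ix: "integrable lborel (\<lambda>x. h x * ?J x)"
    by (rule integrable_mult_bounded[OF h _ Jc]) measurable
  have "ennreal (cmod (LINT x|lborel. h x * ?J x)) \<le> (\<integral>\<^sup>+ x. ennreal (?c x) * ennreal (cmod (?J x)) \<partial>lborel)"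
    using integral_norm_bound_ennreal[OF ix] by (simp add: norm_mult ennreal_mult)
  also have "\<dots> \<le> (\<integral>\<^sup>+ x. ennreal (?c x) * (\<integral>\<^sup>+ y. ennreal (?c y * ?G (x - y)) \<partial>lborel) \<partial>lborel)"
    by (intro nn_integral_mono mult_left_mono Jb) auto
  also have "\<dots> = (\<integral>\<^sup>+ x. \<integral>\<^sup>+ y. ennreal (?c x) * ennreal (?c y * ?G (x - y)) \<partial>lborel \<partial>lborel)"
    by (intro nn_integral_cong nn_integral_cmult[symmetric]) auto
  also have "\<dots> \<le> (\<integral>\<^sup>+ x. \<integral>\<^sup>+ y. ennreal (?c x^2 / 2) * ennreal (?G (x - y)) + ennreal (?c y^2 / 2) * ennreal (?G (x - y)) \<partial>lborel \<partial>lborel)"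
  proof (intro nn_integral_mono)
    fix x y
    have "?c x * ?c y \<le> ?c x^2 / 2 + ?c y^2 / 2"
      using zero_le_power2[of "?c x - ?c y"] by (simp add: power2_diff)
    then have "?c x * ?c y * ?G (x - y) \<le> (?c x^2 / 2 + ?c y^2 / 2) * ?G (x - y)"
      by (intro mult_right_mono) auto
    then show "ennreal (?c x) * ennreal (?c y * ?G (x - y)) \<le> ennreal (?c x^2 / 2) * ennreal (?G (x - y)) + ennreal (?c y^2 / 2) * ennreal (?G (x - y))"
      by (simp add: distrib_right mult.assoc flip: ennreal_mult ennreal_plus)
  qed
  also have "\<dots> = (\<integral>\<^sup>+ x. (\<integral>\<^sup>+ y. ennreal (?c x^2 / 2) * ennreal (?G (x - y)) \<partial>lborel)
      + (\<integral>\<^sup>+ y. ennreal (?c y^2 / 2) * ennreal (?G (x - y)) \<partial>lborel) \<partial>lborel)"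
    by (intro nn_integral_cong nn_integral_add) auto
  also have "\<dots> = (\<integral>\<^sup>+ x. \<integral>\<^sup>+ y. ennreal (?c x^2 / 2) * ennreal (?G (x - y)) \<partial>lborel \<partial>lborel)
      + (\<integral>\<^sup>+ x. \<integral>\<^sup>+ y. ennreal (?c y^2 / 2) * ennreal (?G (x - y)) \<partial>lborel \<partial>lborel)"
    by (intro nn_integral_add) auto
  also have "(\<integral>\<^sup>+ x. \<integral>\<^sup>+ y. ennreal (?c y^2 / 2) * ennreal (?G (x - y)) \<partial>lborel \<partial>lborel)
      = (\<integral>\<^sup>+ y. \<integral>\<^sup>+ x. ennreal (?c y^2 / 2) * ennreal (?G (x - y)) \<partial>lborel \<partial>lborel)"
    by (rule lborel_pair.Fubini'[symmetric]) measurable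
  also have "\<dots> = (\<integral>\<^sup>+ x. \<integral>\<^sup>+ y. ennreal (?c x^2 / 2) * ennreal (?G (x - y)) \<partial>lborel \<partial>lborel)"
    by (simp add: normal_density_def power2_commute)
  also have "(\<integral>\<^sup>+ x. \<integral>\<^sup>+ y. ennreal (?c x^2 / 2) * ennreal (?G (x - y)) \<partial>lborel \<partial>lborel) = (\<integral>\<^sup>+ x. ennreal (?c x^2 / 2) \<partial>lborel)"
    by (subst nn_integral_cmult) (auto simp: nn_integral_normal_density[OF \<sigma>])
  also have "(\<integral>\<^sup>+ x. ennreal (?c x^2 / 2) \<partial>lborel) = ennreal ((LINT x|lborel. ?c x^2) / 2)"
    using h2 by (subst nn_integral_eq_integral) auto
  also have "ennreal ((LINT x|lborel. ?c x^2) / 2) + ennreal ((LINT x|lborel. ?c x^2) / 2) = ennreal (LINT x|lborel. ?c x^2)"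
    by (subst ennreal_plus[symmetric]) auto
  finally show ?thesis by (simp add: ennreal_le_iff)
qed

lemma gaussian_damped_integrable:
  assumes "integrable lborel h" "\<epsilon> > 0"
  shows "integrable lborel (\<lambda>k. exp (- \<epsilon> * k^2 / 2) * (cmod (cfourier h k))^2)"
proof -
  have [measurable]: "h \<in> borel_measurable borel" using assms by (auto dest: borel_measurable_integrable)
  let ?B = "1 / sqrt (2 * pi) * (LINT x|lborel. cmod (h x))"
  show ?thesis
  proof (rule Bochner_Integration.integrable_bound)
    show "integrable lborel (\<lambda>k. ?B^2 * exp (- \<epsilon> * k^2 / 2))"
      using exp_poly_integrable[of "\<epsilon> / 2" 1] assms(2) by simp
    show "AE k in lborel. norm (exp (- \<epsilon> * k^2 / 2) * (cmod (cfourier h k))^2) \<le> norm (?B^2 * exp (- \<epsilon> * k^2 / 2))"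
    proof (intro AE_I2)
      fix k
      have "(cmod (cfourier h k))^2 \<le> ?B^2" by (intro power_mono cfourier_bound assms(1)) auto
      from mult_left_mono[OF this, of "exp (- \<epsilon> * k^2 / 2)"]
      show "norm (exp (- \<epsilon> * k^2 / 2) * (cmod (cfourier h k))^2) \<le> norm (?B^2 * exp (- \<epsilon> * k^2 / 2))"
        by (simp add: abs_mult mult.commute)
    qed
  qed measurable
qed

text \<open>Under Gaussian damping the Parseval identity is available; the Schur bound is uniform in
  the damping, and Fatou's lemma removes it. This yields the inequality half of Plancherel, enough
  for continuity of the transform in L2.\<close>

lemma cfourier_bessel:
  assumes h: "integrable lborel h" and h2: "integrable lborel (\<lambda>x. (cmod (h x))^2)"
  shows "integrable lborel (\<lambda>k. (cmod (cfourier h k))^2)"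
    and "(LINT k|lborel. (cmod (cfourier h k))^2) \<le> (LINT x|lborel. (cmod (h x))^2)"
proof -
  have [measurable]: "h \<in> borel_measurable borel" using h by (auto dest: borel_measurable_integrable)
  let ?N = "LINT x|lborel. (cmod (h x))^2" and ?e = "\<lambda>n::nat. 1 / (real n + 1)"
  let ?u = "\<lambda>n k. exp (- ?e n * k^2 / 2) * (cmod (cfourier h k))^2"
  have I: "(LINT k|lborel. ?u n k) \<le> ?N" for n
  proof -
    have e: "?e n > 0" by simp
    have "0 \<le> (LINT k|lborel. ?u n k)" by (intro Bochner_Integration.integral_nonneg) auto
    then have "(LINT k|lborel. ?u n k) = cmod (complex_of_real (LINT k|lborel. ?u n k))" by simp
    also have "\<dots> \<le> ?N" unfolding gaussian_parseval[OF h e]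
      by (rule gaussian_schur_bound[OF h h2]) simp
    finally show ?thesis .
  qed
  have nn: "(\<integral>\<^sup>+ k. ennreal (?u n k) \<partial>lborel) \<le> ennreal ?N" for n
    using I[of n] gaussian_damped_integrable[OF h, of "?e n"] by (subst nn_integral_eq_integral) (auto intro!: ennreal_leI)
  have lim: "liminf (\<lambda>n. ennreal (?u n k)) = ennreal ((cmod (cfourier h k))^2)" for k
  proof (rule lim_imp_Liminf)
    have "(\<lambda>n. exp (- ?e n * k^2 / 2) * (cmod (cfourier h k))^2) \<longlonglongrightarrow> 1 * (cmod (cfourier h k))^2"
    proof (intro tendsto_mult_right)
      have "(\<lambda>n. - ?e n * k^2 / 2) \<longlonglongrightarrow> 0" by real_asymp
      from tendsto_exp[OF this] show "(\<lambda>n. exp (- ?e n * k^2 / 2)) \<longlonglongrightarrow> 1" by simp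
    qed
    then show "(\<lambda>n. ennreal (?u n k)) \<longlonglongrightarrow> ennreal ((cmod (cfourier h k))^2)" by (intro tendsto_ennrealI) simp
  qed simp
  have "(\<integral>\<^sup>+ k. ennreal ((cmod (cfourier h k))^2) \<partial>lborel) = (\<integral>\<^sup>+ k. liminf (\<lambda>n. ennreal (?u n k)) \<partial>lborel)"
    by (simp only: lim)
  also have "\<dots> \<le> liminf (\<lambda>n. \<integral>\<^sup>+ k. ennreal (?u n k) \<partial>lborel)"
    by (rule nn_integral_liminf) measurable
  also have "\<dots> \<le> ennreal ?N"
    unfolding liminf_SUP_INF
  proof (rule SUP_least)
    fix n show "(INF m\<in>{n..}. \<integral>\<^sup>+ k. ennreal (?u m k) \<partial>lborel) \<le> ennreal ?N"
      by (rule INF_lower2[of n], simp, rule nn)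
  qed
  finally have fin: "(\<integral>\<^sup>+ k. ennreal ((cmod (cfourier h k))^2) \<partial>lborel) \<le> ennreal ?N" .
  then show i: "integrable lborel (\<lambda>k. (cmod (cfourier h k))^2)"
    by (intro integrableI_bounded) (auto simp: less_top[symmetric] top_unique le_less_trans)
  show "(LINT k|lborel. (cmod (cfourier h k))^2) \<le> ?N"
    using fin by (subst (asm) nn_integral_eq_integral[OF i]) (auto simp: ennreal_le_iff)
qed

text \<open>For continuous h of compact support the Gaussian averages converge boundedly to h, so
  the damped identity passes to the limit on both sides. \<open>cfourier_bessel\<close> supplies the
  dominating function on the frequency side.\<close>

lemma plancherel_continuous:
  fixes h :: "real \<Rightarrow> real"
  assumes c: "continuous_on UNIV h" and supp: "\<And>x. \<bar>x\<bar> > R \<Longrightarrow> h x = 0"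
  shows "(LINT k|lborel. (cmod (cfourier (\<lambda>x. complex_of_real (h x)) k))^2) = (LINT x|lborel. (h x)^2)"
proof -
  let ?e = "\<lambda>n::nat. 1 / (real n + 1)" and ?F = "cfourier (\<lambda>x. complex_of_real (h x))"
  have hm[measurable]: "h \<in> borel_measurable borel" using c by (rule borel_measurable_continuous_onI)
  have hi: "integrable lborel h" by (rule integrable_continuous_compact_support[OF c supp])
  have h2: "integrable lborel (\<lambda>x. (h x)^2)"
    by (rule integrable_continuous_compact_support[where R=R]) (auto intro!: continuous_intros c simp: supp)
  obtain B where B: "\<And>x. \<bar>h x\<bar> \<le> B"
  proof -
    have "\<exists>y\<in>{-\<bar>R\<bar>..\<bar>R\<bar>}. \<forall>x\<in>{-\<bar>R\<bar>..\<bar>R\<bar>}. \<bar>h x\<bar> \<le> \<bar>h y\<bar>"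
      by (rule continuous_attains_sup) (auto intro!: continuous_intros continuous_on_subset[OF c])
    then obtain y where y: "\<And>x. x \<in> {-\<bar>R\<bar>..\<bar>R\<bar>} \<Longrightarrow> \<bar>h x\<bar> \<le> \<bar>h y\<bar>" by blast
    have "\<bar>h x\<bar> \<le> \<bar>h y\<bar>" for x
    proof (cases "\<bar>x\<bar> > R")
      case False
      then have "x \<in> {-\<bar>R\<bar>..\<bar>R\<bar>}" by auto
      then show ?thesis by (rule y)
    qed (simp add: supp)
    then show ?thesis using that by blast
  qed
  have B0: "0 \<le> B" using B[of 0] by linarith
  have hi': "integrable lborel (\<lambda>x. complex_of_real (h x))" using hi by simp
  have h2': "integrable lborel (\<lambda>x. (cmod (complex_of_real (h x)))^2)" using h2 by simp
  let ?T = "\<lambda>n x. LINT s|lborel. h (x + - sqrt (?e n) * s) * std_normal_density s"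
  have conv: "(LINT y|lborel. h y * normal_density 0 (sqrt (?e n)) (x - y)) = ?T n x" for n x
  proof -
    have e: "sqrt (?e n) > 0" by simp
    have *: "\<sigma> * normal_density 0 \<sigma> (\<sigma> * s) = std_normal_density s" if "\<sigma> > 0" for \<sigma> s :: real
      using that by (simp add: normal_density_def power_mult_distrib real_sqrt_mult)
    have "(LINT y|lborel. h y * normal_density 0 (sqrt (?e n)) (x - y))
       = \<bar>- sqrt (?e n)\<bar> *\<^sub>R (LINT s|lborel. h (x + - sqrt (?e n) * s) * normal_density 0 (sqrt (?e n)) (x - (x + - sqrt (?e n) * s)))"
      using e by (intro lborel_integral_real_affine) simp
    also have "\<dots> = (LINT s|lborel. h (x + - sqrt (?e n) * s) * (sqrt (?e n) * normal_density 0 (sqrt (?e n)) (sqrt (?e n) * s)))"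
      using e by (simp add: mult.left_commute[of _ "sqrt (?e n)"] del: real_sqrt_divide)
    finally show ?thesis unfolding *[OF e] .
  qed
  have Iid: "(LINT k|lborel. exp (- ?e n * k^2 / 2) * (cmod (?F k))^2) = (LINT x|lborel. h x * ?T n x)" for n
  proof -
    have e: "?e n > 0" by simp
    have "complex_of_real (LINT k|lborel. exp (- ?e n * k^2 / 2) * (cmod (?F k))^2)
       = complex_of_real (LINT x|lborel. h x * (LINT y|lborel. h y * normal_density 0 (sqrt (?e n)) (x - y)))"
      unfolding gaussian_parseval[OF hi' e] by (simp only: complex_cnj_complex_of_real of_real_mult[symmetric] integral_complex_of_real)
    then show ?thesis by (simp only: of_real_eq_iff conv)
  qed
  have Tb: "\<bar>?T n x\<bar> \<le> B" for n x
  proof -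
    have "\<bar>?T n x\<bar> \<le> (LINT s|lborel. \<bar>h (x + - sqrt (?e n) * s) * std_normal_density s\<bar>)"
      by (rule integral_abs_bound)
    also have "\<dots> \<le> (LINT s|lborel. B * std_normal_density s)"
      using B B0 by (intro integral_mono' integrable_mult_right) (auto simp: abs_mult intro!: mult_right_mono)
    finally show ?thesis by simp
  qed
  have T: "(\<lambda>n. ?T n x) \<longlonglongrightarrow> h x" for x
  proof -
    have "(\<lambda>n. ?T n x) \<longlonglongrightarrow> (LINT s|lborel. h x * std_normal_density s)"
    proof (rule integral_dominated_convergence[where w="\<lambda>s. B * std_normal_density s"])
      show "AE s in lborel. (\<lambda>n. h (x + - sqrt (?e n) * s) * std_normal_density s) \<longlonglongrightarrow> h x * std_normal_density s"
      proof (intro AE_I2 tendsto_mult_right)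
        fix s :: real
        have "(\<lambda>n. x + - sqrt (?e n) * s) \<longlonglongrightarrow> x" by real_asymp
        then show "(\<lambda>n. h (x + - sqrt (?e n) * s)) \<longlonglongrightarrow> h x"
          by (rule continuous_on_tendsto_compose[OF c]) auto
      qed
      show "AE s in lborel. norm (h (x + - sqrt (?e n) * s) * std_normal_density s) \<le> B * std_normal_density s" for n
        using B by (intro AE_I2) (auto simp: abs_mult intro!: mult_right_mono)
    qed auto
    then show ?thesis by simp
  qed
  have r: "(\<lambda>n. LINT x|lborel. h x * ?T n x) \<longlonglongrightarrow> (LINT x|lborel. h x * h x)"
  proof (rule integral_dominated_convergence[where w="\<lambda>x. B * \<bar>h x\<bar>"])
    show "AE x in lborel. (\<lambda>n. h x * ?T n x) \<longlonglongrightarrow> h x * h x"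
      by (intro AE_I2 tendsto_mult_left T)
    show "AE x in lborel. norm (h x * ?T n x) \<le> B * \<bar>h x\<bar>" for n
    proof (intro AE_I2)
      fix x
      have "\<bar>h x\<bar> * \<bar>?T n x\<bar> \<le> \<bar>h x\<bar> * B" by (intro mult_left_mono Tb abs_ge_zero)
      then show "norm (h x * ?T n x) \<le> B * \<bar>h x\<bar>" unfolding real_norm_def abs_mult by (simp only: mult.commute)
    qed
    show "integrable lborel (\<lambda>x. B * \<bar>h x\<bar>)" using hi by auto
  qed measurable
  have l: "(\<lambda>n. LINT k|lborel. exp (- ?e n * k^2 / 2) * (cmod (?F k))^2) \<longlonglongrightarrow> (LINT k|lborel. (cmod (?F k))^2)"
  proof (rule integral_dominated_convergence[where w="\<lambda>k. (cmod (?F k))^2"])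
    show "AE k in lborel. (\<lambda>n. exp (- ?e n * k^2 / 2) * (cmod (?F k))^2) \<longlonglongrightarrow> (cmod (?F k))^2"
    proof (intro AE_I2)
      fix k :: real
      have "(\<lambda>n. - ?e n * k^2 / 2) \<longlonglongrightarrow> 0" by real_asymp
      from tendsto_mult_right[OF tendsto_exp[OF this], of "(cmod (?F k))^2"]
      show "(\<lambda>n. exp (- ?e n * k^2 / 2) * (cmod (?F k))^2) \<longlonglongrightarrow> (cmod (?F k))^2" by simp
    qed
    show "integrable lborel (\<lambda>k. (cmod (?F k))^2)" by (rule cfourier_bessel[OF hi' h2'])
    show "AE k in lborel. norm (exp (- ?e n * k^2 / 2) * (cmod (?F k))^2) \<le> (cmod (?F k))^2" for n
      by (intro AE_I2) (simp add: abs_mult mult_left_le_one_le)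
  qed measurable
  show ?thesis using LIMSEQ_unique[OF l[unfolded Iid] r] by (simp add: power2_eq_square)
qed

section \<open>Density of continuous functions and the full Plancherel identity\<close>

lemma L2_norm_tendsto_0:
  assumes m: "\<And>n. f n \<in> borel_measurable borel" and w: "w \<in> L2_space"
    and lim: "AE x in lborel. (\<lambda>n. f n x) \<longlonglongrightarrow> 0" and dom: "\<And>n x. \<bar>f n x\<bar> \<le> \<bar>w x\<bar>"
  shows "(\<lambda>n. L2_norm (f n)) \<longlonglongrightarrow> 0"
proof -
  note [measurable] = m
  have "(\<lambda>n. LINT x|lborel. (f n x)^2) \<longlonglongrightarrow> (LINT x|(lborel :: real measure). 0)"
  proof (rule integral_dominated_convergence[where w="\<lambda>x. (w x)^2"])
    show "AE x in lborel. (\<lambda>n. (f n x)^2) \<longlonglongrightarrow> 0"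
      using lim
    proof eventually_elim
      case (elim x)
      from tendsto_power[OF this, of 2] show ?case by simp
    qed
    show "AE x in lborel. norm ((f n x)^2) \<le> (w x)^2" for n
      using dom by (intro AE_I2) (simp add: abs_le_square_iff)
  qed (use w in \<open>auto dest: L2_space_integrable\<close>)
  from tendsto_real_sqrt[OF this] show ?thesis by (simp add: L2_norm_def)
qed

lemma L2_space_continuous_compact_support:
  fixes g :: "real \<Rightarrow> real"
  assumes "continuous_on UNIV g" "\<And>x. \<bar>x\<bar> > R \<Longrightarrow> g x = 0"
  shows "g \<in> L2_space"
proof -
  have "integrable lborel (\<lambda>x. (g x)^2)"
    by (rule integrable_continuous_compact_support[where R=R]) (auto intro!: continuous_on_power simp: assms)
  then show ?thesis using borel_measurable_continuous_onI[OF assms(1)] by (simp add: L2_space_def)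
qed

definition clip :: "real \<Rightarrow> real \<Rightarrow> real" where
  "clip R y = max (- R) (min R y)"

definition cutoff :: "real \<Rightarrow> real \<Rightarrow> real" where
  "cutoff R x = max 0 (min 1 (R + 1 - \<bar>x\<bar>))"

lemma cutoff_bounds: "0 \<le> cutoff R x" "cutoff R x \<le> 1" "\<bar>x\<bar> > R + 1 \<Longrightarrow> cutoff R x = 0" "\<bar>x\<bar> \<le> R \<Longrightarrow> cutoff R x = 1"
  by (auto simp: cutoff_def)

lemma clip_bounds: "R \<ge> 0 \<Longrightarrow> \<bar>clip R y\<bar> \<le> R" "R \<ge> 0 \<Longrightarrow> \<bar>clip R y\<bar> \<le> \<bar>y\<bar>" "\<bar>y\<bar> \<le> R \<Longrightarrow> clip R y = y"
  by (auto simp: clip_def)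

lemma continuous_clip: "continuous_on A (clip R)" and continuous_cutoff: "continuous_on A (cutoff R)"
  unfolding clip_def[abs_def] cutoff_def[abs_def] by (intro continuous_intros)+

text \<open>h is clipped in height and cut off in space, then approximated almost everywhere by
  continuous functions. Applying the same clip and cutoff to the approximants provides the
  domination that pointwise convergence lacks.\<close>

lemma continuous_dense_L2:
  assumes h: "h \<in> L2_space" and e: "e > 0"
  obtains g R where "continuous_on UNIV g" "\<And>x. \<bar>x\<bar> > R \<Longrightarrow> g x = 0" "L2_norm (\<lambda>x. h x - g x) < e"
proof -
  note [measurable] = L2_space_measurable[OF h]
  have [measurable]: "clip R \<in> borel_measurable borel" "cutoff R \<in> borel_measurable borel" for R
    by (intro borel_measurable_continuous_onI continuous_clip continuous_cutoff)+
  let ?h = "\<lambda>n::nat. \<lambda>x. clip (real n) (h x) * cutoff (real n) x"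
  have "(\<lambda>n. L2_norm (\<lambda>x. h x - ?h n x)) \<longlonglongrightarrow> 0"
  proof (rule L2_norm_tendsto_0[where w="\<lambda>x. 2 * h x"])
    show "AE x in lborel. (\<lambda>n. h x - ?h n x) \<longlonglongrightarrow> 0"
    proof (intro AE_I2)
      fix x
      obtain n0 where n0: "\<bar>x\<bar> + \<bar>h x\<bar> < real n0" using reals_Archimedean2 by blast
      have "h x - ?h n x = 0" if "n \<ge> n0" for n
        using n0 that clip_bounds(3)[of "h x" "real n"] cutoff_bounds(4)[of x "real n"] by simp
      then show "(\<lambda>n. h x - ?h n x) \<longlonglongrightarrow> 0"
        by (intro tendsto_eventually eventually_sequentiallyI[of n0])
    qed
    show "\<bar>h x - ?h n x\<bar> \<le> \<bar>2 * h x\<bar>" for n x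
    proof -
      have "\<bar>?h n x\<bar> \<le> \<bar>h x\<bar> * 1"
        unfolding abs_mult using cutoff_bounds[of "real n" x] by (intro mult_mono clip_bounds) auto
      then show ?thesis by linarith
    qed
  qed (use h in auto)
  then obtain N where N: "L2_norm (\<lambda>x. h x - ?h N x) < e / 2"
    using e by (metis (mono_tags, lifting) LIMSEQ_D diff_zero half_gt_zero le_refl real_norm_def abs_of_nonneg L2_norm_nonneg)
  have "h measurable_on UNIV"
    by (rule lebesgue_measurable_imp_measurable_on_real) (auto intro: measurable_completion)
  then obtain E g where E: "negligible E" "\<And>n. continuous_on UNIV (g n)" "\<And>x. x \<notin> E \<Longrightarrow> (\<lambda>n. g n x) \<longlonglongrightarrow> h x"
    unfolding measurable_on_def by auto
  let ?g = "\<lambda>n::nat. \<lambda>x. clip (real N) (g n x) * cutoff (real N) x"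
  have gc: "continuous_on UNIV (?g n)" for n
    by (intro continuous_intros continuous_on_compose2[OF continuous_clip[of UNIV] E(2)] continuous_cutoff) auto
  have [measurable]: "?g n \<in> borel_measurable borel" for n
    by (rule borel_measurable_continuous_onI[OF gc])
  have "AE x in lebesgue. x \<notin> E"
    using E(1) by (intro AE_not_in) (simp add: negligible_iff_null_sets)
  then have AE_E: "AE x in lborel. x \<notin> E" by (simp add: AE_completion_iff)
  have "(\<lambda>n. L2_norm (\<lambda>x. ?h N x - ?g n x)) \<longlonglongrightarrow> 0"
  proof (rule L2_norm_tendsto_0[where w="\<lambda>x. 2 * real N * indicator {- real N - 1..real N + 1} x"])
    show "AE x in lborel. (\<lambda>n. ?h N x - ?g n x) \<longlonglongrightarrow> 0"
      using AE_E
    proof eventually_elim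
      case (elim x)
      have "(\<lambda>n. clip (real N) (g n x)) \<longlonglongrightarrow> clip (real N) (h x)"
        by (rule continuous_on_tendsto_compose[OF continuous_clip[of UNIV] E(3)[OF elim]]) auto
      then have "(\<lambda>n. ?h N x - ?g n x) \<longlonglongrightarrow> ?h N x - ?h N x" by (intro tendsto_intros)
      then show ?case by simp
    qed
    have "integrable lborel (\<lambda>x. (2 * real N)^2 * indicator {- real N - 1..real N + 1} x :: real)"
      by (auto intro!: integrable_real_indicator simp: emeasure_lborel_Icc_eq)
    moreover have "(indicator A x :: real)^2 = indicator A x" for A :: "real set" and x by (simp add: indicator_def)
    ultimately show "(\<lambda>x. 2 * real N * indicator {- real N - 1..real N + 1} x) \<in> L2_space"
      by (simp add: L2_space_def power_mult_distrib)
    show "\<bar>?h N x - ?g n x\<bar> \<le> \<bar>2 * real N * indicator {- real N - 1..real N + 1} x\<bar>" for n x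
    proof (cases "\<bar>x\<bar> > real N + 1")
      case False
      have "\<bar>clip (real N) y * cutoff (real N) x\<bar> \<le> real N * 1" for y
        unfolding abs_mult using cutoff_bounds[of "real N" x] by (intro mult_mono clip_bounds) auto
      from this[of "h x"] this[of "g n x"] show ?thesis using False by (auto simp: indicator_def)
    qed (simp add: cutoff_bounds)
  qed measurable
  then obtain n where n: "L2_norm (\<lambda>x. ?h N x - ?g n x) < e / 2"
    using e by (metis (mono_tags, lifting) LIMSEQ_D diff_zero half_gt_zero le_refl real_norm_def abs_of_nonneg L2_norm_nonneg)
  have hN: "?h N \<in> L2_space"
  proof (rule L2_space_bound[OF h])
    show "\<bar>?h N x\<bar> \<le> \<bar>h x\<bar>" for x
    proof -
      have "\<bar>?h N x\<bar> \<le> \<bar>h x\<bar> * 1"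
        unfolding abs_mult using cutoff_bounds[of "real N" x] by (intro mult_mono clip_bounds) auto
      then show ?thesis by simp
    qed
  qed measurable
  have gs: "?g n x = 0" if "\<bar>x\<bar> > real N + 1" for x using that cutoff_bounds(3)[of "real N" x] by simp
  have "?g n \<in> L2_space"
    by (rule L2_space_continuous_compact_support[OF gc gs])
  with hN h have "L2_norm (\<lambda>x. h x - ?g n x) \<le> L2_norm (\<lambda>x. h x - ?h N x) + L2_norm (\<lambda>x. ?h N x - ?g n x)"
    by (intro L2_norm_triangle_diff)
  then have "L2_norm (\<lambda>x. h x - ?g n x) < e" using N n by linarith
  then show ?thesis using that[OF gc[of n] gs] by blast
qed

lemma cfourier_L2:
  assumes "integrable lborel h" "(\<lambda>x. cmod (h x)) \<in> L2_space"
  shows "(\<lambda>k. cmod (cfourier h k)) \<in> L2_space" "L2_norm_c (cfourier h) \<le> L2_norm_c h"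
proof -
  have [measurable]: "h \<in> borel_measurable borel" using assms by (auto dest: borel_measurable_integrable)
  note b = cfourier_bessel[OF assms(1) L2_space_integrable[OF assms(2)]]
  show "(\<lambda>k. cmod (cfourier h k)) \<in> L2_space" using b(1) by (simp add: L2_space_def)
  show "L2_norm_c (cfourier h) \<le> L2_norm_c h"
    unfolding L2_norm_c_def by (intro real_sqrt_le_mono b(2))
qed

lemma cfourier_norm_diff:
  fixes h g :: "real \<Rightarrow> real" and A :: "real set"
  assumes h: "integrable lborel h" "h \<in> L2_space" and g: "integrable lborel g" "g \<in> L2_space" and A[measurable]: "A \<in> sets borel"
  shows "\<bar>L2_norm_c (\<lambda>k. complex_of_real (indicator A k) * cfourier (\<lambda>x. complex_of_real (h x)) k)
    - L2_norm_c (\<lambda>k. complex_of_real (indicator A k) * cfourier (\<lambda>x. complex_of_real (g x)) k)\<bar> \<le> L2_norm (\<lambda>x. h x - g x)"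
proof -
  let ?c = "\<lambda>f. cfourier (\<lambda>x. complex_of_real (f x))" and ?I = "\<lambda>k. complex_of_real (indicator A k)"
  have [measurable]: "h \<in> borel_measurable borel" "g \<in> borel_measurable borel"
    using h g by (auto dest: borel_measurable_integrable)
  have i: "integrable lborel (\<lambda>x. complex_of_real (f x))" "(\<lambda>x. cmod (complex_of_real (f x))) \<in> L2_space"
    if "integrable lborel f" "f \<in> L2_space" for f :: "real \<Rightarrow> real"
    using that L2_space_abs by auto
  have L: "(\<lambda>k. cmod (?c f k)) \<in> L2_space" if "integrable lborel f" "f \<in> L2_space" for f
    by (rule cfourier_L2[OF i[OF that]])
  have LI: "(\<lambda>k. cmod (?I k * ?c f k)) \<in> L2_space" if "integrable lborel f" "f \<in> L2_space" for f
  proof (rule L2_space_bound[OF L[OF that]])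
    have [measurable]: "f \<in> borel_measurable borel" using that by (auto dest: borel_measurable_integrable)
    show "(\<lambda>x. cmod (?I x * ?c f x)) \<in> borel_measurable borel" by measurable
    show "\<bar>cmod (?I x * ?c f x)\<bar> \<le> \<bar>cmod (?c f x)\<bar>" for x by (simp add: norm_mult indicator_def)
  qed
  have hg: "integrable lborel (\<lambda>x. h x - g x)" "(\<lambda>x. h x - g x) \<in> L2_space"
    using h g by auto
  have "\<bar>L2_norm_c (\<lambda>k. ?I k * ?c h k) - L2_norm_c (\<lambda>k. ?I k * ?c g k)\<bar> \<le> L2_norm_c (\<lambda>k. ?I k * ?c h k - ?I k * ?c g k)"
    by (rule L2_norm_c_triangle_diff[OF _ _ LI[OF h] LI[OF g]]) measurable
  also have "\<dots> \<le> L2_norm_c (?c (\<lambda>x. h x - g x))"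
    unfolding L2_norm_c_eq
  proof (rule L2_norm_mono[OF L[OF hg]])
    fix k
    have "?c h k - ?c g k = ?c (\<lambda>x. h x - g x) k"
      using cfourier_diff[OF i(1)[OF h] i(1)[OF g]] by simp
    then show "\<bar>cmod (?I k * ?c h k - ?I k * ?c g k)\<bar> \<le> \<bar>cmod (?c (\<lambda>x. h x - g x) k)\<bar>"
      by (auto simp: indicator_def)
  qed measurable
  also have "\<dots> \<le> L2_norm_c (\<lambda>x. complex_of_real (h x - g x))"
    by (rule cfourier_L2[OF i[OF hg]])
  also have "\<dots> = L2_norm (\<lambda>x. h x - g x)" by (simp add: L2_norm_c_def L2_norm_def flip: of_real_diff)
  finally show ?thesis .
qed

text \<open>Density argument: by the Bessel inequality both norms are continuous under L2
  approximation, and they agree for continuous functions of compact support.\<close>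

lemma cfourier_plancherel:
  fixes h :: "real \<Rightarrow> real"
  assumes h: "integrable lborel h" "h \<in> L2_space"
  shows "L2_norm_c (cfourier (\<lambda>x. complex_of_real (h x))) = L2_norm h"
proof -
  let ?c = "\<lambda>f. cfourier (\<lambda>x. complex_of_real (f x))"
  have "\<bar>L2_norm_c (?c h) - L2_norm h\<bar> \<le> 2 * e" if e: "e > 0" for e
  proof -
    obtain g R where g: "continuous_on UNIV g" "\<And>x. \<bar>x\<bar> > R \<Longrightarrow> g x = 0" "L2_norm (\<lambda>x. h x - g x) < e"
      using continuous_dense_L2[OF h(2) e] by blast
    have gi: "integrable lborel g" by (rule integrable_continuous_compact_support[OF g(1,2)])
    have g2: "g \<in> L2_space"
      by (rule L2_space_continuous_compact_support[OF g(1,2)])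
    have "L2_norm_c (?c g) = L2_norm g"
      using plancherel_continuous[OF g(1,2)] by (simp add: L2_norm_c_def L2_norm_def)
    moreover have "\<bar>L2_norm_c (?c h) - L2_norm_c (?c g)\<bar> \<le> L2_norm (\<lambda>x. h x - g x)"
      using cfourier_norm_diff[OF h gi g2, of UNIV] by simp
    moreover have "L2_norm h \<le> L2_norm (\<lambda>x. h x - g x) + L2_norm g"
      using L2_norm_triangle[of "\<lambda>x. h x - g x" g] h g2 by auto
    moreover have "L2_norm g \<le> L2_norm (\<lambda>x. g x - h x) + L2_norm h"
      using L2_norm_triangle[of "\<lambda>x. g x - h x" h] h g2 by auto
    ultimately show ?thesis using g(3) L2_norm_minus[of g h] by linarith
  qed
  then have "\<bar>L2_norm_c (?c h) - L2_norm h\<bar> \<le> 0 + e" if "e > 0" for e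
    using that[THEN half_gt_zero] by (metis add_0 field_sum_of_halves mult_2)
  then have "\<bar>L2_norm_c (?c h) - L2_norm h\<bar> \<le> 0" by (rule field_le_epsilon)
  then show ?thesis by simp
qed

section \<open>Truncations and the high-frequency tail\<close>

lemma L2_truncation_tendsto:
  assumes w: "w \<in> L2_space"
  shows "((\<lambda>R. L2_norm (\<lambda>x. w x - w x * indicator {-R..R} x)) \<longlongrightarrow> 0) at_top"
proof -
  let ?d = "\<lambda>R. L2_norm (\<lambda>x. w x - w x * indicator {-R..R} x)"
  note [measurable] = L2_space_measurable[OF w]
  have seq: "(\<lambda>n. ?d (real n)) \<longlonglongrightarrow> 0"
  proof (rule L2_norm_tendsto_0[OF _ w])
    show "AE x in lborel. (\<lambda>n. w x - w x * indicator {- real n..real n} x) \<longlonglongrightarrow> 0"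
    proof (intro AE_I2)
      fix x :: real
      obtain n0 where n0: "\<bar>x\<bar> < real n0" using reals_Archimedean2 by blast
      have "w x - w x * indicator {- real n..real n} x = 0" if "n \<ge> n0" for n
      proof -
        have "x \<in> {- real n..real n}" using n0 that by auto
        then show ?thesis by simp
      qed
      then show "(\<lambda>n. w x - w x * indicator {- real n..real n} x) \<longlonglongrightarrow> 0"
        by (intro tendsto_eventually eventually_sequentiallyI[of n0])
    qed
    show "\<bar>w x - w x * indicator {- real n..real n} x\<bar> \<le> \<bar>w x\<bar>" for n x by (simp add: indicator_def)
  qed measurable
  have mono: "?d S \<le> ?d R" if "R \<le> S" for R S
  proof (rule L2_norm_mono)
    show "(\<lambda>x. w x - w x * indicator {-R..R} x) \<in> L2_space"
      using w by (intro L2_space_diff L2_space_indicator) auto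
    show "\<bar>w x - w x * indicator {-S..S} x\<bar> \<le> \<bar>w x - w x * indicator {-R..R} x\<bar>" for x
      using that by (auto simp: indicator_def)
  qed measurable
  show ?thesis
  proof (rule order_tendstoI)
    fix a :: real assume "a < 0"
    then show "eventually (\<lambda>R. a < ?d R) at_top"
      by (intro always_eventually allI) (meson L2_norm_nonneg less_le_trans)
  next
    fix a :: real assume "0 < a"
    then obtain n where n: "?d (real n) < a" using seq order_tendstoD(2)[OF seq] by (meson eventually_sequentially le_refl)
    show "eventually (\<lambda>R. ?d R < a) at_top"
    proof (intro eventually_at_top_linorderI[of "real n"])
      fix S assume "real n \<le> S"
      from mono[OF this] show "?d S < a" using n by linarith
    qed
  qed
qed

text \<open>\<open>fourier_tail_norm\<close> is a \<open>Lim\<close>, which says something only once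
  the limit exists. Truncated norms differ by at most the two truncation errors, hence are Cauchy
  along the integers; the same bound extends the convergence to real R.\<close>

lemma fourier_tail_norm_tendsto:
  assumes w: "w \<in> L2_space"
  shows "((\<lambda>R. L2_norm_c (\<lambda>k. complex_of_real (indicator {k. \<bar>k\<bar> > K} k) * fourier_int (\<lambda>x. w x * indicator {-R..R} x) k))
     \<longlongrightarrow> fourier_tail_norm w K) at_top"
proof -
  let ?w = "\<lambda>R x. w x * indicator {-R..R} x"
  let ?T = "\<lambda>R. L2_norm_c (\<lambda>k. complex_of_real (indicator {k. \<bar>k\<bar> > K} k) * fourier_int (?w R) k)"
  let ?d = "\<lambda>R. L2_norm (\<lambda>x. w x - ?w R x)"
  have wi: "integrable lborel (?w R)" "?w R \<in> L2_space" for R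
    using w by (auto intro: L2_space_integrable_Icc L2_space_indicator)
  have d: "\<bar>?T R - ?T S\<bar> \<le> ?d R + ?d S" for R S
  proof -
    have "{k. K < \<bar>k\<bar>} \<in> sets borel" by measurable
    from cfourier_norm_diff[OF wi[of R] wi[of S] this]
    have "\<bar>?T R - ?T S\<bar> \<le> L2_norm (\<lambda>x. ?w R x - ?w S x)" by (simp add: fourier_int_cfourier)
    also have "\<dots> \<le> L2_norm (\<lambda>x. ?w R x - w x) + ?d S"
      by (intro L2_norm_triangle_diff wi w)
    finally show ?thesis by (simp add: L2_norm_minus[of _ w])
  qed
  have d0: "((\<lambda>R. ?d R) \<longlongrightarrow> 0) at_top" by (rule L2_truncation_tendsto[OF w])
  have d0': "(\<lambda>n. ?d (real n)) \<longlonglongrightarrow> 0"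
    by (rule filterlim_compose[OF d0 filterlim_real_sequentially])
  have "Cauchy (\<lambda>n. ?T (real n))"
  proof (rule metric_CauchyI)
    fix e :: real assume "e > 0"
    then obtain M where M: "\<And>n. n \<ge> M \<Longrightarrow> ?d (real n) < e / 2"
      using order_tendstoD(2)[OF d0', of "e/2"] by (auto simp: eventually_sequentially)
    have "dist (?T (real m)) (?T (real n)) < e" if "m \<ge> M" "n \<ge> M" for m n
      using d[of "real m" "real n"] M[OF that(1)] M[OF that(2)] by (simp add: dist_real_def)
    then show "\<exists>M. \<forall>m\<ge>M. \<forall>n\<ge>M. dist (?T (real m)) (?T (real n)) < e" by blast
  qed
  then obtain L where L: "(\<lambda>n. ?T (real n)) \<longlonglongrightarrow> L" using Cauchy_convergent_iff convergent_def by blast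
  have "\<bar>?T R - L\<bar> \<le> ?d R" for R
  proof (rule tendsto_le[OF sequentially_bot])
    show "(\<lambda>n. \<bar>?T R - ?T (real n)\<bar>) \<longlonglongrightarrow> \<bar>?T R - L\<bar>" by (intro tendsto_intros L)
    show "(\<lambda>n. ?d R + ?d (real n)) \<longlonglongrightarrow> ?d R" using tendsto_add[OF tendsto_const d0', of "?d R"] by simp
    show "\<forall>\<^sub>F n in sequentially. \<bar>?T R - ?T (real n)\<bar> \<le> ?d R + ?d (real n)"
      by (intro always_eventually allI d)
  qed
  then have "((\<lambda>R. ?T R - L) \<longlongrightarrow> 0) at_top"
    by (intro Lim_null_comparison[OF _ d0]) (auto intro: always_eventually)
  then have "(?T \<longlongrightarrow> L) at_top" by (simp add: LIM_zero_iff)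
  moreover from this have "fourier_tail_norm w K = L"
    unfolding fourier_tail_norm_def by (intro tendsto_Lim) auto
  ultimately show ?thesis by simp
qed

lemma fourier_tail_norm_nonneg:
  assumes "w \<in> L2_space" shows "0 \<le> fourier_tail_norm w K"
  by (rule tendsto_lowerbound[OF fourier_tail_norm_tendsto[OF assms]]) (auto simp: L2_norm_c_eq)

text \<open>Cutting the spatial tail of w spreads its spectrum, but contractivity of the transform
  limits the effect to the L2 size of what was cut.\<close>

lemma fourier_tail_norm_compare:
  assumes w: "w \<in> L2_space" and h: "integrable lborel h" "h \<in> L2_space"
  shows "L2_norm_c (\<lambda>k. complex_of_real (indicator {k. \<bar>k\<bar> > K} k) * fourier_int h k)
    \<le> fourier_tail_norm w K + L2_norm (\<lambda>x. h x - w x)"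
proof -
  let ?w = "\<lambda>R x. w x * indicator {-R..R} x"
  let ?T = "\<lambda>R. L2_norm_c (\<lambda>k. complex_of_real (indicator {k. \<bar>k\<bar> > K} k) * fourier_int (?w R) k)"
  let ?d = "\<lambda>R. L2_norm (\<lambda>x. w x - ?w R x)"
  have wi: "integrable lborel (?w R)" "?w R \<in> L2_space" for R
    using w by (auto intro: L2_space_integrable_Icc L2_space_indicator)
  have b: "L2_norm_c (\<lambda>k. complex_of_real (indicator {k. \<bar>k\<bar> > K} k) * fourier_int h k) \<le> ?T R + (L2_norm (\<lambda>x. h x - w x) + ?d R)" for R
  proof -
    have "{k. K < \<bar>k\<bar>} \<in> sets borel" by measurable
    from cfourier_norm_diff[OF h wi[of R] this]
    have "L2_norm_c (\<lambda>k. complex_of_real (indicator {k. \<bar>k\<bar> > K} k) * fourier_int h k) \<le> ?T R + L2_norm (\<lambda>x. h x - ?w R x)"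
      by (simp add: fourier_int_cfourier)
    also have "L2_norm (\<lambda>x. h x - ?w R x) \<le> L2_norm (\<lambda>x. h x - w x) + ?d R"
      by (intro L2_norm_triangle_diff wi w h)
    finally show ?thesis by simp
  qed
  have "((\<lambda>R. ?T R + (L2_norm (\<lambda>x. h x - w x) + ?d R)) \<longlongrightarrow> fourier_tail_norm w K + (L2_norm (\<lambda>x. h x - w x) + 0)) at_top"
    by (intro tendsto_intros fourier_tail_norm_tendsto L2_truncation_tendsto w)
  then have "L2_norm_c (\<lambda>k. complex_of_real (indicator {k. \<bar>k\<bar> > K} k) * fourier_int h k) \<le> fourier_tail_norm w K + (L2_norm (\<lambda>x. h x - w x) + 0)"
    by (rule tendsto_lowerbound) (auto intro!: always_eventually b)
  then show ?thesis by simp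
qed

section \<open>Coherent states and band limiting\<close>

text \<open>The sum runs over n < N, so the projection onto \<open>P_hat N 1\<close> is
  \<open>hermite_proj (Suc N)\<close>. The slack of one index later absorbs the boundary
  coefficients of the derivative.\<close>

definition hermite_proj :: "nat \<Rightarrow> (real \<Rightarrow> real) \<Rightarrow> real \<Rightarrow> real" where
  "hermite_proj N w x = (\<Sum>n<N. L2_inner w (hermite_fun n) * hermite_fun n x)"

lemma hermite_proj_L2 [intro]: "hermite_proj N w \<in> L2_space"
  unfolding hermite_proj_def[abs_def] by (intro L2_space_sum L2_space_scale hermite_fun_L2)

lemma hermite_proj_inner:
  assumes "v \<in> L2_space"
  shows "L2_inner (hermite_proj N w) v = (\<Sum>n<N. L2_inner w (hermite_fun n) * L2_inner (hermite_fun n) v)"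
  unfolding hermite_proj_def[abs_def] using assms by (intro L2_inner_sum_left) auto

lemma hermite_proj_coeff:
  "L2_inner (hermite_proj N w) (hermite_fun m) = (if m < N then L2_inner w (hermite_fun m) else 0)"
  by (simp add: hermite_proj_inner hermite_orthonormal if_distrib[of "\<lambda>t. _ * t"] cong: if_cong)

lemma hermite_proj_residual_orthogonal:
  assumes "w \<in> L2_space" "m < N"
  shows "L2_inner (\<lambda>x. w x - hermite_proj N w x) (hermite_fun m) = 0"
  using assms by (subst L2_inner_diff_left) (auto simp: hermite_proj_coeff)

lemma hermite_proj_residual_inner_proj:
  assumes "w \<in> L2_space"
  shows "L2_inner (\<lambda>x. w x - hermite_proj N w x) (hermite_proj N u) = 0"
proof -
  have "(\<lambda>x. w x - hermite_proj N w x) \<in> L2_space" using assms by auto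
  then show ?thesis
    using assms by (subst L2_inner_commute)
      (auto simp: hermite_proj_inner L2_inner_commute[of "hermite_fun _"] hermite_proj_residual_orthogonal)
qed

text \<open>The first identity is the duality behind the approximation bound: the squared residual
  norm is w tested against its own residual. The second measures the residual by the missing
  coefficients.\<close>

lemma hermite_proj_residual_norm:
  assumes "w \<in> L2_space"
  shows "(L2_norm (\<lambda>x. w x - hermite_proj N w x))^2 = L2_inner w (\<lambda>x. w x - hermite_proj N w x)"
    and "(L2_norm (\<lambda>x. w x - hermite_proj N w x))^2 = (L2_norm w)^2 - (\<Sum>n<N. (L2_inner w (hermite_fun n))^2)"
proof -
  let ?v = "\<lambda>x. w x - hermite_proj N w x"
  have v: "?v \<in> L2_space" using assms by auto
  have "L2_inner ?v ?v = L2_inner w ?v - L2_inner (hermite_proj N w) ?v"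
    using assms v by (intro L2_inner_diff_left) auto
  then show 1: "(L2_norm ?v)^2 = L2_inner w ?v"
    using hermite_proj_residual_inner_proj[OF assms, of N w] by (simp add: L2_norm_inner L2_inner_commute)
  have "L2_inner w ?v = L2_inner w w - L2_inner (hermite_proj N w) w"
    using assms by (subst L2_inner_commute, subst L2_inner_diff_left) auto
  also have "L2_inner (hermite_proj N w) w = (\<Sum>n<N. (L2_inner w (hermite_fun n))^2)"
    using assms by (simp add: hermite_proj_inner L2_inner_commute[of "hermite_fun _"] power2_eq_square)
  finally show "(L2_norm ?v)^2 = (L2_norm w)^2 - (\<Sum>n<N. (L2_inner w (hermite_fun n))^2)"
    using 1 by (simp add: L2_norm_inner)
qed

text \<open>Chernoff's trick with factor 2: m^k \<le> (2 m)^k / 2^N for k \<ge> N, and the series of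
  the enlarged terms is at most exp (2 m).\<close>

lemma exp_tail_le:
  fixes m :: real
  assumes "0 \<le> m"
  shows "exp m - (\<Sum>n<N. m^n / fact n) \<le> exp (2 * m) / 2^N"
proof -
  have e: "exp t = (\<Sum>n<N. t^n / fact n) + (\<Sum>n. t^(n + N) / fact (n + N))" for t :: real
  proof -
    have "(\<lambda>n. t^n / fact n) sums exp t" using exp_converges[of t] by (simp add: divide_inverse mult.commute)
    then show ?thesis
      using suminf_split_initial_segment[of "\<lambda>n. t^n / fact n" N] by (auto simp: sums_iff)
  qed
  have s: "summable (\<lambda>n. t^(n + N) / fact (n + N))" for t :: real
  proof -
    have "summable (\<lambda>n. t^n / fact n)" using summable_exp[of t] by (simp add: divide_inverse mult.commute)
    then show ?thesis by (rule summable_ignore_initial_segment)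
  qed
  have "(\<Sum>n. m^(n + N) / fact (n + N)) \<le> (\<Sum>n. (2 * m)^(n + N) / fact (n + N) / 2^N)"
  proof (rule suminf_le[OF _ s summable_divide[OF s]])
    fix n
    have "m^(n + N) * 1 \<le> m^(n + N) * 2^n" using assms by (intro mult_left_mono) auto
    then have "m^(n + N) / fact (n + N) \<le> m^(n + N) * 2^n / fact (n + N)"
      by (intro divide_right_mono) auto
    also have "\<dots> = (2 * m)^(n + N) / fact (n + N) / 2^N"
      by (simp add: power_mult_distrib power_add)
    finally show "m^(n + N) / fact (n + N) \<le> (2 * m)^(n + N) / fact (n + N) / 2^N" .
  qed
  also have "\<dots> = (\<Sum>n. (2 * m)^(n + N) / fact (n + N)) / 2^N"
    by (rule suminf_divide[OF s])
  also have "\<dots> \<le> exp (2 * m) / 2^N"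
    using e[of "2 * m"] assms by (intro divide_right_mono) (auto intro!: sum_nonneg)
  finally show ?thesis using e[of m] by simp
qed

(* Real and imaginary parts of the coherent state exp (- (x - y)^2 / 2 + i b (x - y)). It is an
   eigenfunction of the annihilation operator, which is why its Hermite coefficients satisfy a
   two-term recursion and their squared moduli are Poisson weights. *)
definition coh_cos :: "real \<Rightarrow> real \<Rightarrow> real \<Rightarrow> real" where
  "coh_cos y b x = exp (- ((x - y)^2) / 2) * cos (b * (x - y))"

definition coh_sin :: "real \<Rightarrow> real \<Rightarrow> real \<Rightarrow> real" where
  "coh_sin y b x = exp (- ((x - y)^2) / 2) * sin (b * (x - y))"

section \<open>Hermite coefficients of coherent states\<close>

lemma shifted_gaussian_L2: "(\<lambda>x. exp (- ((x - y)^2) / 2)) \<in> L2_space" for y :: real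
proof -
  have "integrable lborel (\<lambda>x. exp (- 1 * (- y + 1 * x)^2) * poly 1 (- y + 1 * x))"
    using exp_poly_integrable[of 1 1] by (intro lborel_integrable_real_affine) auto
  moreover have "(exp (- ((x - y)^2) / 2))^2 = exp (- 1 * (- y + 1 * x)^2) * poly 1 (- y + 1 * x)" for x
    by (simp add: power2_eq_square flip: exp_add)
  ultimately show ?thesis unfolding L2_space_def by (auto simp del: power2_eq_square)
qed

lemma coh_measurable [measurable]: "coh_cos y b \<in> borel_measurable borel" "coh_sin y b \<in> borel_measurable borel"
  unfolding coh_cos_def[abs_def] coh_sin_def[abs_def]
  by (intro borel_measurable_continuous_onI continuous_intros; simp)+

lemma coh_L2 [intro]: "coh_cos y b \<in> L2_space" "coh_sin y b \<in> L2_space"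
  by (rule L2_space_bound[OF shifted_gaussian_L2[of y]];
      simp add: coh_cos_def coh_sin_def abs_mult mult_left_le coh_measurable[unfolded coh_cos_def[abs_def]] coh_measurable[unfolded coh_sin_def[abs_def]])+

lemma coh_deriv:
  "(coh_cos y b has_real_derivative - (x - y) * coh_cos y b x - b * coh_sin y b x) (at x)"
  "(coh_sin y b has_real_derivative - (x - y) * coh_sin y b x + b * coh_cos y b x) (at x)"
  unfolding coh_cos_def[abs_def] coh_sin_def[abs_def]
  by (auto intro!: derivative_eq_intros simp: field_simps)

text \<open>The derivative of f is \<open>f' x - (x - y) * f x\<close>; thus \<open>f'\<close> is
  what remains once the Gaussian drift is removed. The adjoint x + d/dx of the raising operator
  sends f to y f + \<open>f'\<close>, free of the factor x, and on the complex coherent state this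
  is multiplication by y + i b.\<close>

lemma creation_by_parts:
  fixes f f' :: "real \<Rightarrow> real"
  assumes f: "f \<in> L2_space" and f': "f' \<in> L2_space" "\<And>x. (f has_real_derivative f' x - (x - y) * f x) (at x)"
    and c: "continuous_on UNIV f'" and b: "\<And>x. \<bar>f x\<bar> \<le> 1"
  shows "sqrt (2 * (real n + 1)) * L2_inner f (hermite_fun (Suc n)) = y * L2_inner f (hermite_fun n) + L2_inner f' (hermite_fun n)"
proof -
  let ?h = "hermite_fun n" and ?g = "gauss_poly 1"
  have cf: "continuous_on UNIV f"
    by (intro continuous_at_imp_continuous_on ballI DERIV_isCont[OF f'(2)])
  have lt: "((\<lambda>x. f x * ?h x) \<longlongrightarrow> 0) F" if "(?h \<longlongrightarrow> 0) F" for F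
  proof (rule Lim_null_comparison)
    show "\<forall>\<^sub>F x in F. norm (f x * ?h x) \<le> \<bar>?h x\<bar>"
      using b by (intro always_eventually allI) (simp add: abs_mult mult_left_le_one_le)
    show "((\<lambda>x. \<bar>?h x\<bar>) \<longlongrightarrow> 0) F" using that by (rule tendsto_rabs_zero)
  qed
  have up: "x * ?h x - deriv ?h x = sqrt (2 * (real n + 1)) * hermite_fun (Suc n) x" for x
    unfolding hermite_fun_x hermite_fun_deriv two_sqrt_half[symmetric] by simp
  have L: "(\<lambda>x. x * ?h x) \<in> L2_space" "deriv ?h \<in> L2_space"
    by (subst hermite_fun_x[abs_def], intro L2_space_add L2_space_scale; simp)
       (subst hermite_fun_deriv[abs_def], intro L2_space_diff L2_space_scale; simp)
  have i: "integrable lborel (\<lambda>x. f x * (x * ?h x))" "integrable lborel (\<lambda>x. f x * deriv ?h x)"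
    "integrable lborel (\<lambda>x. f x * ?h x)" "integrable lborel (\<lambda>x. f' x * ?h x)"
    by (intro L2_space_mult_integrable f f' L hermite_fun_L2)+
  have "(LINT x|lborel. f' x * ?h x + y * (f x * ?h x) - f x * (x * ?h x) + f x * deriv ?h x) = 0"
  proof (rule integral_derivative_zero[where F="\<lambda>x. f x * ?h x"])
    show "((\<lambda>x. f x * ?h x) has_real_derivative f' x * ?h x + y * (f x * ?h x) - f x * (x * ?h x) + f x * deriv ?h x) (at x)" for x
      by (auto intro!: derivative_eq_intros f'(2) hermite_fun_has_derivative simp: algebra_simps)
    have "continuous_on UNIV (deriv ?h)"
      by (intro continuous_at_imp_continuous_on ballI DERIV_isCont[OF hermite_fun_has_derivative2])
    then show "continuous_on UNIV (\<lambda>x. f' x * ?h x + y * (f x * ?h x) - f x * (x * ?h x) + f x * deriv ?h x)"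
      by (intro continuous_intros cf c hermite_fun_continuous)
    show "integrable lborel (\<lambda>x. f' x * ?h x + y * (f x * ?h x) - f x * (x * ?h x) + f x * deriv ?h x)"
      by (intro Bochner_Integration.integrable_add Bochner_Integration.integrable_diff integrable_mult_right i)
    show "((\<lambda>x. f x * ?h x) \<longlongrightarrow> 0) at_top" by (rule lt[OF hermite_fun_tendsto_0])
    show "((\<lambda>x. f x * ?h x) \<longlongrightarrow> 0) at_bot"
      using exp_poly_tendsto_0_at_bot[of "1/2" "hermite_normal n"]
      by (intro lt) (simp add: hermite_fun_gauss_poly gauss_poly_def[abs_def])
  qed
  moreover have "(LINT x|lborel. f' x * ?h x + y * (f x * ?h x) - f x * (x * ?h x) + f x * deriv ?h x)
     = L2_inner f' ?h + y * L2_inner f ?h - (LINT x|lborel. f x * (x * ?h x)) + (LINT x|lborel. f x * deriv ?h x)"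
    using i by (simp add: L2_inner_def)
  moreover have "sqrt (2 * (real n + 1)) * L2_inner f (hermite_fun (Suc n)) = (LINT x|lborel. f x * (x * ?h x)) - (LINT x|lborel. f x * deriv ?h x)"
  proof -
    have "sqrt (2 * (real n + 1)) * L2_inner f (hermite_fun (Suc n)) = (LINT x|lborel. f x * (sqrt (2 * (real n + 1)) * hermite_fun (Suc n) x))"
      using L2_inner_scale_right[of f "sqrt (2 * (real n + 1))" "hermite_fun (Suc n)"] by (simp only: L2_inner_def)
    also have "\<dots> = (LINT x|lborel. f x * (x * ?h x) - f x * deriv ?h x)"
      unfolding up[symmetric] by (simp only: right_diff_distrib)
    finally show ?thesis using i by simp
  qed
  ultimately show ?thesis by simp
qed

lemma coh_continuous: "continuous_on A (coh_cos y b)" "continuous_on A (coh_sin y b)"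
  by (intro continuous_at_imp_continuous_on ballI DERIV_isCont[OF coh_deriv(1)] DERIV_isCont[OF coh_deriv(2)])+

lemma coh_abs_le: "\<bar>coh_cos y b x\<bar> \<le> 1" "\<bar>coh_sin y b x\<bar> \<le> 1"
  unfolding coh_cos_def coh_sin_def abs_mult by (rule mult_le_one; simp)+

lemma coh_coeff_0:
  "(L2_inner (coh_cos y b) (hermite_fun 0))^2 + (L2_inner (coh_sin y b) (hermite_fun 0))^2 = sqrt pi * exp (- ((y^2 + b^2) / 2))"
proof -
  let ?c = "1 / pi powr (1/4)" and ?z = "\<lambda>x. complex_of_real (coh_cos y b x) + \<i> * complex_of_real (coh_sin y b x)"
  have i: "integrable lborel (\<lambda>x. coh_cos y b x * hermite_fun 0 x)" "integrable lborel (\<lambda>x. coh_sin y b x * hermite_fun 0 x)"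
    by (intro L2_space_mult_integrable coh_L2 hermite_fun_L2)+
  \<comment> \<open>Centred at the midpoint y / 2, the product of the two Gaussians is exp (- y^2 /
    4) exp (- s^2).\<close>
  have pt: "?z (y / 2 + 1 * s) * complex_of_real (hermite_fun 0 (y / 2 + 1 * s))
      = complex_of_real (?c * exp (- (y^2) / 4)) * cis (- (b * y / 2)) * (complex_of_real (exp (- 2 * s^2 / 2)) * cis (b * s))" for s
  proof -
    have e: "exp (- ((y / 2 + s - y)^2) / 2) * exp (- ((y / 2 + s)^2) / 2) = exp (- (y^2) / 4) * exp (- 2 * s^2 / 2)"
      unfolding exp_add[symmetric] by (rule arg_cong[where f=exp]) (simp add: power2_eq_square field_simps)
    have "?z (y / 2 + s) = complex_of_real (exp (- ((y / 2 + s - y)^2) / 2)) * cis (b * (y / 2 + s - y))"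
      by (simp add: coh_cos_def coh_sin_def cis_conv_exp complex_eq_iff Re_exp Im_exp)
    also have "b * (y / 2 + s - y) = - (b * y / 2) + b * s" by (simp add: algebra_simps)
    also have "cis (- (b * y / 2) + b * s) = cis (- (b * y / 2)) * cis (b * s)" by (simp add: cis_mult)
    finally have "?z (y / 2 + s) * complex_of_real (hermite_fun 0 (y / 2 + s))
        = complex_of_real (?c * (exp (- ((y / 2 + s - y)^2) / 2) * exp (- ((y / 2 + s)^2) / 2))) * cis (- (b * y / 2)) * cis (b * s)"
      by (simp add: hermite_fun_def mult_ac)
    then show ?thesis unfolding e by (simp add: mult_ac)
  qed
  have "complex_of_real (L2_inner (coh_cos y b) (hermite_fun 0)) + \<i> * complex_of_real (L2_inner (coh_sin y b) (hermite_fun 0))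
     = (LINT x|lborel. ?z x * complex_of_real (hermite_fun 0 x))"
    using i by (simp add: L2_inner_def distrib_right mult.assoc flip: of_real_mult)
  also have "\<dots> = (LINT s|lborel. ?z (y / 2 + 1 * s) * complex_of_real (hermite_fun 0 (y / 2 + 1 * s)))"
    by (subst lborel_integral_real_affine[where c=1 and t="y / 2"]) auto
  also have "\<dots> = complex_of_real (?c * exp (- (y^2) / 4)) * cis (- (b * y / 2)) * complex_of_real (sqrt (2 * pi / 2) * exp (- (b^2) / (2 * 2)))"
    unfolding pt by (subst gaussian_fourier[symmetric]) simp_all
  finally have z: "complex_of_real (L2_inner (coh_cos y b) (hermite_fun 0)) + \<i> * complex_of_real (L2_inner (coh_sin y b) (hermite_fun 0))
     = complex_of_real (?c * exp (- (y^2) / 4) * (sqrt pi * exp (- (b^2) / 4))) * cis (- (b * y / 2))"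
    by (simp add: mult_ac)
  have "(L2_inner (coh_cos y b) (hermite_fun 0))^2 + (L2_inner (coh_sin y b) (hermite_fun 0))^2
     = (cmod (complex_of_real (L2_inner (coh_cos y b) (hermite_fun 0)) + \<i> * complex_of_real (L2_inner (coh_sin y b) (hermite_fun 0))))^2"
    by (simp add: cmod_power2)
  also have "\<dots> = (?c * exp (- (y^2) / 4) * (sqrt pi * exp (- (b^2) / 4)))^2"
    unfolding z by (simp add: norm_mult norm_divide)
  also have "\<dots> = ?c^2 * pi * exp (- ((y^2 + b^2) / 2))"
  proof -
    have e: "(exp (- (y^2) / 4))^2 * (exp (- (b^2) / 4))^2 = exp (- ((y^2 + b^2) / 2))"
      unfolding exp_double[symmetric] exp_add[symmetric] by (rule arg_cong[where f=exp]) (simp add: field_simps)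
    show ?thesis unfolding e[symmetric] power_mult_distrib by simp
  qed
  also have "?c^2 * pi = sqrt pi"
  proof -
    have "?c^2 = 1 / sqrt pi" by (simp add: power_divide powr_power powr_half_sqrt)
    then show ?thesis by (simp add: real_div_sqrt)
  qed
  finally show ?thesis .
qed

text \<open>The recursions for the real and imaginary parts amount to multiplication by (y + i b) /
  sqrt (2 (n + 1)), so the squared modulus gains the factor ((y^2 + b^2) / 2) / (n + 1).\<close>

lemma coh_coeff:
  "(L2_inner (coh_cos y b) (hermite_fun n))^2 + (L2_inner (coh_sin y b) (hermite_fun n))^2
    = sqrt pi * exp (- ((y^2 + b^2) / 2)) * (((y^2 + b^2) / 2)^n / fact n)"
proof (induction n)
  case 0
  then show ?case by (simp add: coh_coeff_0)
next
  case (Suc n)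
  let ?p = "\<lambda>n. L2_inner (coh_cos y b) (hermite_fun n)" and ?q = "\<lambda>n. L2_inner (coh_sin y b) (hermite_fun n)" and ?m = "(y^2 + b^2) / 2"
  have p: "sqrt (2 * (real n + 1)) * ?p (Suc n) = y * ?p n - b * ?q n"
  proof -
    have "(coh_cos y b has_real_derivative (- b) * coh_sin y b x - (x - y) * coh_cos y b x) (at x)" for x
      using coh_deriv(1)[of y b x] by (simp add: algebra_simps)
    from creation_by_parts[OF coh_L2(1) L2_space_scale[OF coh_L2(2)] this _ coh_abs_le(1), of n] show ?thesis
      by (simp add: L2_inner_scale_left[of "- b", simplified] continuous_on_mult coh_continuous continuous_on_minus)
  qed
  have q: "sqrt (2 * (real n + 1)) * ?q (Suc n) = y * ?q n + b * ?p n"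
  proof -
    have "(coh_sin y b has_real_derivative b * coh_cos y b x - (x - y) * coh_sin y b x) (at x)" for x
      using coh_deriv(2)[of y b x] by (simp add: algebra_simps)
    from creation_by_parts[OF coh_L2(2) L2_space_scale[OF coh_L2(1)] this _ coh_abs_le(2), of n] show ?thesis
      by (simp add: L2_inner_scale_left continuous_on_mult coh_continuous)
  qed
  have "2 * (real n + 1) * ((?p (Suc n))^2 + (?q (Suc n))^2) = (sqrt (2 * (real n + 1)) * ?p (Suc n))^2 + (sqrt (2 * (real n + 1)) * ?q (Suc n))^2"
    by (simp add: power_mult_distrib distrib_left)
  also have "\<dots> = (y^2 + b^2) * ((?p n)^2 + (?q n)^2)"
    unfolding p q by (simp add: power2_eq_square algebra_simps)
  finally have "(?p (Suc n))^2 + (?q (Suc n))^2 = ?m / (real n + 1) * ((?p n)^2 + (?q n)^2)"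
    by (simp add: field_simps)
  also have "\<dots> = sqrt pi * exp (- ?m) * (?m^Suc n / fact (Suc n))"
  proof -
    have "m / (real n + 1) * (A * (m^n / fact n)) = A * (m^Suc n / fact (Suc n))" for m A :: real
      by (simp add: add.commute)
    then show ?thesis unfolding Suc.IH .
  qed
  finally show ?case .
qed

lemma coh_norm: "(L2_norm (coh_cos y b))^2 + (L2_norm (coh_sin y b))^2 = sqrt pi"
proof -
  have "(L2_norm (coh_cos y b))^2 + (L2_norm (coh_sin y b))^2 = (LINT x|lborel. (coh_cos y b x)^2 + (coh_sin y b x)^2)"
    unfolding L2_norm_squared by (intro Bochner_Integration.integral_add[symmetric] L2_space_integrable coh_L2)
  also have "\<dots> = (LINT x|lborel. sqrt pi * normal_density y (1 / sqrt 2) x)"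
  proof (intro Bochner_Integration.integral_cong refl)
    fix x
    have "(coh_cos y b x)^2 + (coh_sin y b x)^2 = (exp (- ((x - y)^2) / 2))^2 * ((cos (b * (x - y)))^2 + (sin (b * (x - y)))^2)"
      unfolding coh_cos_def coh_sin_def by (simp only: power_mult_distrib distrib_left)
    also have "\<dots> = exp (- ((x - y)^2))" by (simp flip: exp_double)
    also have "\<dots> = sqrt pi * normal_density y (1 / sqrt 2) x" by (simp add: normal_density_def power_divide)
    finally show "(coh_cos y b x)^2 + (coh_sin y b x)^2 = sqrt pi * normal_density y (1 / sqrt 2) x" .
  qed
  finally show ?thesis by simp
qed

text \<open>The mass not captured is a Poisson tail with mean m; exp (- m) from the Poisson law
  against exp (2 m) from the tail bound leaves exp m / 2^N.\<close>

lemma coh_residual: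
  "(L2_norm (\<lambda>x. coh_cos y b x - hermite_proj N (coh_cos y b) x))^2 + (L2_norm (\<lambda>x. coh_sin y b x - hermite_proj N (coh_sin y b) x))^2
    \<le> sqrt pi * exp ((y^2 + b^2) / 2) / 2^N"
proof -
  let ?m = "(y^2 + b^2) / 2"
  have "(L2_norm (\<lambda>x. coh_cos y b x - hermite_proj N (coh_cos y b) x))^2 + (L2_norm (\<lambda>x. coh_sin y b x - hermite_proj N (coh_sin y b) x))^2
    = sqrt pi - (\<Sum>n<N. (L2_inner (coh_cos y b) (hermite_fun n))^2 + (L2_inner (coh_sin y b) (hermite_fun n))^2)"
    unfolding hermite_proj_residual_norm(2)[OF coh_L2(1)] hermite_proj_residual_norm(2)[OF coh_L2(2)] sum.distrib
    using coh_norm[of y b] by simp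
  also have "\<dots> = sqrt pi * exp (- ?m) * (exp ?m - (\<Sum>n<N. ?m^n / fact n))"
    unfolding coh_coeff sum_distrib_left[symmetric] by (simp add: right_diff_distrib exp_minus)
  also have "\<dots> \<le> sqrt pi * exp (- ?m) * (exp (2 * ?m) / 2^N)"
    by (intro mult_left_mono exp_tail_le) auto
  also have "\<dots> = sqrt pi * exp ?m / 2^N"
  proof -
    have e: "exp (- t) * exp (2 * t) = exp t" for t :: real
      unfolding exp_add[symmetric] by simp
    have "a * exp (- t) * (exp (2 * t) / c) = a * exp t / c" for a c t :: real
      using e[of t] by (simp add: mult.assoc)
    then show ?thesis .
  qed
  finally show ?thesis .
qed

text \<open>A function orthogonal to the first N Hermite functions pairs with the coherent state
  only through the part of the state with index at least N.\<close>

lemma coh_inner_residual: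
  assumes v: "v \<in> L2_space" "\<And>n. n < N \<Longrightarrow> L2_inner v (hermite_fun n) = 0"
  shows "\<bar>L2_inner v (coh_cos y b)\<bar> \<le> L2_norm v * sqrt (sqrt pi * exp ((y^2 + b^2) / 2) / 2^N)"
    and "\<bar>L2_inner v (coh_sin y b)\<bar> \<le> L2_norm v * sqrt (sqrt pi * exp ((y^2 + b^2) / 2) / 2^N)"
proof -
  have *: "\<bar>L2_inner v f\<bar> \<le> L2_norm v * L2_norm (\<lambda>x. f x - hermite_proj N f x)" if "f \<in> L2_space" for f
  proof -
    have "L2_inner v f = L2_inner v (\<lambda>x. f x - hermite_proj N f x)"
    proof -
      have "L2_inner (hermite_proj N f) v = 0"
        using v by (simp add: hermite_proj_inner L2_inner_commute[of "hermite_fun _"])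
      moreover have "L2_inner (\<lambda>x. f x - hermite_proj N f x) v = L2_inner f v - L2_inner (hermite_proj N f) v"
        using that v by (intro L2_inner_diff_left) auto
      ultimately show ?thesis by (simp add: L2_inner_commute[of v])
    qed
    then show ?thesis using L2_cauchy_schwarz[of v "\<lambda>x. f x - hermite_proj N f x"] v that by auto
  qed
  have "L2_norm (\<lambda>x. f x - hermite_proj N f x) \<le> sqrt (sqrt pi * exp ((y^2 + b^2) / 2) / 2^N)"
    if "f = coh_cos y b \<or> f = coh_sin y b" for f
    using that coh_residual[of y b N] by (intro real_le_rsqrt) (auto intro: order_trans[rotated])
  then show "\<bar>L2_inner v (coh_cos y b)\<bar> \<le> L2_norm v * sqrt (sqrt pi * exp ((y^2 + b^2) / 2) / 2^N)"
    "\<bar>L2_inner v (coh_sin y b)\<bar> \<le> L2_norm v * sqrt (sqrt pi * exp ((y^2 + b^2) / 2) / 2^N)"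
    by (auto intro!: order_trans[OF *] mult_left_mono)
qed

(* The indicator of [-L, L] smoothed by a standard Gaussian: the Fourier multiplier with this symbol
   has as kernel a superposition of coherent states with frequencies in [-L, L]. *)
definition soft_band :: "real \<Rightarrow> real \<Rightarrow> real" where
  "soft_band L k = (LINT b|lborel. indicator {-L..L} b * std_normal_density (k - b))"

lemma std_normal_density_shift: "std_normal_density (k - b) = normal_density k 1 b"
  by (simp add: normal_density_def power2_commute)

lemma soft_band_integrable_kernel: "integrable lborel (\<lambda>b. indicator {-L..L} b * std_normal_density (k - b))"
  unfolding std_normal_density_shift
  by (rule Bochner_Integration.integrable_bound[OF integrable_normal_density[of 1 k]]) (auto simp: indicator_def)

lemma soft_band_measurable [measurable]: "soft_band L \<in> borel_measurable borel"
  unfolding soft_band_def[abs_def] by measurable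

lemma soft_band_bounds: "0 \<le> soft_band L k" "soft_band L k \<le> 1"
proof -
  show "0 \<le> soft_band L k" unfolding soft_band_def by (intro Bochner_Integration.integral_nonneg) auto
  have "soft_band L k \<le> (LINT b|lborel. std_normal_density (k - b))"
    unfolding soft_band_def
    using soft_band_integrable_kernel[of L k] integrable_normal_density[of 1 k]
    by (intro integral_mono) (auto simp: std_normal_density_shift indicator_def)
  then show "soft_band L k \<le> 1" by (simp add: std_normal_density_shift)
qed

text \<open>Completing the square, (k - b)^2 / 2 - k^2 / 4 = (k - 2 b)^2 / 4 - b^2 / 2. Uniformly in
  b, the shifted density is thus dominated by a multiple of exp (- k^2 / 4).\<close>

lemma shifted_density_gaussian_bound:
  assumes "\<bar>b\<bar> \<le> L"
  shows "std_normal_density (k - b) * exp (k^2 / 4) \<le> exp (L^2 / 2)"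
proof -
  have "0 \<le> (k - 2 * b)^2" by simp
  moreover have "(k - 2 * b)^2 = k^2 - 4 * (k * b) + 4 * b^2" "(k - b)^2 = k^2 - 2 * (k * b) + b^2"
    by (simp_all add: power2_eq_square algebra_simps)
  ultimately have "- ((k - b)^2) / 2 + k^2 / 4 \<le> b^2 / 2" by linarith
  also have "b^2 \<le> L^2" using assms by (simp add: abs_le_square_iff[symmetric])
  finally have e: "exp (- ((k - b)^2) / 2 + k^2 / 4) \<le> exp (L^2 / 2)" by simp
  have "1 \<le> sqrt (2 * pi)" using pi_gt3 by (intro real_le_rsqrt) auto
  then have "1 / sqrt (2 * pi) * exp (- ((k - b)^2) / 2 + k^2 / 4) \<le> 1 * exp (- ((k - b)^2) / 2 + k^2 / 4)"
    by (intro mult_right_mono) auto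
  moreover have "std_normal_density (k - b) * exp (k^2 / 4) = 1 / sqrt (2 * pi) * exp (- ((k - b)^2) / 2 + k^2 / 4)"
    by (simp only: std_normal_density_def exp_add mult.assoc)
  ultimately show ?thesis using e by linarith
qed

lemma integrable_indicator_Icc: "integrable lborel (indicator {a..b} :: real \<Rightarrow> real)"
  by (auto intro!: integrable_real_indicator simp: emeasure_lborel_Icc_eq)

lemma soft_band_integrable: "integrable lborel (soft_band L)"
proof (rule Bochner_Integration.integrable_bound)
  let ?I = "LINT b|lborel. indicator {-L..L} b * exp (L^2 / 2)"
  show "integrable lborel (\<lambda>k. ?I * exp (- (k^2) / 4))"
    using exp_poly_integrable[of "1/4" 1] by auto
  have "soft_band L k \<le> ?I * exp (- (k^2) / 4)" for k
  proof -
    have "soft_band L k \<le> (LINT b|lborel. indicator {-L..L} b * exp (L^2 / 2) * exp (- (k^2) / 4))"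
      unfolding soft_band_def
    proof (rule integral_mono[OF soft_band_integrable_kernel])
      show "integrable lborel (\<lambda>b. indicator {-L..L} b * exp (L^2 / 2) * exp (- (k^2) / 4))"
        using integrable_indicator_Icc by auto
      fix b
      show "indicator {-L..L} b * std_normal_density (k - b) \<le> indicator {-L..L} b * exp (L^2 / 2) * exp (- (k^2) / 4)"
      proof (cases "b \<in> {-L..L}")
        case True
        then have "std_normal_density (k - b) * exp (k^2 / 4) * exp (- (k^2) / 4) \<le> exp (L^2 / 2) * exp (- (k^2) / 4)"
          by (intro mult_right_mono shifted_density_gaussian_bound) auto
        then show ?thesis using True by (simp add: mult.assoc flip: exp_add)
      qed simp
    qed
    then show ?thesis by simp
  qed
  then show "AE k in lborel. norm (soft_band L k) \<le> norm (?I * exp (- (k^2) / 4))"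
    using soft_band_bounds(1)[of L] by (intro AE_I2) (auto intro: order_trans[OF _ abs_ge_self])
qed measurable

text \<open>For |k| \<le> M each b outside [- 2 M, 2 M] has distance at least M from k. There the
  density at t = k - b is at most exp (- M^2 / 2) times its value at |t| - M, because (|t| - M)^2 +
  M^2 \<le> t^2. The factor 2 counts the two sides.\<close>

lemma soft_band_near_1:
  assumes "0 \<le> M" "\<bar>k\<bar> \<le> M"
  shows "1 - soft_band (2 * M) k \<le> 2 * exp (- (M^2) / 2)"
proof -
  let ?s = std_normal_density
  have ints: "integrable lborel (\<lambda>b. ?s (k - b + c))" "(LINT b|lborel. ?s (k - b + c)) = 1" for c
  proof -
    have "?s (k - b + c) = normal_density (k + c) 1 b" for b
      using std_normal_density_shift[of "k + c" b] by (simp add: algebra_simps)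
    then show "integrable lborel (\<lambda>b. ?s (k - b + c))" "(LINT b|lborel. ?s (k - b + c)) = 1" by simp_all
  qed
  have d: "?s t \<le> exp (- (M^2) / 2) * ?s (\<bar>t\<bar> - M)" if "\<bar>t\<bar> \<ge> M" for t
  proof -
    have "(\<bar>t\<bar> - M)^2 + M^2 \<le> t^2"
      using mult_nonneg_nonneg[of M "\<bar>t\<bar> - M"] assms(1) that by (simp add: power2_eq_square algebra_simps)
    then have "exp (- (t^2) / 2) \<le> exp (- (M^2) / 2 + - ((\<bar>t\<bar> - M)^2) / 2)" by simp
    then have "exp (- (t^2) / 2) \<le> exp (- (M^2) / 2) * exp (- ((\<bar>t\<bar> - M)^2) / 2)" by (simp only: exp_add)
    from mult_left_mono[OF this, of "1 / sqrt (2 * pi)"] show ?thesis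
      by (simp add: std_normal_density_def mult_ac)
  qed
  have "1 - soft_band (2 * M) k = (LINT b|lborel. ?s (k - b + 0) - indicator {-(2*M)..2*M} b * ?s (k - b))"
    unfolding soft_band_def using ints[of 0] soft_band_integrable_kernel[of "2 * M" k] by simp
  also have "\<dots> \<le> (LINT b|lborel. exp (- (M^2) / 2) * (?s (k - b + - M) + ?s (k - b + M)))"
  proof (rule integral_mono)
    fix b
    show "?s (k - b + 0) - indicator {-(2*M)..2*M} b * ?s (k - b) \<le> exp (- (M^2) / 2) * (?s (k - b + - M) + ?s (k - b + M))"
    proof (cases "b \<in> {-(2*M)..2*M}")
      case False
      then have t: "\<bar>k - b\<bar> \<ge> M" using assms by auto
      have "?s (\<bar>k - b\<bar> - M) \<le> ?s (k - b + - M) + ?s (k - b + M)"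
      proof (cases "k - b \<ge> 0")
        case False
        then have "?s (\<bar>k - b\<bar> - M) = ?s (k - b + M)" by (simp add: std_normal_density_def power2_eq_square algebra_simps)
        then show ?thesis by simp
      qed simp
      then have "exp (- (M^2) / 2) * ?s (\<bar>k - b\<bar> - M) \<le> exp (- (M^2) / 2) * (?s (k - b + - M) + ?s (k - b + M))"
        by (intro mult_left_mono) auto
      from order_trans[OF d[OF t] this] show ?thesis using False by simp
    qed auto
  qed (use ints(1)[of M] ints(1)[of "- M"] soft_band_integrable_kernel[of "2 * M" k] ints(1)[of 0] in auto)
  also have "\<dots> = 2 * exp (- (M^2) / 2)" using ints[of M] ints[of "- M"] by simp
  finally show ?thesis .
qed

text \<open>Up to 1 / (2 pi) the inverse Fourier transform of \<open>soft_band\<close>: smoothing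
  the symbol by convolution multiplies the kernel by exp (- t^2 / 2).\<close>

definition band_kernel :: "real \<Rightarrow> real \<Rightarrow> complex" where
  "band_kernel L t = complex_of_real (exp (- (t^2) / 2)) * (LINT b|lborel. complex_of_real (indicator {-L..L} b) * cis (t * b))"

lemma soft_band_fourier:
  "(LINT k|lborel. complex_of_real (soft_band L k) * cis (t * k)) = band_kernel L t"
proof -
  \<comment> \<open>exp (- k^2 / 4) is split off as the integrable factor, and the kernel keeps exp
    (k^2 / 4). The indicator is repeated inside the kernel so that
    \<open>shifted_density_gaussian_bound\<close> bounds it for all b.\<close>
  let ?a = "\<lambda>k. complex_of_real (exp (- (k^2) / 4))" and ?i = "\<lambda>b. complex_of_real (indicator {-L..L} b)"
  let ?K = "\<lambda>k b. complex_of_real (indicator {-L..L} b * (std_normal_density (k - b) * exp (k^2 / 4))) * cis (t * k)"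
  have aK: "?a k * (c * ?K k b) = c * (?i b * (complex_of_real (std_normal_density (k - b)) * cis (t * k)))" for k b c
  proof -
    have "exp (- (k^2) / 4) * exp (k^2 / 4) = 1" by (simp flip: exp_add)
    then have "complex_of_real (exp (- (k^2) / 4)) * complex_of_real (exp (k^2 / 4)) = 1" by (simp flip: of_real_mult)
    then show ?thesis by (simp add: mult_ac)
  qed
  have ii: "?i b * (?i b * c) = ?i b * c" for b c by (simp add: indicator_def)
  have "(LINT k|lborel. complex_of_real (soft_band L k) * cis (t * k)) = (LINT k|lborel. ?a k * (LINT b|lborel. ?i b * ?K k b))"
  proof (rule Bochner_Integration.integral_cong[OF refl])
    fix k
    have "?a k * (LINT b|lborel. ?i b * ?K k b) = (LINT b|lborel. ?a k * (?i b * ?K k b))" by simp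
    also have "\<dots> = (LINT b|lborel. complex_of_real (indicator {-L..L} b * std_normal_density (k - b)) * cis (t * k))"
      unfolding aK ii by (simp add: mult.assoc)
    also have "\<dots> = complex_of_real (soft_band L k) * cis (t * k)"
      unfolding soft_band_def integral_complex_of_real[symmetric] by simp
    finally show "complex_of_real (soft_band L k) * cis (t * k) = ?a k * (LINT b|lborel. ?i b * ?K k b)" by simp
  qed
  also have "\<dots> = (LINT b|lborel. ?i b * (LINT k|lborel. ?a k * ?K k b))"
  proof (rule bounded_kernel_swap[where C="exp (L^2 / 2)"])
    show "integrable lborel ?a" using exp_poly_integrable[of "1/4" 1] by simp
    show "integrable lborel ?i" using integrable_indicator_Icc by simp
    show "cmod (?K k b) \<le> exp (L^2 / 2)" for k b
    proof (cases "b \<in> {-L..L}")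
      case True
      then have "std_normal_density (k - b) * exp (k^2 / 4) \<le> exp (L^2 / 2)" by (intro shifted_density_gaussian_bound) auto
      then show ?thesis using True by (simp add: norm_mult)
    qed simp
  qed measurable
  also have "\<dots> = (LINT b|lborel. ?i b * (complex_of_real (exp (- (t^2) / 2)) * cis (t * b)))"
  proof (rule Bochner_Integration.integral_cong[OF refl])
    fix b
    have "(LINT k|lborel. ?a k * ?K k b) = ?i b * (LINT k|lborel. complex_of_real (std_normal_density (k - b)) * cis (t * k))"
    proof -
      have "?a k * ?K k b = ?i b * (complex_of_real (std_normal_density (k - b)) * cis (t * k))" for k
        using aK[of k 1 b] by (simp only: mult_1_left)
      then show ?thesis by (simp only: integral_mult_right_zero)
    qed
    also have "(LINT k|lborel. complex_of_real (std_normal_density (k - b)) * cis (t * k))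
        = (LINT s|lborel. complex_of_real (std_normal_density (b + 1 * s - b)) * cis (t * (b + 1 * s)))"
      by (subst lborel_integral_real_affine[where c=1 and t=b]) auto
    also have "\<dots> = (LINT s|lborel. complex_of_real (1 / sqrt (2 * pi)) * cis (t * b) * (complex_of_real (exp (- 1 * s^2 / 2)) * cis (t * s)))"
      by (simp add: std_normal_density_def distrib_left cis_mult[symmetric] mult_ac)
    also have "\<dots> = complex_of_real (1 / sqrt (2 * pi)) * cis (t * b) * complex_of_real (sqrt (2 * pi / 1) * exp (- (t^2) / (2 * 1)))"
      by (subst gaussian_fourier[symmetric]) simp_all
    also have "\<dots> = complex_of_real (exp (- (t^2) / 2)) * cis (t * b)" by simp
    finally show "?i b * (LINT k|lborel. ?a k * ?K k b) = ?i b * (complex_of_real (exp (- (t^2) / 2)) * cis (t * b))"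
      by (simp only: ii)
  qed
  also have "\<dots> = band_kernel L t" unfolding band_kernel_def by (simp add: mult.left_commute[of "complex_of_real (indicator _ _)"])
  finally show ?thesis .
qed

section \<open>The band-limiting operator\<close>

lemma band_kernel_measurable [measurable]: "band_kernel L \<in> borel_measurable borel"
  unfolding band_kernel_def[abs_def] by measurable

lemma band_kernel_bound:
  assumes "L \<ge> 0" shows "cmod (band_kernel L t) \<le> exp (- (t^2) / 2) * (2 * L)"
proof -
  have "cmod (LINT b|lborel. complex_of_real (indicator {-L..L} b) * cis (t * b)) \<le> (LINT b|lborel. cmod (complex_of_real (indicator {-L..L} b) * cis (t * b)))"
    by (rule integral_norm_bound)
  also have "\<dots> = (LINT b|lborel. indicator {-L..L} b)" by (simp add: norm_mult)
  also have "\<dots> = 2 * L" using assms by simp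
  finally show ?thesis unfolding band_kernel_def norm_mult by (simp add: mult_left_mono)
qed

text \<open>The inverse transform is the forward one at - x. Values stay complex, and real parts are
  taken where a real approximation is wanted, which cannot increase the distance to the real
  function h.\<close>

definition band_limit :: "real \<Rightarrow> (real \<Rightarrow> real) \<Rightarrow> real \<Rightarrow> complex" where
  "band_limit L h x = cfourier (\<lambda>k. complex_of_real (soft_band L k) * cfourier (\<lambda>y. complex_of_real (h y)) k) (- x)"

lemma band_limit_kernel:
  assumes h: "integrable lborel h"
  shows "band_limit L h x = 1 / (2 * pi) * (LINT y|lborel. complex_of_real (h y) * band_kernel L (x - y))"
proof -
  let ?c = "complex_of_real (1 / sqrt (2 * pi))" and ?\<chi> = "\<lambda>k. complex_of_real (soft_band L k)"
  have cc: "?c * ?c = 1 / (2 * pi)" by (simp flip: of_real_mult)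
  have "band_limit L h x = ?c * ?c * (LINT k|lborel. (?\<chi> k * cis (x * k)) * (LINT y|lborel. complex_of_real (h y) * cis (- k * y)))"
    unfolding band_limit_def cfourier_def by (simp add: mult_ac)
  also have "(LINT k|lborel. (?\<chi> k * cis (x * k)) * (LINT y|lborel. complex_of_real (h y) * cis (- k * y)))
    = (LINT y|lborel. complex_of_real (h y) * (LINT k|lborel. (?\<chi> k * cis (x * k)) * cis (- k * y)))"
  proof (rule bounded_kernel_swap[where C=1])
    show "integrable lborel (\<lambda>k. ?\<chi> k * cis (x * k))"
      using soft_band_integrable by (intro integrable_mult_bounded[where C=1]) auto
  qed (use h in auto)
  also have "(\<lambda>y. LINT k|lborel. (?\<chi> k * cis (x * k)) * cis (- k * y)) = (\<lambda>y. band_kernel L (x - y))"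
    unfolding soft_band_fourier[symmetric] by (simp only: mult.assoc cis_mult) (simp add: algebra_simps)
  finally show ?thesis unfolding cc .
qed

lemma cfourier_measurable' [measurable (raw)]:
  "h \<in> borel_measurable borel \<Longrightarrow> f \<in> borel_measurable M \<Longrightarrow> (\<lambda>x. cfourier h (f x)) \<in> borel_measurable M"
  by (rule measurable_compose[OF _ cfourier_measurable])

lemma band_limit_measurable [measurable (raw)]:
  "h \<in> borel_measurable borel \<Longrightarrow> band_limit L h \<in> borel_measurable borel"
  unfolding band_limit_def[abs_def]
  by (intro cfourier_measurable' borel_measurable_continuous_onI[OF continuous_on_minus[OF continuous_on_id]]) measurable

lemma band_limit_inner:
  assumes h: "integrable lborel h"
  shows "(LINT x|lborel. complex_of_real (h x) * cnj (band_limit L h x))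
    = complex_of_real (LINT k|lborel. soft_band L k * (cmod (cfourier (\<lambda>y. complex_of_real (h y)) k))^2)"
proof -
  let ?F = "cfourier (\<lambda>y. complex_of_real (h y))"
  have "cnj (band_kernel L t) = (LINT k|lborel. complex_of_real (soft_band L k) * cis (- t * k))" for t
    unfolding soft_band_fourier[symmetric] Bochner_Integration.integral_cnj[symmetric] by (simp add: cis_cnj)
  then have "cnj (band_limit L h x) = 1 / (2 * pi) * (LINT y|lborel. complex_of_real (h y) * (LINT k|lborel. complex_of_real (soft_band L k) * cis (- (x - y) * k)))" for x
    unfolding band_limit_kernel[OF h] complex_cnj_mult Bochner_Integration.integral_cnj[symmetric] by (simp del: minus_diff_eq)
  then have "(LINT x|lborel. complex_of_real (h x) * cnj (band_limit L h x))
    = 1 / (2 * pi) * (LINT x|lborel. complex_of_real (h x) * (LINT y|lborel. cnj (complex_of_real (h y)) * (LINT k|lborel. complex_of_real (soft_band L k) * cis (- (x - y) * k))))"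
    by (simp add: mult.left_commute[of "complex_of_real (h _)"])
  also have "\<dots> = (LINT k|lborel. complex_of_real (soft_band L k) * (?F k * cnj (?F k)))"
    using h soft_band_integrable by (intro parseval_weight[symmetric]) auto
  also have "\<dots> = (LINT k|lborel. complex_of_real (soft_band L k * (cmod (?F k))^2))"
    by (simp add: complex_norm_square[symmetric])
  finally show ?thesis by (simp only: integral_complex_of_real)
qed

text \<open>The Bessel inequality for the inverse transform. Together with
  \<open>band_limit_inner\<close> it allows the squared error to be expanded without an inversion
  theorem.\<close>

lemma band_limit_norm:
  assumes h: "integrable lborel h" "h \<in> L2_space"
  shows "integrable lborel (\<lambda>x. (cmod (band_limit L h x))^2)"
    and "(LINT x|lborel. (cmod (band_limit L h x))^2) \<le> (LINT k|lborel. (soft_band L k)^2 * (cmod (cfourier (\<lambda>y. complex_of_real (h y)) k))^2)"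
proof -
  let ?F = "cfourier (\<lambda>y. complex_of_real (h y))" and ?g = "\<lambda>k. complex_of_real (soft_band L k) * cfourier (\<lambda>y. complex_of_real (h y)) k"
  have hi: "integrable lborel (\<lambda>y. complex_of_real (h y))" using h by simp
  have [measurable]: "h \<in> borel_measurable borel" using h by (auto dest: borel_measurable_integrable)
  have F2: "integrable lborel (\<lambda>k. (cmod (?F k))^2)"
    by (rule cfourier_bessel(1)[OF hi]) (use L2_space_integrable[OF h(2)] in simp)
  have g1: "integrable lborel ?g"
    using soft_band_integrable by (intro integrable_mult_bounded[OF _ _ cfourier_bound[OF hi]]) auto
  have g2: "integrable lborel (\<lambda>k. (cmod (?g k))^2)"
  proof (rule Bochner_Integration.integrable_bound[OF F2])
    show "AE k in lborel. norm ((cmod (?g k))^2) \<le> norm ((cmod (?F k))^2)"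
      using soft_band_bounds[of L] by (intro AE_I2) (auto simp: norm_mult power_mult_distrib power_le_one intro!: mult_left_le_one_le)
  qed measurable
  note b = cfourier_bessel[OF g1 g2]
  have "integrable lborel (\<lambda>x. (cmod (cfourier ?g (0 + (-1) * x)))^2)"
    using b(1) by (intro lborel_integrable_real_affine) auto
  then show "integrable lborel (\<lambda>x. (cmod (band_limit L h x))^2)" by (simp add: band_limit_def)
  have "(LINT x|lborel. (cmod (band_limit L h x))^2) = (LINT x|lborel. (cmod (cfourier ?g x))^2)"
    by (subst (2) lborel_integral_real_affine[where c="-1" and t=0]) (auto simp: band_limit_def)
  also have "\<dots> \<le> (LINT k|lborel. (cmod (?g k))^2)" by (rule b(2))
  finally show "(LINT x|lborel. (cmod (band_limit L h x))^2) \<le> (LINT k|lborel. (soft_band L k)^2 * (cmod (?F k))^2)"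
    by (simp add: norm_mult power_mult_distrib)
qed

lemma band_limit_Re_L2:
  assumes h: "integrable lborel h" "h \<in> L2_space"
  shows "(\<lambda>x. Re (band_limit L h x)) \<in> L2_space"
proof -
  have [measurable]: "h \<in> borel_measurable borel" using h by (auto dest: borel_measurable_integrable)
  have "(\<lambda>x. cmod (band_limit L h x)) \<in> L2_space"
    using band_limit_norm(1)[OF h, of L] by (simp add: L2_space_def)
  then show ?thesis by (rule L2_space_bound) (auto simp: abs_Re_le_cmod)
qed

text \<open>With s the soft band and F the transform of h, Plancherel,
  \<open>band_limit_inner\<close> and the Bessel bound estimate the squared error by the integral of
  (1 - s)^2 |F|^2. Beyond M the factor is at most 1; up to M, 1 - s \<le> 2 exp (- M^2 / 2).\<close>

lemma band_limit_error:
  assumes h: "integrable lborel h" "h \<in> L2_space" and M: "0 \<le> M"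
  shows "L2_norm (\<lambda>x. h x - Re (band_limit (2 * M) h x))
    \<le> L2_norm_c (\<lambda>k. complex_of_real (indicator {k. \<bar>k\<bar> > M} k) * fourier_int h k) + 2 * exp (- (M^2) / 2) * L2_norm h"
proof -
  let ?F = "cfourier (\<lambda>y. complex_of_real (h y))" and ?\<chi> = "soft_band (2 * M)" and ?T = "band_limit (2 * M) h"
  have hi: "integrable lborel (\<lambda>y. complex_of_real (h y))" using h by simp
  have [measurable]: "h \<in> borel_measurable borel" using h by (auto dest: borel_measurable_integrable)
  have F2: "integrable lborel (\<lambda>k. (cmod (?F k))^2)"
    by (rule cfourier_bessel(1)[OF hi]) (use L2_space_integrable[OF h(2)] in simp)
  have b: "0 \<le> ?\<chi> k" "?\<chi> k \<le> 1" for k using soft_band_bounds by auto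
  have F\<chi>: "integrable lborel (\<lambda>k. ?\<chi> k * (cmod (?F k))^2)" "integrable lborel (\<lambda>k. (?\<chi> k)^2 * (cmod (?F k))^2)"
    by (rule Bochner_Integration.integrable_bound[OF F2]; use b in \<open>force simp: abs_mult power_le_one intro!: mult_left_le_one_le\<close>)+
  have T2: "integrable lborel (\<lambda>x. (cmod (?T x))^2)" by (rule band_limit_norm(1)[OF h])
  have R: "(\<lambda>x. Re (?T x)) \<in> L2_space" by (rule band_limit_Re_L2[OF h])
  have hR: "integrable lborel (\<lambda>x. h x * Re (?T x))" by (rule L2_space_mult_integrable[OF h(2) R])
  have hT: "(LINT x|lborel. h x * Re (?T x)) = (LINT k|lborel. ?\<chi> k * (cmod (?F k))^2)"
  proof -
    have "(\<lambda>x. cmod (?T x)) \<in> L2_space" using T2 by (simp add: L2_space_def)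
    from L2_space_mult_integrable[OF L2_space_abs[OF h(2)] this]
    have "integrable lborel (\<lambda>x. complex_of_real (h x) * cnj (?T x))"
      by (rule Bochner_Integration.integrable_bound) (auto simp: norm_mult)
    then have "Re (LINT x|lborel. complex_of_real (h x) * cnj (?T x)) = (LINT x|lborel. Re (complex_of_real (h x) * cnj (?T x)))"
      by (rule Bochner_Integration.integral_Re[symmetric])
    then show ?thesis unfolding band_limit_inner[OF h(1)] by simp
  qed
  have "(L2_norm h)^2 = (LINT k|lborel. (cmod (?F k))^2)"
    using cfourier_plancherel[OF h] by (metis L2_norm_c_def L2_norm_squared L2_norm_c_eq)
  then have pl: "(LINT x|lborel. (h x)^2) = (LINT k|lborel. (cmod (?F k))^2)" by (simp add: L2_norm_squared)
  have "(L2_norm (\<lambda>x. h x - Re (?T x)))^2 \<le> (LINT x|lborel. (h x)^2 - 2 * (h x * Re (?T x)) + (cmod (?T x))^2)"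
    unfolding L2_norm_squared
  proof (rule integral_mono)
    show "integrable lborel (\<lambda>x. (h x - Re (?T x))^2)" using h R by (intro L2_space_integrable) auto
    show "integrable lborel (\<lambda>x. (h x)^2 - 2 * (h x * Re (?T x)) + (cmod (?T x))^2)"
      using L2_space_integrable[OF h(2)] hR T2 by simp
    show "(h x - Re (?T x))^2 \<le> (h x)^2 - 2 * (h x * Re (?T x)) + (cmod (?T x))^2" for x
      by (simp add: cmod_power2 power2_diff)
  qed
  also have "\<dots> = (LINT k|lborel. (cmod (?F k))^2) - 2 * (LINT k|lborel. ?\<chi> k * (cmod (?F k))^2) + (LINT x|lborel. (cmod (?T x))^2)"
    using L2_space_integrable[OF h(2)] hR T2 by (simp add: pl hT)
  also have "\<dots> \<le> (LINT k|lborel. (cmod (?F k))^2) - 2 * (LINT k|lborel. ?\<chi> k * (cmod (?F k))^2) + (LINT k|lborel. (?\<chi> k)^2 * (cmod (?F k))^2)"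
    using band_limit_norm(2)[OF h] by simp
  also have "\<dots> = (LINT k|lborel. (1 - ?\<chi> k)^2 * (cmod (?F k))^2)"
    using F2 F\<chi> by (subst Bochner_Integration.integral_diff[symmetric] Bochner_Integration.integral_add[symmetric] integral_mult_right_zero[symmetric] | simp add: power2_diff algebra_simps)+
  also have "\<dots> \<le> (LINT k|lborel. (cmod (complex_of_real (indicator {k. \<bar>k\<bar> > M} k) * fourier_int h k))^2 + (2 * exp (- (M^2) / 2))^2 * (cmod (?F k))^2)"
  proof (rule integral_mono)
    have i1: "integrable lborel (\<lambda>k. (cmod (complex_of_real (indicator {k. \<bar>k\<bar> > M} k) * fourier_int h k))^2)"
      by (rule Bochner_Integration.integrable_bound[OF F2]) (auto simp: norm_mult indicator_def fourier_int_cfourier)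
    then show "integrable lborel (\<lambda>k. (cmod (complex_of_real (indicator {k. \<bar>k\<bar> > M} k) * fourier_int h k))^2 + (2 * exp (- (M^2) / 2))^2 * (cmod (?F k))^2)"
      using F2 by simp
    have "integrable lborel (\<lambda>k. (cmod (?F k))^2 - 2 * (?\<chi> k * (cmod (?F k))^2) + (?\<chi> k)^2 * (cmod (?F k))^2)"
      using F2 F\<chi> by simp
    then show "integrable lborel (\<lambda>k. (1 - ?\<chi> k)^2 * (cmod (?F k))^2)"
      by (simp add: power2_diff algebra_simps)
    show "(1 - ?\<chi> k)^2 * (cmod (?F k))^2 \<le> (cmod (complex_of_real (indicator {k. \<bar>k\<bar> > M} k) * fourier_int h k))^2 + (2 * exp (- (M^2) / 2))^2 * (cmod (?F k))^2" for k
    proof (cases "\<bar>k\<bar> > M")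
      case True
      have "(1 - ?\<chi> k)^2 \<le> 1" using b[of k] by (intro power_le_one) auto
      then have "(1 - ?\<chi> k)^2 * (cmod (?F k))^2 \<le> 1 * (cmod (?F k))^2" by (intro mult_right_mono) auto
      then show ?thesis using True by (simp add: fourier_int_cfourier add_increasing2)
    next
      case False
      then have "(1 - ?\<chi> k)^2 \<le> (2 * exp (- (M^2) / 2))^2"
        using b[of k] soft_band_near_1[OF M, of k] by (intro power_mono) auto
      then have "(1 - ?\<chi> k)^2 * (cmod (?F k))^2 \<le> (2 * exp (- (M^2) / 2))^2 * (cmod (?F k))^2" by (intro mult_right_mono) auto
      then show ?thesis by (simp add: add_increasing)
    qed
  qed
  also have "\<dots> = (L2_norm_c (\<lambda>k. complex_of_real (indicator {k. \<bar>k\<bar> > M} k) * fourier_int h k))^2 + (2 * exp (- (M^2) / 2) * L2_norm h)^2"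
  proof -
    have "integrable lborel (\<lambda>k. (cmod (complex_of_real (indicator {k. \<bar>k\<bar> > M} k) * fourier_int h k))^2)"
      by (rule Bochner_Integration.integrable_bound[OF F2]) (auto simp: norm_mult indicator_def fourier_int_cfourier)
    then show ?thesis using F2 by (simp add: L2_norm_c_def L2_norm_squared power_mult_distrib pl)
  qed
  also have "\<dots> \<le> (L2_norm_c (\<lambda>k. complex_of_real (indicator {k. \<bar>k\<bar> > M} k) * fourier_int h k) + 2 * exp (- (M^2) / 2) * L2_norm h)^2"
    by (simp add: power2_sum L2_norm_c_eq)
  finally show ?thesis by (rule power2_le_imp_le) (simp add: L2_norm_c_eq)
qed

text \<open>The band-limited h is a superposition over |y| \<le> M and |b| \<le> L of coherent
  states weighted by h(y). Each meets v only through its high-index tail, which is worst at the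
  corner (M, L); 2 L is the length of the frequency interval.\<close>

lemma band_limit_coherent:
  assumes h: "integrable lborel h" "h \<in> L2_space" "\<And>y. \<bar>y\<bar> > M \<Longrightarrow> h y = 0" and pos: "0 \<le> M" "0 \<le> L"
    and v: "v \<in> L2_space" "\<And>n. n < N \<Longrightarrow> L2_inner v (hermite_fun n) = 0"
  shows "\<bar>L2_inner (\<lambda>x. Re (band_limit L h x)) v\<bar>
    \<le> 2 * L * (LINT y|lborel. \<bar>h y\<bar>) * (L2_norm v * sqrt (sqrt pi * exp ((M^2 + L^2) / 2) / 2^N))"
proof -
  let ?\<delta> = "L2_norm v * sqrt (sqrt pi * exp ((M^2 + L^2) / 2) / 2^N)"
  let ?i = "\<lambda>b. complex_of_real (indicator {-L..L} b)"
  let ?c = "complex_of_real"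
  have [measurable]: "h \<in> borel_measurable borel" "v \<in> borel_measurable borel"
    using h v by (auto dest: borel_measurable_integrable L2_space_measurable)
  have inner: "cmod (LINT x|lborel. ?c (v x * exp (- ((x - y)^2) / 2)) * cis ((x - y) * b)) \<le> 2 * ?\<delta>"
    if yb: "\<bar>y\<bar> \<le> M" "\<bar>b\<bar> \<le> L" for y b
  proof -
    have "(y^2 + b^2) / 2 \<le> (M^2 + L^2) / 2"
      using yb pos by (intro divide_right_mono add_mono) (auto simp: abs_le_square_iff[symmetric])
    then have d: "sqrt (sqrt pi * exp ((y^2 + b^2) / 2) / 2^N) \<le> sqrt (sqrt pi * exp ((M^2 + L^2) / 2) / 2^N)"
      by (intro real_sqrt_le_mono divide_right_mono mult_left_mono) auto
    then have D: "L2_norm v * sqrt (sqrt pi * exp ((y^2 + b^2) / 2) / 2^N) \<le> ?\<delta>" by (intro mult_left_mono) auto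
    have i: "integrable lborel (\<lambda>x. v x * coh_cos y b x)" "integrable lborel (\<lambda>x. v x * coh_sin y b x)"
      by (intro L2_space_mult_integrable v coh_L2)+
    have "?c (v x * exp (- ((x - y)^2) / 2)) * cis ((x - y) * b) = ?c (v x * coh_cos y b x) + \<i> * ?c (v x * coh_sin y b x)" for x
      by (simp add: complex_eq_iff coh_cos_def coh_sin_def mult.commute)
    then have "(LINT x|lborel. ?c (v x * exp (- ((x - y)^2) / 2)) * cis ((x - y) * b)) = ?c (L2_inner v (coh_cos y b)) + \<i> * ?c (L2_inner v (coh_sin y b))"
      using i by (simp add: L2_inner_def del: of_real_mult)
    then have "cmod (LINT x|lborel. ?c (v x * exp (- ((x - y)^2) / 2)) * cis ((x - y) * b)) \<le> \<bar>L2_inner v (coh_cos y b)\<bar> + \<bar>L2_inner v (coh_sin y b)\<bar>"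
      using norm_triangle_ineq[of "?c (L2_inner v (coh_cos y b))" "\<i> * ?c (L2_inner v (coh_sin y b))"] by (simp add: norm_mult)
    moreover have "\<bar>L2_inner v (coh_cos y b)\<bar> \<le> L2_norm v * sqrt (sqrt pi * exp ((y^2 + b^2) / 2) / 2^N)"
      by (rule coh_inner_residual(1)[OF v(1)]) (rule v(2))
    moreover have "\<bar>L2_inner v (coh_sin y b)\<bar> \<le> L2_norm v * sqrt (sqrt pi * exp ((y^2 + b^2) / 2) / 2^N)"
      by (rule coh_inner_residual(2)[OF v(1)]) (rule v(2))
    ultimately show ?thesis using D by linarith
  qed
  have J: "cmod (LINT x|lborel. ?c (v x) * band_kernel L (x - y)) \<le> 2 * L * (2 * ?\<delta>)" if y: "\<bar>y\<bar> \<le> M" for y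
  proof -
    let ?a = "\<lambda>x. ?c (v x * exp (- ((x - y)^2) / 2))"
    have ai: "integrable lborel ?a"
      using L2_space_mult_integrable[OF v(1) shifted_gaussian_L2[of y]] by (simp del: of_real_mult)
    have "(LINT x|lborel. ?c (v x) * band_kernel L (x - y)) = (LINT x|lborel. ?a x * (LINT b|lborel. ?i b * cis ((x - y) * b)))"
      by (simp add: band_kernel_def mult.assoc)
    also have "\<dots> = (LINT b|lborel. ?i b * (LINT x|lborel. ?a x * cis ((x - y) * b)))"
      by (rule bounded_kernel_swap[where C=1]) (use ai integrable_indicator_Icc in auto)
    finally have eqJ: "(LINT x|lborel. ?c (v x) * band_kernel L (x - y)) = (LINT b|lborel. ?i b * (LINT x|lborel. ?a x * cis ((x - y) * b)))" .
    have "cmod (LINT x|lborel. ?c (v x) * band_kernel L (x - y)) \<le> (LINT b|lborel. cmod (?i b * (LINT x|lborel. ?a x * cis ((x - y) * b))))"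
      unfolding eqJ by (rule integral_norm_bound)
    also have "\<dots> \<le> (LINT b|lborel. indicator {-L..L} b * (2 * ?\<delta>))"
    proof (rule integral_mono')
      show "integrable lborel (\<lambda>b. indicator {-L..L} b * (2 * ?\<delta>))" using integrable_indicator_Icc by (rule integrable_mult_left)
      show "cmod (?i b * (LINT x|lborel. ?a x * cis ((x - y) * b))) \<le> indicator {-L..L} b * (2 * ?\<delta>)" for b
      proof (cases "b \<in> {-L..L}")
        case True
        then have "\<bar>b\<bar> \<le> L" by auto
        from inner[OF y this] show ?thesis
          unfolding indicator_simps(1)[OF True] of_real_1 mult_1_left .
      next
        case False
        show ?thesis unfolding indicator_simps(2)[OF False] by simp
      qed
      show "0 \<le> indicator {-L..L} b * (2 * ?\<delta>)" for b by (intro mult_nonneg_nonneg) auto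
    qed
    also have "\<dots> = 2 * L * (2 * ?\<delta>)" using pos by simp
    finally show ?thesis .
  qed
  \<comment> \<open>v is merely square-integrable; multiplied by exp (- x^2 / 4) it becomes
    integrable. The compensating exp (x^2 / 4) is controlled by the Gaussian in the band kernel
    because |y| \<le> M.\<close>
  let ?a = "\<lambda>x. ?c (v x * exp (- (x^2) / 4))" and ?m = "\<lambda>y. ?c (indicator {-M..M} y)"
  let ?K = "\<lambda>x y. ?m y * ?c (exp (x^2 / 4)) * band_kernel L (x - y)"
  have ai: "integrable lborel ?a"
  proof -
    have "(\<lambda>x::real. exp (- (x^2) / 4)) \<in> L2_space"
    proof -
      have "(exp (- (x^2) / 4))^2 = exp (- (1/2) * x^2) * poly 1 x" for x :: real
        by (simp flip: exp_double)
      then show ?thesis using exp_poly_integrable[of "1/2" 1] by (simp add: L2_space_def del: power2_eq_square)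
    qed
    from L2_space_mult_integrable[OF v(1) this] show ?thesis by (simp del: of_real_mult)
  qed
  have Kb: "cmod (?K x y) \<le> exp (M^2 / 2) * (2 * L)" for x y
  proof (cases "y \<in> {-M..M}")
    case True
    have "0 \<le> (x - 2 * y)^2" by simp
    moreover have "(x - 2 * y)^2 = x^2 - 4 * (x * y) + 4 * y^2" "(x - y)^2 = x^2 - 2 * (x * y) + y^2"
      by (simp_all add: power2_eq_square algebra_simps)
    moreover have "y^2 \<le> M^2" using True pos by (auto simp: abs_le_square_iff[symmetric])
    ultimately have "x^2 / 4 + - ((x - y)^2) / 2 \<le> M^2 / 2" by linarith
    then have "exp (x^2 / 4) * exp (- ((x - y)^2) / 2) \<le> exp (M^2 / 2)" by (simp flip: exp_add)
    then have "exp (x^2 / 4) * exp (- ((x - y)^2) / 2) * (2 * L) \<le> exp (M^2 / 2) * (2 * L)"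
      using pos by (intro mult_right_mono) auto
    moreover have "cmod (?K x y) \<le> exp (x^2 / 4) * (exp (- ((x - y)^2) / 2) * (2 * L))"
      using True mult_left_mono[OF band_kernel_bound[OF pos(2), of "x - y"], of "exp (x^2 / 4)"] by (simp add: norm_mult)
    ultimately show ?thesis by (simp add: mult.assoc)
  qed (use pos in simp)
  have hm: "?c (h y) * ?m y = ?c (h y)" for y using h(3)[of y] by (cases "\<bar>y\<bar> > M") (auto simp: indicator_def)
  have aK: "?a x * ?K x y = ?m y * (?c (v x) * band_kernel L (x - y))" for x y
  proof -
    have "exp (- (x^2) / 4) * exp (x^2 / 4) = 1" by (simp flip: exp_add)
    then have "?c (exp (- (x^2) / 4)) * ?c (exp (x^2 / 4)) = 1" by (simp flip: of_real_mult)
    then have "?c (v x) * (?m y * ((?c (exp (- (x^2) / 4)) * ?c (exp (x^2 / 4))) * band_kernel L (x - y))) = ?m y * (?c (v x) * band_kernel L (x - y))"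
      by simp
    then show ?thesis by (simp only: of_real_mult mult_ac)
  qed
  have T: "band_limit L h x = 1 / (2 * pi) * (LINT y|lborel. ?c (h y) * band_kernel L (x - y))" for x
    by (rule band_limit_kernel[OF h(1)])
  have Ti: "integrable lborel (\<lambda>x. ?c (v x) * band_limit L h x)"
  proof -
    have [measurable]: "band_limit L h \<in> borel_measurable borel" by measurable
    have "(\<lambda>x. cmod (band_limit L h x)) \<in> L2_space"
      using band_limit_norm(1)[OF h(1,2), of L] by (simp add: L2_space_def)
    from L2_space_mult_integrable[OF L2_space_abs[OF v(1)] this] show ?thesis
      by (rule Bochner_Integration.integrable_bound) (auto simp: norm_mult)
  qed
  have "(LINT x|lborel. ?c (v x) * band_limit L h x) = 1 / (2 * pi) * (LINT x|lborel. ?c (v x) * (LINT y|lborel. ?c (h y) * band_kernel L (x - y)))"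
    unfolding T by (simp add: mult.left_commute[of "?c (v _)"])
  also have "(LINT x|lborel. ?c (v x) * (LINT y|lborel. ?c (h y) * band_kernel L (x - y))) = (LINT x|lborel. ?a x * (LINT y|lborel. ?c (h y) * ?K x y))"
  proof (rule Bochner_Integration.integral_cong[OF refl])
    fix x
    have "?a x * (LINT y|lborel. ?c (h y) * ?K x y) = (LINT y|lborel. ?c (h y) * (?a x * ?K x y))"
      by (subst integral_mult_right_zero[symmetric]) (simp only: mult.left_commute)
    also have "\<dots> = (LINT y|lborel. ?c (v x) * (?c (h y) * ?m y * band_kernel L (x - y)))"
      unfolding aK by (simp only: mult_ac)
    also have "\<dots> = ?c (v x) * (LINT y|lborel. ?c (h y) * band_kernel L (x - y))"
      unfolding hm by simp
    finally show "?c (v x) * (LINT y|lborel. ?c (h y) * band_kernel L (x - y)) = ?a x * (LINT y|lborel. ?c (h y) * ?K x y)" by (rule sym)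
  qed
  also have "\<dots> = (LINT y|lborel. ?c (h y) * (LINT x|lborel. ?a x * ?K x y))"
    by (rule bounded_kernel_swap[OF ai _ _ Kb]) (use h in auto)
  finally have eq: "(LINT x|lborel. ?c (v x) * band_limit L h x) = 1 / (2 * pi) * (LINT y|lborel. ?c (h y) * (LINT x|lborel. ?a x * ?K x y))" .
  have "cmod (LINT y|lborel. ?c (h y) * (LINT x|lborel. ?a x * ?K x y)) \<le> (LINT y|lborel. cmod (?c (h y) * (LINT x|lborel. ?a x * ?K x y)))"
    by (rule integral_norm_bound)
  also have "\<dots> \<le> (LINT y|lborel. \<bar>h y\<bar> * (2 * L * (2 * ?\<delta>)))"
  proof (rule integral_mono')
    show "integrable lborel (\<lambda>y. \<bar>h y\<bar> * (2 * L * (2 * ?\<delta>)))" using h(1) by (intro integrable_mult_left integrable_abs)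
    fix y
    show "cmod (?c (h y) * (LINT x|lborel. ?a x * ?K x y)) \<le> \<bar>h y\<bar> * (2 * L * (2 * ?\<delta>))"
    proof (cases "\<bar>y\<bar> \<le> M")
      case True
      then have "y \<in> {-M..M}" by auto
      then have "cmod (LINT x|lborel. ?a x * ?K x y) \<le> 2 * L * (2 * ?\<delta>)"
        unfolding aK using J[OF True] by simp
      then show ?thesis unfolding norm_mult by (simp only: norm_of_real mult_left_mono abs_ge_zero)
    qed (use h(3)[of y] in simp)
  qed (use pos in auto)
  finally have B: "cmod (LINT y|lborel. ?c (h y) * (LINT x|lborel. ?a x * ?K x y)) \<le> (LINT y|lborel. \<bar>h y\<bar>) * (2 * L * (2 * ?\<delta>))"
    by simp
  have "L2_inner (\<lambda>x. Re (band_limit L h x)) v = (LINT x|lborel. Re (?c (v x) * band_limit L h x))"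
    by (simp add: L2_inner_def mult.commute)
  also have "\<dots> = Re (LINT x|lborel. ?c (v x) * band_limit L h x)"
    by (rule Bochner_Integration.integral_Re[OF Ti])
  finally have "\<bar>L2_inner (\<lambda>x. Re (band_limit L h x)) v\<bar> \<le> cmod (LINT x|lborel. ?c (v x) * band_limit L h x)"
    by (simp only: abs_Re_le_cmod)
  also have "\<dots> = 1 / (2 * pi) * cmod (LINT y|lborel. ?c (h y) * (LINT x|lborel. ?a x * ?K x y))"
  proof -
    have "\<bar>1 / (2 * pi)\<bar> = 1 / (2 * pi)" by simp
    then show ?thesis unfolding eq norm_mult by (simp only: norm_of_real)
  qed
  also have "\<dots> \<le> 1 / (2 * pi) * ((LINT y|lborel. \<bar>h y\<bar>) * (2 * L * (2 * ?\<delta>)))"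
    by (intro mult_left_mono B) auto
  \<comment> \<open>Weakening 1 / (2 pi) to 1 / 2 cancels the factor 2 that came from treating
    cosine and sine parts separately.\<close>
  also have "\<dots> \<le> 1 / 2 * ((LINT y|lborel. \<bar>h y\<bar>) * (2 * L * (2 * ?\<delta>)))"
    using pi_gt3 pos by (intro mult_right_mono mult_nonneg_nonneg) (auto simp: field_simps)
  finally show ?thesis by (simp add: mult_ac)
qed

text \<open>The 7/16 in q is 5/16 from the mean 5 N / 16 plus 2/16 from squaring the target exp (- N
  / 16). The squared left side is then polynomial in N times q^N exp (- N / 8), and q < 1 absorbs
  the polynomial, for which M \<le> N is precise enough.\<close>

lemma coherent_error_constant:
  obtains B :: real where "B \<ge> 0" "\<And>(N::nat) M. N \<ge> 1 \<Longrightarrow> M = 1 / (2 * sqrt 2) * sqrt (real N) \<Longrightarrow>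
    2 * (2 * M) * (sqrt (2 * M) * sqrt (sqrt pi * exp ((M^2 + (2 * M)^2) / 2) / 2^N)) \<le> B * exp (- real N / 16)"
proof -
  define q where "q = exp (7/16 :: real) / 2"
  have q: "0 < q" "q < 1"
  proof -
    have "exp (7/16 :: real) \<le> exp (1/2)" by simp
    also have "exp (1/2 :: real) < 2"
    proof (rule power2_less_imp_less)
      have "(exp (1/2 :: real))^2 = exp 1" by (simp flip: exp_double)
      then show "(exp (1/2 :: real))^2 < 2^2" using exp_le by simp
    qed simp
    finally show "q < 1" by (simp add: q_def)
  qed (simp add: q_def)
  have "(\<lambda>N. real N^2 * q^N) \<longlonglongrightarrow> 0" using q by real_asymp
  then have "Bseq (\<lambda>N. real N^2 * q^N)" by (intro convergent_imp_Bseq convergentI)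
  then obtain K where K: "K > 0" "\<And>N. norm (real N^2 * q^N) \<le> K" by (rule BseqE) auto
  show ?thesis
  proof (rule that[of "sqrt (8 * K)"])
    show "0 \<le> sqrt (8 * K)" using K by simp
    fix N :: nat and M :: real assume N: "N \<ge> 1" and M_def: "M = 1 / (2 * sqrt 2) * sqrt (real N)"
    have M: "M \<ge> 0" "M^2 = real N / 8" by (auto simp: M_def power_mult_distrib power_divide)
    have pos: "(M^2 + (2 * M)^2) / 2 = 5 * real N / 16" using M(2) by (simp add: power_mult_distrib)
    have "M \<le> real N"
    proof (rule power2_le_imp_le)
      have "real N * 1 \<le> real N * real N" using N by (intro mult_left_mono) auto
      then show "M^2 \<le> (real N)^2" using M(2) by (simp add: power2_eq_square)
    qed simp
    have ex: "exp (5 * real N / 16) / 2^N = q^N * exp (- real N / 8)"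
    proof -
      have "q^N = exp (7/16 * real N) / 2^N" by (simp add: q_def power_divide exp_of_nat_mult[symmetric] mult.commute)
      moreover have "exp (7/16 * real N) * exp (- real N / 8) = exp (5 * real N / 16)"
        unfolding exp_add[symmetric] by (rule arg_cong[where f=exp]) simp
      ultimately show ?thesis by simp
    qed
    have sp: "sqrt pi \<le> 2" using pi_less_4 by (intro real_le_lsqrt) auto
    have "(2 * (2 * M) * (sqrt (2 * M) * sqrt (sqrt pi * exp (5 * real N / 16) / 2^N)))^2
       = 16 * M^2 * (2 * M) * (sqrt pi * (exp (5 * real N / 16) / 2^N))"
      using M(1) by (simp add: power_mult_distrib)
    also have "\<dots> \<le> 16 * (real N / 8) * (2 * real N) * (2 * (exp (5 * real N / 16) / 2^N))"
      unfolding M(2) using \<open>M \<le> real N\<close> M(1) sp by (intro mult_mono mult_right_mono) auto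
    also have "\<dots> = 8 * (real N^2 * q^N) * exp (- real N / 8)"
      unfolding ex by (simp add: power2_eq_square)
    also have "\<dots> \<le> 8 * K * exp (- real N / 8)"
      using K(2)[of N] by (intro mult_right_mono) (auto simp: abs_le_iff)
    also have "\<dots> = (sqrt (8 * K) * exp (- real N / 16))^2"
      using K(1) by (simp add: power_mult_distrib flip: exp_double)
    finally show "2 * (2 * M) * (sqrt (2 * M) * sqrt (sqrt pi * exp ((M^2 + (2 * M)^2) / 2) / 2^N))
        \<le> sqrt (8 * K) * exp (- real N / 16)"
      unfolding pos by (rule power2_le_imp_le) (use K(1) in auto)
  qed
qed

text \<open>Duality: the squared norm of the residual v is the pairing of w with v. Splitting w into
  w - h, h minus its band-limited version, and that version, each pairing is a multiple of the norm
  of v, which is divided out. The spatial tail enters twice, once for w - h and once when h replaces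
  w in the Fourier tail; 2 + B covers this and the leakage terms.\<close>

lemma hermite_approximation:
  obtains C :: real where "C \<ge> 0"
    "\<And>w N. w \<in> L2_space \<Longrightarrow> N \<ge> 1 \<Longrightarrow> L2_norm (\<lambda>x. w x - hermite_proj N w x) \<le> C * E_err N 1 w"
proof -
  obtain B :: real where B: "B \<ge> 0" "\<And>(N::nat) M. N \<ge> 1 \<Longrightarrow> M = 1 / (2 * sqrt 2) * sqrt (real N) \<Longrightarrow>
    2 * (2 * M) * (sqrt (2 * M) * sqrt (sqrt pi * exp ((M^2 + (2 * M)^2) / 2) / 2^N)) \<le> B * exp (- real N / 16)" using coherent_error_constant by blast
  have main: "L2_norm (\<lambda>x. w x - hermite_proj N w x) \<le> (2 + B) * E_err N 1 w" if w: "w \<in> L2_space" and N: "N \<ge> 1" for w N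
  proof -
    define M where "M = 1 / (2 * sqrt 2) * sqrt (real N)"
    have M: "M \<ge> 0" "M^2 / 2 = real N / 16" by (auto simp: M_def power_mult_distrib power_divide)
    define h where "h x = w x * indicator {-M..M} x" for x
    define v where "v x = w x - hermite_proj N w x" for x
    let ?e = "exp (- real N / 16)" and ?T = "\<lambda>x. Re (band_limit (2 * M) h x)"
    let ?tx = "L2_norm (\<lambda>x. w x * indicator {x. \<bar>x\<bar> > M} x)"
    have h: "integrable lborel h" "h \<in> L2_space" "\<And>y. \<bar>y\<bar> > M \<Longrightarrow> h y = 0"
      unfolding h_def[abs_def] using w L2_space_integrable_Icc[OF w] L2_space_indicator[OF w]
      by (auto simp: indicator_eq_0_iff)
    have v: "v \<in> L2_space" "\<And>n. n < N \<Longrightarrow> L2_inner v (hermite_fun n) = 0"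
      unfolding v_def[abs_def] using w by (auto simp: hermite_proj_residual_orthogonal)
    have T: "?T \<in> L2_space" by (rule band_limit_Re_L2[OF h(1,2)])
    have wh: "L2_norm (\<lambda>x. w x - h x) = ?tx"
    proof (rule arg_cong[where f=L2_norm], rule ext)
      fix x show "w x - h x = w x * indicator {x. \<bar>x\<bar> > M} x"
        by (cases "\<bar>x\<bar> > M") (auto simp: h_def indicator_def)
    qed
    have hw: "L2_norm h \<le> L2_norm w"
      by (rule L2_norm_mono[OF w]) (use L2_space_measurable[OF h(2)] in \<open>auto simp: h_def indicator_def\<close>)
    \<comment> \<open>The support length 2 M converts the L1 norm into an L2 norm; this accounts for
      \<open>sqrt (2 * M)\<close> in \<open>coherent_error_constant\<close>.\<close>
    have h1: "(LINT y|lborel. \<bar>h y\<bar>) \<le> sqrt (2 * M) * L2_norm w"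
    proof -
      have I: "indicator {-M..M} \<in> L2_space"
      proof -
        have "(indicator {-M..M} x :: real)^2 = indicator {-M..M} x" for x by (simp add: indicator_def)
        then show ?thesis using integrable_indicator_Icc by (simp add: L2_space_def)
      qed
      have "(LINT y|lborel. \<bar>h y\<bar>) = L2_inner (\<lambda>y. \<bar>h y\<bar>) (indicator {-M..M})"
        unfolding L2_inner_def by (intro Bochner_Integration.integral_cong) (auto simp: h_def indicator_def)
      also have "\<dots> \<le> L2_norm (\<lambda>y. \<bar>h y\<bar>) * L2_norm (indicator {-M..M})"
        using L2_cauchy_schwarz[OF L2_space_abs[OF h(2)] I] by simp
      also have "L2_norm (\<lambda>y. \<bar>h y\<bar>) = L2_norm h" by (simp add: L2_norm_def)
      also have "L2_norm (indicator {-M..M}) = sqrt (2 * M)"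
      proof -
        have "(indicator {-M..M} x :: real)^2 = indicator {-M..M} x" for x by (simp add: indicator_def)
        then show ?thesis using M(1) by (simp add: L2_norm_def)
      qed
      also have "L2_norm h * sqrt (2 * M) \<le> L2_norm w * sqrt (2 * M)" using hw M(1) by (intro mult_right_mono) auto
      finally show ?thesis by (simp add: mult.commute)
    qed
    have "(L2_norm v)^2 = L2_inner w v"
      using hermite_proj_residual_norm(1)[OF w, of N] by (simp add: v_def[abs_def])
    also have "\<dots> = L2_inner (\<lambda>x. w x - h x) v + L2_inner (\<lambda>x. h x - ?T x) v + L2_inner ?T v"
      using w h v T by (simp add: L2_inner_diff_left)
    also have "\<dots> \<le> ?tx * L2_norm v + (fourier_tail_norm w M + ?tx + 2 * ?e * L2_norm w) * L2_norm v + (B * ?e * L2_norm w) * L2_norm v"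
    proof (intro add_mono)
      have "(\<lambda>x. w x - h x) \<in> L2_space" using w h by auto
      from L2_cauchy_schwarz[OF this v(1)] show "L2_inner (\<lambda>x. w x - h x) v \<le> ?tx * L2_norm v" unfolding wh by simp
      have "(\<lambda>x. h x - ?T x) \<in> L2_space" using T h by auto
      from L2_cauchy_schwarz[OF this v(1)] have "L2_inner (\<lambda>x. h x - ?T x) v \<le> L2_norm (\<lambda>x. h x - ?T x) * L2_norm v" by simp
      also have "L2_norm (\<lambda>x. h x - ?T x) \<le> L2_norm_c (\<lambda>k. complex_of_real (indicator {k. \<bar>k\<bar> > M} k) * fourier_int h k) + 2 * exp (- (M^2) / 2) * L2_norm h"
        by (rule band_limit_error[OF h(1,2) M(1)])
      also have "\<dots> \<le> (fourier_tail_norm w M + ?tx) + 2 * ?e * L2_norm w"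
      proof (intro add_mono)
        show "L2_norm_c (\<lambda>k. complex_of_real (indicator {k. \<bar>k\<bar> > M} k) * fourier_int h k) \<le> fourier_tail_norm w M + ?tx"
          using fourier_tail_norm_compare[OF w h(1,2), of M] wh by (simp add: L2_norm_minus[of h])
        have "exp (- (M^2) / 2) = ?e" using M(2) by simp
        then show "2 * exp (- (M^2) / 2) * L2_norm h \<le> 2 * ?e * L2_norm w" using hw by (simp only:) simp
      qed
      finally show "L2_inner (\<lambda>x. h x - ?T x) v \<le> (fourier_tail_norm w M + ?tx + 2 * ?e * L2_norm w) * L2_norm v"
        by (simp add: mult_right_mono)
      let ?s = "sqrt (sqrt pi * exp ((M^2 + (2 * M)^2) / 2) / 2^N)"
      have "L2_inner ?T v \<le> 2 * (2 * M) * (LINT y|lborel. \<bar>h y\<bar>) * (L2_norm v * ?s)"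
        by (rule order_trans[OF abs_ge_self band_limit_coherent[OF h M(1) _ v(1) v(2)]]) (use M in auto)
      also have "\<dots> \<le> 2 * (2 * M) * (sqrt (2 * M) * L2_norm w) * (L2_norm v * ?s)"
        using h1 M(1) by (intro mult_right_mono mult_left_mono mult_nonneg_nonneg) auto
      also have "\<dots> = (2 * (2 * M) * (sqrt (2 * M) * ?s)) * (L2_norm w * L2_norm v)" by (simp only: mult_ac)
      also have "\<dots> \<le> (B * ?e) * (L2_norm w * L2_norm v)"
        using B(2)[OF N M_def] by (intro mult_right_mono) auto
      finally show "L2_inner ?T v \<le> (B * ?e * L2_norm w) * L2_norm v" by (simp only: mult_ac)
    qed
    also have "\<dots> = (2 * ?tx + fourier_tail_norm w M + (2 + B) * (L2_norm w * ?e)) * L2_norm v"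
      by (simp add: algebra_simps)
    also have "\<dots> \<le> ((2 + B) * E_err N 1 w) * L2_norm v"
    proof (intro mult_right_mono)
      have t0: "0 \<le> fourier_tail_norm w M" by (rule fourier_tail_norm_nonneg[OF w])
      have E: "E_err N 1 w = ?tx + fourier_tail_norm w M + L2_norm w * ?e" by (simp add: E_err_def M_def)
      show "2 * ?tx + fourier_tail_norm w M + (2 + B) * (L2_norm w * ?e) \<le> (2 + B) * E_err N 1 w"
        unfolding E distrib_left using B(1) t0 by (intro add_mono) (auto simp: distrib_right)
    qed simp
    finally have "L2_norm v * L2_norm v \<le> ((2 + B) * E_err N 1 w) * L2_norm v" by (simp only: power2_eq_square)
    moreover have "0 \<le> (2 + B) * E_err N 1 w"
      using B(1) fourier_tail_norm_nonneg[OF w] by (auto simp: E_err_def intro!: mult_nonneg_nonneg add_nonneg_nonneg)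
    ultimately have "L2_norm v \<le> (2 + B) * E_err N 1 w"
      by (cases "L2_norm v = 0") (auto simp: less_le)
    then show ?thesis by (simp add: v_def[abs_def])
  qed
  show ?thesis by (rule that[OF _ main]) (use B in auto)
qed

section \<open>Interpolation and rescaling\<close>

lemma L2_norm_hermite_fun: "L2_norm (hermite_fun n) = 1"
proof -
  have "(L2_norm (hermite_fun n))^2 = 1" by (simp add: L2_norm_inner hermite_orthonormal)
  then show ?thesis by (metis L2_norm_nonneg one_power2 power2_eq_iff_nonneg zero_le_one)
qed

definition proj_poly :: "nat \<Rightarrow> (real \<Rightarrow> real) \<Rightarrow> real poly" where
  "proj_poly N w = (\<Sum>n<N. smult (L2_inner w (hermite_fun n)) (hermite_normal n))"

lemma hermite_proj_gauss_poly: "hermite_proj N w = gauss_poly 1 (proj_poly N w)"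
  by (simp add: fun_eq_iff hermite_proj_def proj_poly_def gauss_poly_sum gauss_poly_smult hermite_fun_gauss_poly)

lemma degree_proj_poly: "degree (proj_poly (Suc N) w) \<le> N"
  unfolding proj_poly_def
  by (intro degree_sum_le) (auto intro: order_trans[OF degree_smult_le] simp: degree_hermite_normal)

lemma hermite_proj_residual_mono:
  assumes "w \<in> L2_space"
  shows "L2_norm (\<lambda>x. w x - hermite_proj (Suc N) w x) \<le> L2_norm (\<lambda>x. w x - hermite_proj N w x)"
  by (rule power2_le_imp_le) (simp_all add: hermite_proj_residual_norm(2)[OF assms])

lemma hermite_coeff_bound:
  assumes "w \<in> L2_space" "N \<le> m"
  shows "\<bar>L2_inner w (hermite_fun m)\<bar> \<le> L2_norm (\<lambda>x. w x - hermite_proj N w x)"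
proof -
  have "L2_inner w (hermite_fun m) = L2_inner (\<lambda>x. w x - hermite_proj N w x) (hermite_fun m)"
    using assms by (subst L2_inner_diff_left) (auto simp: hermite_proj_coeff)
  then show ?thesis
    using L2_cauchy_schwarz[of "\<lambda>x. w x - hermite_proj N w x" "hermite_fun m"] assms
    by (auto simp: L2_norm_hermite_fun)
qed

(* Differentiation couples only neighbouring Hermite indices, so its commutator with truncation
   consists of two boundary terms. *)
lemma hermite_proj_deriv_commutator:
  assumes w: "w \<in> L2_space" and w1: "w1 \<in> L2_space"
    and wd: "\<And>p. L2_inner w1 (gauss_poly 1 p) = - \<beta> * L2_inner w (gauss_poly 1 (gauss_deriv 1 p))"
  shows "hermite_proj N w1 x - \<beta> * deriv (hermite_proj N w) x
    = \<beta> * sqrt (real N / 2) * (L2_inner w (hermite_fun N) * hermite_fun (N - 1) x + L2_inner w (hermite_fun (N - 1)) * hermite_fun N x)"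
proof -
  let ?c = "\<lambda>n. L2_inner w (hermite_fun n)"
  have d: "L2_inner w1 (hermite_fun n) = \<beta> * (sqrt ((real n + 1) / 2) * ?c (Suc n) - sqrt (real n / 2) * ?c (n - 1))" for n
  proof -
    have "L2_inner w (gauss_poly 1 (gauss_deriv 1 (hermite_normal n)))
      = L2_inner w (\<lambda>x. sqrt (real n / 2) * hermite_fun (n - 1) x - sqrt ((real n + 1) / 2) * hermite_fun (Suc n) x)"
      unfolding hermite_normal_gauss_deriv
      by (rule arg_cong[where f="L2_inner w"]) (simp add: fun_eq_iff gauss_poly_diff gauss_poly_smult hermite_fun_gauss_poly)
    also have "\<dots> = sqrt (real n / 2) * ?c (n - 1) - sqrt ((real n + 1) / 2) * ?c (Suc n)"
    proof -
      have "L2_inner (\<lambda>x. sqrt (real n / 2) * hermite_fun (n - 1) x - sqrt ((real n + 1) / 2) * hermite_fun (Suc n) x) w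
        = L2_inner (\<lambda>x. sqrt (real n / 2) * hermite_fun (n - 1) x) w - L2_inner (\<lambda>x. sqrt ((real n + 1) / 2) * hermite_fun (Suc n) x) w"
        using w by (intro L2_inner_diff_left L2_space_scale) auto
      then show ?thesis unfolding L2_inner_scale_left by (simp only: L2_inner_commute[of _ w])
    qed
    finally have I: "L2_inner w (gauss_poly 1 (gauss_deriv 1 (hermite_normal n))) = sqrt (real n / 2) * ?c (n - 1) - sqrt ((real n + 1) / 2) * ?c (Suc n)" .
    have "L2_inner w1 (hermite_fun n) = - \<beta> * (sqrt (real n / 2) * ?c (n - 1) - sqrt ((real n + 1) / 2) * ?c (Suc n))"
      using wd[of "hermite_normal n"] unfolding I by (simp only: hermite_fun_gauss_poly)
    then show ?thesis by (simp add: algebra_simps)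
  qed
  have dp: "deriv (hermite_proj N w) x = (\<Sum>n<N. ?c n * deriv (hermite_fun n) x)" for N
  proof (rule DERIV_imp_deriv)
    show "(hermite_proj N w has_real_derivative (\<Sum>n<N. ?c n * deriv (hermite_fun n) x)) (at x)"
      unfolding hermite_proj_def[abs_def] by (intro DERIV_sum DERIV_cmult hermite_fun_has_derivative)
  qed
  show ?thesis
  \<comment> \<open>The sums telescope: each step cancels the boundary pair at N and creates the one
    at \<open>Suc N\<close>.\<close>
  proof (induction N)
    case 0
    then show ?case by (simp add: dp) (simp add: hermite_proj_def)
  next
    case (Suc N)
    have "hermite_proj (Suc N) w1 x - \<beta> * deriv (hermite_proj (Suc N) w) x
      = (hermite_proj N w1 x - \<beta> * deriv (hermite_proj N w) x) + (L2_inner w1 (hermite_fun N) * hermite_fun N x - \<beta> * (?c N * deriv (hermite_fun N) x))"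
      unfolding dp by (simp add: hermite_proj_def algebra_simps)
    also have "\<dots> = \<beta> * sqrt ((real N + 1) / 2) * (?c (Suc N) * hermite_fun N x + ?c N * hermite_fun (Suc N) x)"
      unfolding Suc.IH d hermite_fun_deriv by (simp add: algebra_simps)
    finally show ?case by (simp add: add.commute)
  qed
qed

text \<open>The boundary coefficients have indices N and N + 1, so both are controlled by the
  residual of \<open>hermite_proj N\<close>. For this reason the bound is in terms of
  \<open>hermite_proj N\<close> although the projection itself is
  \<open>hermite_proj (Suc N)\<close>.\<close>

lemma hermite_proj_deriv_error:
  assumes w: "w \<in> L2_space" and w1: "w1 \<in> L2_space" and \<beta>: "\<beta> > 0" and N: "N \<ge> 1"
    and wd: "\<And>p. L2_inner w1 (gauss_poly 1 p) = - \<beta> * L2_inner w (gauss_poly 1 (gauss_deriv 1 p))"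
  shows "L2_norm (\<lambda>x. w1 x - \<beta> * deriv (hermite_proj (Suc N) w) x)
    \<le> L2_norm (\<lambda>x. w1 x - hermite_proj N w1 x) + 2 * \<beta> * sqrt (real N) * L2_norm (\<lambda>x. w x - hermite_proj N w x)"
proof -
  let ?r = "L2_norm (\<lambda>x. w x - hermite_proj N w x)" and ?s = "\<beta> * sqrt ((real N + 1) / 2)"
  let ?c = "\<lambda>n. L2_inner w (hermite_fun n)"
  let ?g = "\<lambda>x. ?c (Suc N) * hermite_fun N x + ?c N * hermite_fun (Suc N) x"
  have g: "?g \<in> L2_space" by (intro L2_space_add L2_space_scale hermite_fun_L2)
  have "L2_norm ?g \<le> L2_norm (\<lambda>x. ?c (Suc N) * hermite_fun N x) + L2_norm (\<lambda>x. ?c N * hermite_fun (Suc N) x)"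
    by (intro L2_norm_triangle L2_space_scale hermite_fun_L2)
  also have "\<dots> = \<bar>?c (Suc N)\<bar> + \<bar>?c N\<bar>" by (simp add: L2_norm_scale L2_norm_hermite_fun)
  also have "\<dots> \<le> 2 * ?r" using hermite_coeff_bound[OF w, of N "Suc N"] hermite_coeff_bound[OF w, of N N] by simp
  finally have gn: "L2_norm ?g \<le> 2 * ?r" .
  have "(\<lambda>x. w1 x - \<beta> * deriv (hermite_proj (Suc N) w) x) = (\<lambda>x. (w1 x - hermite_proj (Suc N) w1 x) + ?s * ?g x)"
    using hermite_proj_deriv_commutator[OF w w1 wd, of "Suc N"] by (auto simp: fun_eq_iff algebra_simps add.commute)
  then have "L2_norm (\<lambda>x. w1 x - \<beta> * deriv (hermite_proj (Suc N) w) x) \<le> L2_norm (\<lambda>x. w1 x - hermite_proj (Suc N) w1 x) + L2_norm (\<lambda>x. ?s * ?g x)"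
    using w1 g by (simp only: L2_norm_triangle L2_space_diff hermite_proj_L2 L2_space_scale)
  also have "\<dots> \<le> L2_norm (\<lambda>x. w1 x - hermite_proj N w1 x) + (\<beta> * sqrt (real N)) * (2 * ?r)"
  proof (intro add_mono hermite_proj_residual_mono w1)
    have "sqrt ((real N + 1) / 2) \<le> sqrt (real N)" using N by (intro real_sqrt_le_mono) auto
    then have "?s \<le> \<beta> * sqrt (real N)" using \<beta> by (intro mult_left_mono) auto
    then have "?s * L2_norm ?g \<le> (\<beta> * sqrt (real N)) * (2 * ?r)" using gn \<beta> by (intro mult_mono) auto
    then show "L2_norm (\<lambda>x. ?s * ?g x) \<le> (\<beta> * sqrt (real N)) * (2 * ?r)"
      unfolding L2_norm_scale using \<beta> by simp
  qed
  finally show ?thesis by (simp add: mult_ac)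
qed

text \<open>On [z, z + \<delta>) the value D z differs from D t by an integral of D1, estimated by
  Cauchy-Schwarz. After averaging over t the sum over z costs nothing, since the gap makes the
  intervals disjoint. \<kappa> carries the factor of a dilation.\<close>

lemma node_sum_bound:
  fixes D D1 :: "real \<Rightarrow> real"
  assumes Z: "finite Z" and gap: "\<And>a b. a \<in> Z \<Longrightarrow> b \<in> Z \<Longrightarrow> a < b \<Longrightarrow> \<delta> \<le> b - a" and \<delta>: "\<delta> > 0"
    and D: "D \<in> L2_space" and D1: "D1 \<in> L2_space"
    and ftc: "\<And>a b. a \<le> b \<Longrightarrow> D b - D a = \<kappa> * (LINT x|lborel. D1 x * indicator {a..b} x)"
  shows "\<delta> * (\<Sum>z\<in>Z. (D z)^2) \<le> 2 * (L2_norm D)^2 + 2 * \<kappa>^2 * \<delta>^2 * (L2_norm D1)^2"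
proof -
  let ?J = "\<lambda>z. {z..<z + \<delta>}" and ?I = "\<lambda>f z. LINT x|lborel. (f x)^2 * indicator {z..<z + \<delta>} x"
  have i: "integrable lborel (\<lambda>x. (f x)^2 * indicator (?J z) x)" if "f \<in> L2_space" for f z
    by (rule Bochner_Integration.integrable_bound[OF L2_space_integrable[OF that]])
       (use L2_space_measurable[OF that] in \<open>auto simp: indicator_def\<close>)
  have one: "\<delta> * (D z)^2 \<le> 2 * ?I D z + 2 * \<kappa>^2 * \<delta>^2 * ?I D1 z" for z
  proof -
    have pt: "(D z)^2 \<le> 2 * (D t)^2 + 2 * \<kappa>^2 * (\<delta> * ?I D1 z)" if t: "t \<in> ?J z" for t
    proof -
      have Iz: "indicator {z..t} \<in> L2_space" "(L2_norm (indicator {z..t}))^2 = t - z"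
      proof -
        have "(indicator {z..t} x :: real)^2 = indicator {z..t} x" for x by (simp add: indicator_def)
        then show "indicator {z..t} \<in> L2_space" "(L2_norm (indicator {z..t}))^2 = t - z"
          using integrable_indicator_Icc[of z t] t by (simp_all add: L2_space_def L2_norm_squared)
      qed
      let ?D1 = "\<lambda>x. D1 x * indicator (?J z) x"
      have D1J: "?D1 \<in> L2_space" using D1 by (intro L2_space_indicator) auto
      have "(LINT x|lborel. D1 x * indicator {z..t} x) = L2_inner ?D1 (indicator {z..t})"
        unfolding L2_inner_def using t by (intro Bochner_Integration.integral_cong) (auto simp: indicator_def)
      then have "\<bar>LINT x|lborel. D1 x * indicator {z..t} x\<bar> \<le> L2_norm ?D1 * L2_norm (indicator {z..t})"
        using L2_cauchy_schwarz[OF D1J Iz(1)] by simp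
      then have "(LINT x|lborel. D1 x * indicator {z..t} x)^2 \<le> (L2_norm ?D1 * L2_norm (indicator {z..t}))^2"
        by (simp add: abs_le_square_iff[symmetric] abs_mult)
      also have "\<dots> = (L2_norm ?D1)^2 * (t - z)" by (simp only: power_mult_distrib Iz(2))
      also have "(L2_norm ?D1)^2 = ?I D1 z"
        unfolding L2_norm_squared by (intro Bochner_Integration.integral_cong) (auto simp: indicator_def)
      also have "?I D1 z * (t - z) \<le> ?I D1 z * \<delta>"
        using t by (intro mult_left_mono Bochner_Integration.integral_nonneg) auto
      finally have q: "(LINT x|lborel. D1 x * indicator {z..t} x)^2 \<le> \<delta> * ?I D1 z" by (simp only: mult.commute)
      have "D z = D t - \<kappa> * (LINT x|lborel. D1 x * indicator {z..t} x)" using ftc[of z t] t by simp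
      then have "(D z)^2 \<le> 2 * (D t)^2 + 2 * (\<kappa> * (LINT x|lborel. D1 x * indicator {z..t} x))^2"
        using zero_le_power2[of "D t + \<kappa> * (LINT x|lborel. D1 x * indicator {z..t} x)"]
        by (simp add: power2_diff power2_sum)
      also have "\<dots> \<le> 2 * (D t)^2 + 2 * (\<kappa>^2 * (\<delta> * ?I D1 z))"
        unfolding power_mult_distrib using q by (intro add_left_mono mult_left_mono) auto
      finally show ?thesis by simp
    qed
    have ij: "integrable lborel (\<lambda>x. c * indicator (?J z) x :: real)" for c
      using \<delta> by (intro integrable_mult_right integrable_real_indicator) (auto simp: emeasure_lborel_Ico)
    have lj: "(LINT x|lborel. c * indicator (?J z) x) = c * \<delta>" for c :: real
      using \<delta> by (simp add: measure_def)
    have "(D z)^2 * \<delta> = (LINT x|lborel. (D z)^2 * indicator (?J z) x)" by (rule lj[symmetric])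
    also have "\<dots> \<le> (LINT x|lborel. 2 * ((D x)^2 * indicator (?J z) x) + (2 * \<kappa>^2 * (\<delta> * ?I D1 z)) * indicator (?J z) x)"
    proof (rule integral_mono[OF ij])
      show "integrable lborel (\<lambda>x. 2 * ((D x)^2 * indicator (?J z) x) + (2 * \<kappa>^2 * (\<delta> * ?I D1 z)) * indicator (?J z) x)"
        by (intro Bochner_Integration.integrable_add integrable_mult_right[OF i[OF D]] ij)
      show "(D z)^2 * indicator (?J z) x \<le> 2 * ((D x)^2 * indicator (?J z) x) + (2 * \<kappa>^2 * (\<delta> * ?I D1 z)) * indicator (?J z) x" for x
      proof (cases "x \<in> ?J z")
        case True then show ?thesis using pt[OF True] by simp
      qed simp
    qed
    also have "\<dots> = 2 * ?I D z + (2 * \<kappa>^2 * (\<delta> * ?I D1 z)) * \<delta>"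
      using i[OF D, of z] ij[of "2 * \<kappa>^2 * (\<delta> * ?I D1 z)"] lj[of "2 * \<kappa>^2 * (\<delta> * ?I D1 z)"] by simp
    finally show ?thesis by (simp add: power2_eq_square mult_ac)
  qed
  have s: "(\<Sum>z\<in>Z. ?I f z) \<le> (L2_norm f)^2" if f: "f \<in> L2_space" for f
  proof -
    have disj: "(\<Sum>z\<in>Z. indicator (?J z) x :: real) \<le> 1" for x
    proof (cases "\<exists>z\<in>Z. x \<in> ?J z")
      case True
      then obtain z where z: "z \<in> Z" "x \<in> ?J z" by blast
      have "indicator (?J y) x = (if y = z then 1 else 0 :: real)" if "y \<in> Z" for y
      proof -
        have "x \<notin> ?J y" if "y \<noteq> z"
          using gap[OF \<open>y \<in> Z\<close> z(1)] gap[OF z(1) \<open>y \<in> Z\<close>] z(2) that by (cases y z rule: linorder_cases) auto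
        then show ?thesis using z by (auto simp: indicator_def)
      qed
      then have "(\<Sum>y\<in>Z. indicator (?J y) x :: real) = (\<Sum>y\<in>Z. if y = z then 1 else 0)" by (intro sum.cong) auto
      also have "\<dots> = 1" using Z z(1) by simp
      finally show ?thesis by simp
    next
      case False
      then have "(\<Sum>z\<in>Z. indicator (?J z) x :: real) = 0" by (intro sum.neutral) auto
      then show ?thesis by simp
    qed
    have "(\<Sum>z\<in>Z. ?I f z) = (LINT x|lborel. (\<Sum>z\<in>Z. (f x)^2 * indicator (?J z) x))"
      by (intro Bochner_Integration.integral_sum[symmetric] i f)
    also have "\<dots> \<le> (LINT x|lborel. (f x)^2)"
    proof (rule integral_mono)
      show "integrable lborel (\<lambda>x. \<Sum>z\<in>Z. (f x)^2 * indicator (?J z) x)"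
        by (intro Bochner_Integration.integrable_sum i f)
      show "(\<Sum>z\<in>Z. (f x)^2 * indicator (?J z) x) \<le> (f x)^2" for x
        using mult_left_mono[OF disj[of x], of "(f x)^2"] by (simp add: sum_distrib_left)
    qed (rule L2_space_integrable[OF f])
    finally show ?thesis by (simp add: L2_norm_squared)
  qed
  have "\<delta> * (\<Sum>z\<in>Z. (D z)^2) = (\<Sum>z\<in>Z. \<delta> * (D z)^2)" by (rule sum_distrib_left)
  also have "\<dots> \<le> (\<Sum>z\<in>Z. 2 * ?I D z + 2 * \<kappa>^2 * \<delta>^2 * ?I D1 z)" by (intro sum_mono one)
  also have "\<dots> = 2 * (\<Sum>z\<in>Z. ?I D z) + 2 * \<kappa>^2 * \<delta>^2 * (\<Sum>z\<in>Z. ?I D1 z)"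
    by (simp only: sum.distrib sum_distrib_left)
  also have "\<dots> \<le> 2 * (L2_norm D)^2 + 2 * \<kappa>^2 * \<delta>^2 * (L2_norm D1)^2"
    by (intro add_mono mult_left_mono s D D1) auto
  finally show ?thesis .
qed

(* The largest quadrature weight (of order N^(-1/6), attained at the turning points) is paired with
   the smallest gap between nodes (of order N^(-1/2), attained at the origin); this is where the
   exponents 1/6 and -1/3 come from. *)
lemma interpolation_stability:
  fixes D D1 :: "real \<Rightarrow> real"
  assumes N: "N \<ge> 1" and p: "degree p \<le> N" and pD: "\<And>z. z \<in> hermite_zeros (Suc N) \<Longrightarrow> gauss_poly 1 p z = D z"
    and D: "D \<in> L2_space" and D1: "D1 \<in> L2_space" and \<kappa>: "\<kappa> \<ge> 0"
    and ftc: "\<And>a b. a \<le> b \<Longrightarrow> D b - D a = \<kappa> * (LINT x|lborel. D1 x * indicator {a..b} x)"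
  shows "L2_norm (gauss_poly 1 p) \<le> 5 * (real N powr (1/6) * L2_norm D + \<kappa> * real N powr (-1/3) * L2_norm D1)"
proof (rule power2_le_imp_le)
  let ?Z = "hermite_zeros (Suc N)" and ?l = "2 * real (Suc N) + 1"
  define \<delta> where "\<delta> = 1 / sqrt ?l"
  have l: "?l > 0" by simp
  have \<delta>: "\<delta> > 0" "\<delta>^2 = 1 / ?l" unfolding \<delta>_def using l by (auto simp: power_divide)
  have gap: "\<delta> \<le> b - a" if "a \<in> ?Z" "b \<in> ?Z" "a < b" for a b
  proof (rule power2_le_imp_le)
    show "\<delta>^2 \<le> (b - a)^2" unfolding \<delta>(2) using hermite_zero_gap[OF that] l by (simp add: divide_le_eq mult.commute)
  qed (use that in simp)
  have nb: "\<delta> * (\<Sum>z\<in>?Z. (D z)^2) \<le> 2 * (L2_norm D)^2 + 2 * \<kappa>^2 * \<delta>^2 * (L2_norm D1)^2"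
    by (rule node_sum_bound[OF finite_hermite_zeros gap \<delta>(1) D D1 ftc])
  have N0: "real N > 0" using N by simp
  let ?a = "real N powr (1/6)" and ?b = "real N powr (-1/3)"
  have i\<delta>: "1 / \<delta> \<le> 3 * real N powr (1/2)"
  proof -
    have "sqrt ?l \<le> sqrt (3^2 * real N)" using N by (intro real_sqrt_le_mono) simp
    also have "\<dots> = 3 * real N powr (1/2)" by (simp add: real_sqrt_mult powr_half_sqrt)
    finally show ?thesis by (simp add: \<delta>_def)
  qed
  have \<delta>i: "\<delta> \<le> real N powr (-1/2)"
  proof -
    have "1 / sqrt ?l \<le> 1 / sqrt (real N)" using N0 by (intro divide_left_mono real_sqrt_le_mono mult_pos_pos) auto
    also have "\<dots> = real N powr (-1/2)" by (simp add: powr_minus powr_half_sqrt inverse_eq_divide)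
    finally show ?thesis by (simp add: \<delta>_def)
  qed
  have "(\<Sum>z\<in>?Z. (D z)^2) \<le> (2 * (L2_norm D)^2 + 2 * \<kappa>^2 * \<delta>^2 * (L2_norm D1)^2) / \<delta>"
    using nb \<delta>(1) by (simp add: pos_le_divide_eq mult.commute)
  also have "\<dots> = (1 / \<delta>) * (2 * (L2_norm D)^2) + \<delta> * (2 * \<kappa>^2 * (L2_norm D1)^2)"
    using \<delta>(1) by (simp add: field_simps power2_eq_square)
  also have "\<dots> \<le> (3 * real N powr (1/2)) * (2 * (L2_norm D)^2) + real N powr (-1/2) * (2 * \<kappa>^2 * (L2_norm D1)^2)"
    by (intro add_mono mult_right_mono i\<delta> \<delta>i) auto
  finally have S: "(\<Sum>z\<in>?Z. (D z)^2) \<le> 6 * (real N powr (1/2) * (L2_norm D)^2) + 2 * (real N powr (-1/2) * (\<kappa>^2 * (L2_norm D1)^2))"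
    by (simp add: mult_ac)
  have "(L2_norm (gauss_poly 1 p))^2 = (\<Sum>z\<in>?Z. 2 / (deriv (hermite_fun (Suc N)) z)^2 * (gauss_poly 1 p z)^2)"
    unfolding L2_norm_inner using p by (intro hermite_quadrature) simp
  also have "\<dots> \<le> (\<Sum>z\<in>?Z. (4 * real N powr (-1/6)) * (D z)^2)"
  proof (intro sum_mono)
    fix z assume z: "z \<in> ?Z"
    have "2 / (deriv (hermite_fun (Suc N)) z)^2 \<le> 2 * sqrt pi * real (Suc N) powr (-1/6)"
      by (rule hermite_weight_bound[OF z]) simp
    also have "\<dots> \<le> 4 * real N powr (-1/6)"
    proof (intro mult_mono powr_mono2')
      have "sqrt pi \<le> 2" using pi_less_4 by (intro real_le_lsqrt) auto
      then show "2 * sqrt pi \<le> 4" by simp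
    qed (use N0 in auto)
    finally have "2 / (deriv (hermite_fun (Suc N)) z)^2 \<le> 4 * real N powr (-1/6)" .
    then show "2 / (deriv (hermite_fun (Suc N)) z)^2 * (gauss_poly 1 p z)^2 \<le> (4 * real N powr (-1/6)) * (D z)^2"
      unfolding pD[OF z] by (intro mult_right_mono) auto
  qed
  also have "\<dots> = (4 * real N powr (-1/6)) * (\<Sum>z\<in>?Z. (D z)^2)" by (simp add: sum_distrib_left)
  also have "\<dots> \<le> (4 * real N powr (-1/6)) * (6 * (real N powr (1/2) * (L2_norm D)^2) + 2 * (real N powr (-1/2) * (\<kappa>^2 * (L2_norm D1)^2)))"
    by (intro mult_left_mono S) auto
  also have "\<dots> = 24 * ((real N powr (-1/6) * real N powr (1/2)) * (L2_norm D)^2) + 8 * ((real N powr (-1/6) * real N powr (-1/2)) * (\<kappa>^2 * (L2_norm D1)^2))"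
    by (simp add: algebra_simps)
  also have "real N powr (-1/6) * real N powr (1/2) = ?a^2" using N0 by (simp add: powr_power flip: powr_add)
  also have "real N powr (-1/6) * real N powr (-1/2) = ?b^2" using N0 by (simp add: powr_power flip: powr_add)
  also have "24 * (?a^2 * (L2_norm D)^2) + 8 * (?b^2 * (\<kappa>^2 * (L2_norm D1)^2)) = 24 * (?a * L2_norm D)^2 + 8 * (\<kappa> * ?b * L2_norm D1)^2"
    by (simp add: power_mult_distrib mult_ac)
  \<comment> \<open>24 = 4 * 6 and 8 = 4 * 2 are rounded up to 25 = 5^2, so that adding the
    nonnegative cross term completes a square.\<close>
  also have "\<dots> \<le> 25 * (?a * L2_norm D)^2 + 25 * (\<kappa> * ?b * L2_norm D1)^2 + 50 * ((?a * L2_norm D) * (\<kappa> * ?b * L2_norm D1))"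
    using \<kappa> by (intro add_increasing2 add_mono mult_right_mono) auto
  also have "\<dots> = (5 * (?a * L2_norm D + \<kappa> * ?b * L2_norm D1))^2"
    by (simp add: power2_eq_square algebra_simps)
  finally show "(L2_norm (gauss_poly 1 p))^2 \<le> (5 * (?a * L2_norm D + \<kappa> * ?b * L2_norm D1))^2" .
  show "0 \<le> 5 * (?a * L2_norm D + \<kappa> * ?b * L2_norm D1)" using \<kappa> by simp
qed

lemma hermite_interpolant_exists:
  obtains p where "degree p \<le> N" "\<And>z. z \<in> hermite_zeros (Suc N) \<Longrightarrow> gauss_poly 1 p z = F z"
proof -
  let ?Z = "hermite_zeros (Suc N)" and ?d = "deriv (hermite_fun (Suc N))"
  have "\<exists>l. degree l \<le> N \<and> gauss_poly 1 l z = ?d z \<and> (\<forall>y\<in>?Z. y \<noteq> z \<longrightarrow> gauss_poly 1 l y = 0)" if "z \<in> ?Z" for z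
    using hermite_lagrange[OF that] by (metis less_Suc_eq_le)
  then obtain l where l: "\<And>z. z \<in> ?Z \<Longrightarrow> degree (l z) \<le> N \<and> gauss_poly 1 (l z) z = ?d z \<and> (\<forall>y\<in>?Z. y \<noteq> z \<longrightarrow> gauss_poly 1 (l z) y = 0)"
    by metis
  have d: "?d z \<noteq> 0" if "z \<in> ?Z" for z using hermite_fun_simple_zero that by (auto simp: hermite_zeros_def)
  show ?thesis
  proof (rule that[of "\<Sum>z\<in>?Z. smult (F z / ?d z) (l z)"])
    show "degree (\<Sum>z\<in>?Z. smult (F z / ?d z) (l z)) \<le> N"
      using l by (intro degree_sum_le) (auto intro: order_trans[OF degree_smult_le])
    fix x assume x: "x \<in> ?Z"
    have "(\<Sum>z\<in>?Z. F z / ?d z * gauss_poly 1 (l z) x) = (\<Sum>z\<in>?Z. if z = x then F x else 0)"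
      using x l d by (intro sum.cong) auto
    then show "gauss_poly 1 (\<Sum>z\<in>?Z. smult (F z / ?d z) (l z)) x = F x"
      using x by (simp add: gauss_poly_sum gauss_poly_smult)
  qed
qed

lemma gauss_poly_rescale:
  assumes "\<beta> \<noteq> 0"
  shows "gauss_poly 1 p (\<beta> * x) = gauss_poly \<beta> (pcompose p [:0, \<beta>:]) x"
    and "gauss_poly \<beta> p (x / \<beta>) = gauss_poly 1 (pcompose p [:0, 1 / \<beta>:]) x"
  using assms by (simp_all add: gauss_poly_def poly_pcompose power_mult_distrib power_divide mult.commute)

text \<open>\<open>interp_hat\<close> is a \<open>THE\<close>-description. Existence is carried over
  from \<beta> = 1 by dilation; uniqueness holds because a nonzero polynomial of degree at most N
  cannot vanish at N + 1 nodes.\<close>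

lemma interp_hat_spec:
  assumes \<beta>: "\<beta> > 0"
  obtains q where "degree q \<le> N" "\<And>x. interp_hat N \<beta> f (x / \<beta>) = gauss_poly 1 q x"
    "\<And>z. z \<in> hermite_zeros (Suc N) \<Longrightarrow> gauss_poly 1 q z = f (z / \<beta>)" "interp_hat N \<beta> f \<in> P_hat N \<beta>"
proof -
  let ?P = "\<lambda>g. g \<in> P_hat N \<beta> \<and> (\<forall>x. hermite_fun (Suc N) x = 0 \<longrightarrow> g (x / \<beta>) = f (x / \<beta>))"
  obtain q where q: "degree q \<le> N" "\<And>z. z \<in> hermite_zeros (Suc N) \<Longrightarrow> gauss_poly 1 q z = f (z / \<beta>)"
    using hermite_interpolant_exists[of N "\<lambda>z. f (z / \<beta>)"] by blast
  let ?g = "gauss_poly \<beta> (pcompose q [:0, \<beta>:])"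
  have gx: "?g (x / \<beta>) = gauss_poly 1 q x" for x
    using gauss_poly_rescale(1)[of \<beta> q "x / \<beta>"] \<beta> by simp
  have dq: "degree (pcompose q [:0, \<beta>:]) \<le> N" using q(1) \<beta> by (simp add: degree_pcompose)
  have Pg: "?P ?g" using q dq by (auto simp: P_hat_gauss_poly gx hermite_zeros_def)
  have uniq: "g = ?g" if "?P g" for g
  proof -
    obtain p where p: "g = gauss_poly \<beta> p" "degree p \<le> N" using \<open>?P g\<close> by (auto simp: P_hat_gauss_poly)
    have "pcompose p [:0, 1 / \<beta>:] - q = 0"
    proof (rule gauss_poly_zero_at_nodes[where n="Suc N"])
      have "degree (pcompose p [:0, 1 / \<beta>:]) \<le> N" using p(2) \<beta> by (simp add: degree_pcompose)
      then show "degree (pcompose p [:0, 1 / \<beta>:] - q) < Suc N" using q(1) degree_diff_le less_Suc_eq_le by blast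
      fix x assume x: "x \<in> hermite_zeros (Suc N)"
      have "gauss_poly 1 (pcompose p [:0, 1 / \<beta>:]) x = g (x / \<beta>)" using gauss_poly_rescale(2)[of \<beta> p x] p \<beta> by simp
      also have "\<dots> = gauss_poly 1 q x" using \<open>?P g\<close> q(2)[OF x] x by (simp add: hermite_zeros_def)
      finally show "gauss_poly 1 (pcompose p [:0, 1 / \<beta>:] - q) x = 0" by (simp add: gauss_poly_diff)
    qed
    then have "gauss_poly 1 q (\<beta> * x) = g x" for x
      using gauss_poly_rescale(2)[of \<beta> p "\<beta> * x"] p \<beta> by simp
    then show ?thesis using gauss_poly_rescale(1)[of \<beta> q] \<beta> by (simp add: fun_eq_iff)
  qed
  have "interp_hat N \<beta> f = ?g"
    unfolding interp_hat_def by (rule the_equality[of ?P ?g, OF Pg uniq])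
  then show ?thesis using that[of q] q gx Pg by simp
qed

section \<open>Dilations: reduction to unit scale\<close>

lemma integral_rescale:
  fixes g :: "real \<Rightarrow> 'a :: {banach, second_countable_topology}"
  assumes "\<beta> > 0"
  shows "(LINT x|lborel. g (x / \<beta>)) = \<beta> *\<^sub>R (LINT x|lborel. g x)"
  using lborel_integral_real_affine[of "\<beta>" "\<lambda>x. g (x / \<beta>)" 0] assms by simp

lemma L2_rescale:
  assumes \<beta>: "\<beta> > 0"
  shows L2_space_rescale: "w \<in> L2_space \<Longrightarrow> (\<lambda>x. w (x / \<beta>)) \<in> L2_space"
    and L2_inner_rescale: "L2_inner (\<lambda>x. v (x / \<beta>)) (\<lambda>x. w (x / \<beta>)) = \<beta> * L2_inner v w"
    and L2_norm_rescale: "L2_norm (\<lambda>x. w (x / \<beta>)) = sqrt \<beta> * L2_norm w"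
proof -
  show "(\<lambda>x. w (x / \<beta>)) \<in> L2_space" if "w \<in> L2_space"
  proof -
    have [measurable]: "w \<in> borel_measurable borel" using that by (rule L2_space_measurable)
    have "integrable lborel (\<lambda>x. (w (0 + (1 / \<beta>) * x))^2)"
      using L2_space_integrable[OF that] \<beta> by (intro lborel_integrable_real_affine[where f="\<lambda>x. (w x)^2"]) auto
    then show ?thesis by (simp add: L2_space_def)
  qed
  show "L2_inner (\<lambda>x. v (x / \<beta>)) (\<lambda>x. w (x / \<beta>)) = \<beta> * L2_inner v w"
    unfolding L2_inner_def using integral_rescale[OF \<beta>, of "\<lambda>x. v x * w x"] by simp
  show "L2_norm (\<lambda>x. w (x / \<beta>)) = sqrt \<beta> * L2_norm w"
    unfolding L2_norm_def using integral_rescale[OF \<beta>, of "\<lambda>x. (w x)^2"] by (simp add: real_sqrt_mult)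
qed

text \<open>The dilation acts on truncated Fourier integrals by replacing R with R / \<beta>, which
  the limit over R does not see.\<close>

lemma fourier_tail_norm_rescale:
  assumes w: "w \<in> L2_space" and \<beta>: "\<beta> > 0"
  shows "fourier_tail_norm (\<lambda>x. w (x / \<beta>)) K = sqrt \<beta> * fourier_tail_norm w (K * \<beta>)"
proof -
  let ?T = "\<lambda>w K R. L2_norm_c (\<lambda>k. complex_of_real (indicator {k. \<bar>k\<bar> > K} k) * fourier_int (\<lambda>x. w x * indicator {-R..R} x) k)"
  have T: "?T (\<lambda>x. w (x / \<beta>)) K R = sqrt \<beta> * ?T w (K * \<beta>) (R / \<beta>)" for R
  proof -
    have F: "fourier_int (\<lambda>x. w (x / \<beta>) * indicator {-R..R} x) k = complex_of_real \<beta> * fourier_int (\<lambda>x. w x * indicator {-(R / \<beta>)..R / \<beta>} x) (\<beta> * k)" for k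
    proof -
      let ?g = "\<lambda>x. complex_of_real (w x * indicator {-(R / \<beta>)..R / \<beta>} x) * cis (- (\<beta> * k) * x)"
      have "complex_of_real (w (x / \<beta>) * indicator {-R..R} x) * cis (- k * x) = ?g (x / \<beta>)" for x
        using \<beta> by (auto simp: indicator_def field_simps)
      then have "(LINT x|lborel. complex_of_real (w (x / \<beta>) * indicator {-R..R} x) * cis (- k * x)) = (LINT x|lborel. ?g (x / \<beta>))"
        by (intro Bochner_Integration.integral_cong refl)
      also have "\<dots> = \<beta> *\<^sub>R (LINT x|lborel. ?g x)" by (rule integral_rescale[OF \<beta>])
      finally show ?thesis
        unfolding fourier_int_def by (simp only: scaleR_conv_of_real mult.left_commute)
    qed
    let ?h = "\<lambda>k. (cmod (complex_of_real (indicator {k. \<bar>k\<bar> > K * \<beta>} k) * fourier_int (\<lambda>x. w x * indicator {-(R / \<beta>)..R / \<beta>} x) k))^2"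
    have "(cmod (complex_of_real (indicator {k. \<bar>k\<bar> > K} k) * fourier_int (\<lambda>x. w (x / \<beta>) * indicator {-R..R} x) k))^2 = \<beta>^2 * ?h (k / (1 / \<beta>))" for k
      unfolding F using \<beta> by (auto simp: indicator_def norm_mult power_mult_distrib field_simps abs_mult)
    then have "(LINT k|lborel. (cmod (complex_of_real (indicator {k. \<bar>k\<bar> > K} k) * fourier_int (\<lambda>x. w (x / \<beta>) * indicator {-R..R} x) k))^2)
       = \<beta>^2 * (LINT k|lborel. ?h (k / (1 / \<beta>)))" by (simp only: integral_mult_right_zero)
    also have "(LINT k|lborel. ?h (k / (1 / \<beta>))) = (1 / \<beta>) * (LINT k|lborel. ?h k)"
      using integral_rescale[of "1 / \<beta>" ?h] \<beta> by simp
    also have "\<beta>^2 * ((1 / \<beta>) * (LINT k|lborel. ?h k)) = \<beta> * (LINT k|lborel. ?h k)" using \<beta> by (simp add: power2_eq_square)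
    finally show ?thesis by (simp only: L2_norm_c_def real_sqrt_mult)
  qed
  have "((\<lambda>R. ?T (\<lambda>x. w (x / \<beta>)) K R) \<longlongrightarrow> fourier_tail_norm (\<lambda>x. w (x / \<beta>)) K) at_top"
    by (rule fourier_tail_norm_tendsto[OF L2_space_rescale[OF \<beta> w]])
  moreover have "((\<lambda>R. sqrt \<beta> * ?T w (K * \<beta>) (R / \<beta>)) \<longlongrightarrow> sqrt \<beta> * fourier_tail_norm w (K * \<beta>)) at_top"
  proof (intro tendsto_mult_left filterlim_compose[OF fourier_tail_norm_tendsto[OF w]])
    show "filterlim (\<lambda>R. R / \<beta>) at_top at_top" using \<beta> by real_asymp
  qed
  ultimately show ?thesis unfolding T by (intro tendsto_unique[OF trivial_limit_at_top_linorder])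
qed

text \<open>The spatial cutoff scales by 1 / \<beta> and the frequency cutoff by \<beta>, exactly as
  the dilation requires. The common factor sqrt \<beta> later cancels against the one in the
  norms.\<close>

lemma E_err_rescale:
  assumes w: "w \<in> L2_space" and \<beta>: "\<beta> > 0"
  shows "E_err N 1 (\<lambda>x. w (x / \<beta>)) = sqrt \<beta> * E_err N \<beta> w"
proof -
  let ?M = "1 / (2 * sqrt 2) * sqrt (real N)"
  have "(\<lambda>x. w (x / \<beta>) * indicator {x. \<bar>x\<bar> > ?M / 1} x) = (\<lambda>x. (\<lambda>x. w x * indicator {x. \<bar>x\<bar> > ?M / \<beta>} x) (x / \<beta>))"
    using \<beta> by (auto simp: fun_eq_iff indicator_def field_simps)
  then have "L2_norm (\<lambda>x. w (x / \<beta>) * indicator {x. \<bar>x\<bar> > ?M / 1} x) = sqrt \<beta> * L2_norm (\<lambda>x. w x * indicator {x. \<bar>x\<bar> > ?M / \<beta>} x)"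
    using L2_norm_rescale[OF \<beta>] by simp
  then show ?thesis
    unfolding E_err_def fourier_tail_norm_rescale[OF assms] L2_norm_rescale[OF \<beta>] by (simp add: algebra_simps)
qed

lemma E_err_nonneg: "w \<in> L2_space \<Longrightarrow> 0 \<le> E_err N \<beta> w"
  unfolding E_err_def by (intro add_nonneg_nonneg mult_nonneg_nonneg fourier_tail_norm_nonneg) auto

section \<open>The Galerkin approximation\<close>

text \<open>The chain rule for weak derivatives, tested on weighted polynomials; \<beta> is placed
  so that this matches the hypothesis \<open>wd\<close> of the derivative estimates at unit
  scale.\<close>

lemma weak_deriv_rescaled:
  assumes w: "w \<in> L2_space" and g: "g \<in> L2_space" and wd: "weak_deriv w g" and \<beta>: "\<beta> > 0"
  shows "L2_inner (\<lambda>x. g (x / \<beta>)) (gauss_poly 1 p) = - \<beta> * L2_inner (\<lambda>x. w (x / \<beta>)) (gauss_poly 1 (gauss_deriv 1 p))"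
proof -
  let ?q = "pcompose p [:0, \<beta>:]"
  have b: "\<beta> \<noteq> 0" using \<beta> by simp
  have s: "gauss_poly 1 p x = gauss_poly \<beta> ?q (x / \<beta>)" for x
    using gauss_poly_rescale(1)[OF b, of p "x / \<beta>"] b by simp
  have d: "\<beta> * gauss_poly 1 (gauss_deriv 1 p) x = gauss_poly \<beta> (gauss_deriv \<beta> ?q) (x / \<beta>)" for x
  proof -
    have "((\<lambda>x. gauss_poly 1 p (\<beta> * x)) has_real_derivative gauss_poly 1 (gauss_deriv 1 p) (\<beta> * (x / \<beta>)) * \<beta>) (at (x / \<beta>))"
      by (rule DERIV_chain2[OF gauss_poly_has_derivative]) (auto intro!: derivative_eq_intros)
    moreover have "(\<lambda>x. gauss_poly 1 p (\<beta> * x)) = gauss_poly \<beta> ?q"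
      using gauss_poly_rescale(1)[OF b] by auto
    ultimately have "gauss_poly 1 (gauss_deriv 1 p) (\<beta> * (x / \<beta>)) * \<beta> = gauss_poly \<beta> (gauss_deriv \<beta> ?q) (x / \<beta>)"
      using gauss_poly_has_derivative DERIV_unique by metis
    then show ?thesis using b by (simp add: mult.commute)
  qed
  have "L2_inner (\<lambda>x. g (x / \<beta>)) (gauss_poly 1 p) = \<beta> * L2_inner g (gauss_poly \<beta> ?q)"
    using L2_inner_rescale[OF \<beta>, of g "gauss_poly \<beta> ?q"] by (simp flip: s)
  also have "L2_inner g (gauss_poly \<beta> ?q) = - L2_inner w (gauss_poly \<beta> (gauss_deriv \<beta> ?q))"
    using weak_deriv_gauss_poly[OF w g wd b, of ?q] by simp
  also have "\<beta> * - L2_inner w (gauss_poly \<beta> (gauss_deriv \<beta> ?q)) = - L2_inner (\<lambda>x. w (x / \<beta>)) (\<lambda>x. \<beta> * gauss_poly 1 (gauss_deriv 1 p) x)"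
    unfolding d L2_inner_rescale[OF \<beta>] by simp
  finally show ?thesis by (simp only: L2_inner_scale_right mult_minus_left)
qed

text \<open>The L2 projection onto \<open>P_hat N \<beta>\<close>, obtained by conjugating the one
  at unit scale with the dilation; \<open>Suc N\<close> because degree N is included.\<close>

definition scaled_proj :: "nat \<Rightarrow> real \<Rightarrow> (real \<Rightarrow> real) \<Rightarrow> real \<Rightarrow> real" where
  "scaled_proj N \<beta> w x = hermite_proj (Suc N) (\<lambda>x. w (x / \<beta>)) (\<beta> * x)"

lemma scaled_proj_gauss_poly:
  assumes "\<beta> \<noteq> 0"
  shows "scaled_proj N \<beta> w = gauss_poly \<beta> (pcompose (proj_poly (Suc N) (\<lambda>x. w (x / \<beta>))) [:0, \<beta>:])"
  by (simp add: fun_eq_iff scaled_proj_def hermite_proj_gauss_poly gauss_poly_rescale(1)[OF assms])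

lemma scaled_proj_P_hat: "\<beta> \<noteq> 0 \<Longrightarrow> scaled_proj N \<beta> w \<in> P_hat N \<beta>"
  by (auto simp: P_hat_gauss_poly scaled_proj_gauss_poly degree_pcompose intro!: exI degree_proj_poly)

lemma deriv_scaled_proj:
  "deriv (scaled_proj N \<beta> w) x = \<beta> * deriv (hermite_proj (Suc N) (\<lambda>x. w (x / \<beta>))) (\<beta> * x)"
proof (rule DERIV_imp_deriv)
  let ?h = "hermite_proj (Suc N) (\<lambda>x. w (x / \<beta>))"
  have h: "(?h has_real_derivative deriv ?h y) (at y)" for y
    unfolding hermite_proj_gauss_poly deriv_gauss_poly by (rule gauss_poly_has_derivative)
  have "((\<lambda>x. ?h (\<beta> * x)) has_real_derivative deriv ?h (\<beta> * x) * \<beta>) (at x)"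
    by (rule DERIV_chain2[OF h]) (auto intro!: derivative_eq_intros)
  then show "(scaled_proj N \<beta> w has_real_derivative \<beta> * deriv ?h (\<beta> * x)) (at x)"
    by (simp add: scaled_proj_def[abs_def] mult.commute)
qed

lemma P_hat_L2: "\<beta> \<noteq> 0 \<Longrightarrow> v \<in> P_hat N \<beta> \<Longrightarrow> v \<in> L2_space"
  and P_hat_deriv_L2: "\<beta> \<noteq> 0 \<Longrightarrow> v \<in> P_hat N \<beta> \<Longrightarrow> deriv v \<in> L2_space"
  by (auto simp: P_hat_gauss_poly deriv_gauss_poly)

lemma P_hat_diff:
  assumes "v \<in> P_hat N \<beta>" "w \<in> P_hat N \<beta>"
  shows "(\<lambda>x. v x - w x) \<in> P_hat N \<beta>" "deriv (\<lambda>x. v x - w x) = (\<lambda>x. deriv v x - deriv w x)"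
proof -
  obtain p q where pq: "v = gauss_poly \<beta> p" "w = gauss_poly \<beta> q" "degree p \<le> N" "degree q \<le> N"
    using assms by (auto simp: P_hat_gauss_poly)
  have e: "(\<lambda>x. v x - w x) = gauss_poly \<beta> (p - q)" by (simp add: pq fun_eq_iff gauss_poly_diff)
  show "(\<lambda>x. v x - w x) \<in> P_hat N \<beta>" unfolding e P_hat_gauss_poly using degree_diff_le[OF pq(3,4)] by auto
  show "deriv (\<lambda>x. v x - w x) = (\<lambda>x. deriv v x - deriv w x)"
    unfolding e unfolding pq deriv_gauss_poly by (simp add: fun_eq_iff gauss_deriv_diff gauss_poly_diff)
qed

lemma L2_norm_scaled_residual:
  assumes "\<beta> > 0"
  shows "sqrt \<beta> * L2_norm (\<lambda>x. w x - scaled_proj N \<beta> w x) = L2_norm (\<lambda>x. w (x / \<beta>) - hermite_proj (Suc N) (\<lambda>x. w (x / \<beta>)) x)"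
    and "sqrt \<beta> * L2_norm (\<lambda>x. w1 x - deriv (scaled_proj N \<beta> w) x)
      = L2_norm (\<lambda>x. w1 (x / \<beta>) - \<beta> * deriv (hermite_proj (Suc N) (\<lambda>x. w (x / \<beta>))) x)"
  using L2_norm_rescale[OF assms, of "\<lambda>x. w x - scaled_proj N \<beta> w x"]
    L2_norm_rescale[OF assms, of "\<lambda>x. w1 x - deriv (scaled_proj N \<beta> w) x"] assms
  by (simp_all add: scaled_proj_def deriv_scaled_proj)

lemma scaled_approximation:
  obtains C :: real where "C \<ge> 0"
    "\<And>w N \<beta>. w \<in> L2_space \<Longrightarrow> N \<ge> 1 \<Longrightarrow> \<beta> > 0 \<Longrightarrow> L2_norm (\<lambda>x. w x - scaled_proj N \<beta> w x) \<le> C * E_err N \<beta> w"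
    "\<And>w w1 N \<beta>. H1_with w w1 \<Longrightarrow> N \<ge> 1 \<Longrightarrow> \<beta> > 0 \<Longrightarrow>
      L2_norm (\<lambda>x. w1 x - deriv (scaled_proj N \<beta> w) x) \<le> C * E_err N \<beta> w1 + 2 * \<beta> * sqrt (real N) * (C * E_err N \<beta> w)"
proof -
  obtain C :: real where C: "C \<ge> 0"
    "\<And>w N. w \<in> L2_space \<Longrightarrow> N \<ge> 1 \<Longrightarrow> L2_norm (\<lambda>x. w x - hermite_proj N w x) \<le> C * E_err N 1 w"
    using hermite_approximation by blast
  show ?thesis
  proof (rule that[OF C(1)])
    fix w :: "real \<Rightarrow> real" and N :: nat and \<beta> :: real
    assume w: "w \<in> L2_space" and N: "N \<ge> 1" and \<beta>: "\<beta> > 0"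
    note w' = L2_space_rescale[OF \<beta> w]
    have "sqrt \<beta> * L2_norm (\<lambda>x. w x - scaled_proj N \<beta> w x) \<le> C * E_err N 1 (\<lambda>x. w (x / \<beta>))"
      unfolding L2_norm_scaled_residual(1)[OF \<beta>]
      by (rule order_trans[OF hermite_proj_residual_mono[OF w'] C(2)[OF w' N]])
    also have "\<dots> = sqrt \<beta> * (C * E_err N \<beta> w)" unfolding E_err_rescale[OF w \<beta>] by simp
    finally show "L2_norm (\<lambda>x. w x - scaled_proj N \<beta> w x) \<le> C * E_err N \<beta> w" using \<beta> by simp
  next
    fix w w1 :: "real \<Rightarrow> real" and N :: nat and \<beta> :: real
    assume H1: "H1_with w w1" and N: "N \<ge> 1" and \<beta>: "\<beta> > 0"
    then have w: "w \<in> L2_space" "w1 \<in> L2_space" "weak_deriv w w1" by (auto simp: H1_with_def)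
    note w' = L2_space_rescale[OF \<beta> w(1)] L2_space_rescale[OF \<beta> w(2)]
    have "sqrt \<beta> * L2_norm (\<lambda>x. w1 x - deriv (scaled_proj N \<beta> w) x)
      \<le> L2_norm (\<lambda>x. w1 (x / \<beta>) - hermite_proj N (\<lambda>x. w1 (x / \<beta>)) x)
        + 2 * \<beta> * sqrt (real N) * L2_norm (\<lambda>x. w (x / \<beta>) - hermite_proj N (\<lambda>x. w (x / \<beta>)) x)"
      unfolding L2_norm_scaled_residual(2)[OF \<beta>]
      by (rule hermite_proj_deriv_error[OF w' \<beta> N weak_deriv_rescaled[OF w \<beta>]])
    also have "\<dots> \<le> C * E_err N 1 (\<lambda>x. w1 (x / \<beta>)) + 2 * \<beta> * sqrt (real N) * (C * E_err N 1 (\<lambda>x. w (x / \<beta>)))"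
      using \<beta> by (intro add_mono mult_left_mono C(2) w' N) auto
    also have "\<dots> = sqrt \<beta> * (C * E_err N \<beta> w1 + 2 * \<beta> * sqrt (real N) * (C * E_err N \<beta> w))"
      unfolding E_err_rescale[OF w(1) \<beta>] E_err_rescale[OF w(2) \<beta>] by (simp add: algebra_simps)
    finally show "L2_norm (\<lambda>x. w1 x - deriv (scaled_proj N \<beta> w) x) \<le> C * E_err N \<beta> w1 + 2 * \<beta> * sqrt (real N) * (C * E_err N \<beta> w)"
      using \<beta> by simp
  qed
qed

lemma gauss_poly_FTC:
  assumes "a \<le> b"
  shows "gauss_poly \<beta> p b - gauss_poly \<beta> p a = (LINT x|lborel. gauss_poly \<beta> (gauss_deriv \<beta> p) x * indicator {a..b} x)"
  using integral_FTC_Icc_real[OF assms, of "gauss_poly \<beta> p" "gauss_poly \<beta> (gauss_deriv \<beta> p)"]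
    gauss_poly_has_derivative[of \<beta> p] gauss_poly_continuous[of UNIV \<beta> "gauss_deriv \<beta> p"]
  by (simp add: continuous_on_eq_continuous_at)

text \<open>Interpolation reproduces \<open>P_hat N \<beta>\<close>, so interpolant minus projection
  is the interpolant of the projection error D. Stability applies to D at unit scale, and
  differentiating D (x / \<beta>) gives \<kappa> = 1 / \<beta>.\<close>

lemma interpolation_error:
  assumes H1: "H1_with f f'" and cf: "continuous_on UNIV f" and N: "N \<ge> 1" and \<beta>: "\<beta> > 0"
  shows "L2_norm (\<lambda>x. interp_hat N \<beta> f x - scaled_proj N \<beta> f x)
    \<le> 5 * (real N powr (1/6) * L2_norm (\<lambda>x. f x - scaled_proj N \<beta> f x)
        + 1 / \<beta> * real N powr (-1/3) * L2_norm (\<lambda>x. f' x - deriv (scaled_proj N \<beta> f) x))"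
proof -
  have f: "f \<in> L2_space" "f' \<in> L2_space" "weak_deriv f f'" using H1 by (auto simp: H1_with_def)
  have b: "\<beta> \<noteq> 0" using \<beta> by simp
  let ?W = "scaled_proj N \<beta> f"
  obtain w where w: "?W = gauss_poly \<beta> w" "degree w \<le> N"
    using scaled_proj_P_hat[OF b] by (auto simp: P_hat_gauss_poly)
  have WL: "?W \<in> L2_space" "deriv ?W \<in> L2_space"
    using scaled_proj_P_hat[OF b] P_hat_L2[OF b] P_hat_deriv_L2[OF b] by blast+
  obtain q where q: "degree q \<le> N" "\<And>x. interp_hat N \<beta> f (x / \<beta>) = gauss_poly 1 q x"
    "\<And>z. z \<in> hermite_zeros (Suc N) \<Longrightarrow> gauss_poly 1 q z = f (z / \<beta>)"
    using interp_hat_spec[OF \<beta>] by metis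
  let ?w = "pcompose w [:0, 1 / \<beta>:]"
  define D where "D x = f x - ?W x" for x
  define D1 where "D1 x = f' x - deriv ?W x" for x
  have DL: "D \<in> L2_space" "D1 \<in> L2_space" unfolding D_def[abs_def] D1_def[abs_def] using f WL by auto
  have ftc: "D s - D r = (LINT x|lborel. D1 x * indicator {r..s} x)" if "r \<le> s" for r s
  proof -
    have "D s - D r = (f s - f r) - (?W s - ?W r)" by (simp add: D_def)
    also have "\<dots> = (LINT x|lborel. f' x * indicator {r..s} x) - (LINT x|lborel. deriv ?W x * indicator {r..s} x)"
      using weak_deriv_FTC[OF cf f(2,3) that] gauss_poly_FTC[OF that, of \<beta> w] by (simp add: w deriv_gauss_poly)
    also have "\<dots> = (LINT x|lborel. f' x * indicator {r..s} x - deriv ?W x * indicator {r..s} x)"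
      by (intro Bochner_Integration.integral_diff[symmetric] L2_space_integrable_Icc f WL)
    finally show ?thesis by (simp add: D1_def left_diff_distrib)
  qed
  have "L2_norm (gauss_poly 1 (q - ?w)) \<le> 5 * (real N powr (1/6) * L2_norm (\<lambda>x. D (x / \<beta>)) + (1 / \<beta>) * real N powr (-1/3) * L2_norm (\<lambda>x. D1 (x / \<beta>)))"
  proof (rule interpolation_stability[OF N])
    show "degree (q - ?w) \<le> N" using q(1) w(2) b by (intro degree_diff_le) (auto simp: degree_pcompose)
    show "gauss_poly 1 (q - ?w) z = D (z / \<beta>)" if "z \<in> hermite_zeros (Suc N)" for z
      using q(3)[OF that] by (simp add: gauss_poly_diff D_def w flip: gauss_poly_rescale(2)[OF b])
    show "D (s / \<beta>) - D (r / \<beta>) = 1 / \<beta> * (LINT x|lborel. D1 (x / \<beta>) * indicator {r..s} x)" if "r \<le> s" for r s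
    proof -
      have "(LINT x|lborel. D1 (x / \<beta>) * indicator {r..s} x) = (LINT x|lborel. (\<lambda>x. D1 x * indicator {r / \<beta>..s / \<beta>} x) (x / \<beta>))"
        using \<beta> by (intro Bochner_Integration.integral_cong) (auto simp: indicator_def divide_le_cancel)
      also have "\<dots> = \<beta> * (LINT x|lborel. D1 x * indicator {r / \<beta>..s / \<beta>} x)"
        by (subst integral_rescale[OF \<beta>]) simp
      finally show ?thesis using ftc[of "r / \<beta>" "s / \<beta>"] that \<beta> by (simp add: divide_right_mono)
    qed
  qed (use \<beta> in \<open>auto intro: L2_space_rescale DL\<close>)
  moreover have "gauss_poly 1 (q - ?w) = (\<lambda>x. (\<lambda>x. interp_hat N \<beta> f x - ?W x) (x / \<beta>))"
    by (simp add: fun_eq_iff gauss_poly_diff q(2) w flip: gauss_poly_rescale(2)[OF b])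
  ultimately have "sqrt \<beta> * L2_norm (\<lambda>x. interp_hat N \<beta> f x - ?W x)
      \<le> 5 * (real N powr (1/6) * (sqrt \<beta> * L2_norm D) + (1 / \<beta>) * real N powr (-1/3) * (sqrt \<beta> * L2_norm D1))"
    using L2_norm_rescale[OF \<beta>, of "\<lambda>x. interp_hat N \<beta> f x - ?W x"] L2_norm_rescale[OF \<beta>, of D] L2_norm_rescale[OF \<beta>, of D1] by simp
  also have "\<dots> = sqrt \<beta> * (5 * (real N powr (1/6) * L2_norm D + (1 / \<beta>) * real N powr (-1/3) * L2_norm D1))"
    by (simp add: algebra_simps)
  finally show ?thesis using \<beta> by (simp add: D_def[abs_def] D1_def[abs_def])
qed

text \<open>A Strang-type argument: coercivity with constant min 1 \<gamma> for e = uN - W, with g -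
  f as consistency error. Since e is a Gaussian-weighted polynomial, the equation for u may be
  tested with it by \<open>weak_deriv_gauss_poly\<close>.\<close>

lemma galerkin_quasi_optimality:
  assumes \<gamma>: "\<gamma> > 0" and \<beta>: "\<beta> > 0" and H2: "H2_with u u' u''" and f: "f \<in> L2_space"
    and pde: "AE x in lborel. - u'' x + \<gamma> * u x = f x"
    and uN: "uN \<in> P_hat N \<beta>" and W: "W \<in> P_hat N \<beta>" and g: "g \<in> P_hat N \<beta>"
    and gal: "\<And>v. v \<in> P_hat N \<beta> \<Longrightarrow> L2_inner (deriv uN) (deriv v) + \<gamma> * L2_inner uN v = L2_inner g v"
  shows "H1_norm (\<lambda>x. u x - uN x) (\<lambda>x. u' x - deriv uN x)
    \<le> L2_norm (\<lambda>x. u x - W x) + L2_norm (\<lambda>x. u' x - deriv W x)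
      + 2 / min 1 \<gamma> * (L2_norm (\<lambda>x. g x - f x) + L2_norm (\<lambda>x. u' x - deriv W x) + \<gamma> * L2_norm (\<lambda>x. u x - W x))"
proof -
  have b: "\<beta> \<noteq> 0" using \<beta> by simp
  have u: "u \<in> L2_space" "u' \<in> L2_space" "u'' \<in> L2_space" "weak_deriv u' u''"
    using H2 by (auto simp: H2_with_def H1_with_def)
  note L = P_hat_L2[OF b] P_hat_deriv_L2[OF b]
  define e where "e x = uN x - W x" for x
  have eP: "e \<in> P_hat N \<beta>" and de: "deriv e = (\<lambda>x. deriv uN x - deriv W x)"
    unfolding e_def[abs_def] using P_hat_diff[OF uN W] by auto
  note LL = L(1)[OF uN] L(1)[OF W] L(1)[OF g] L(1)[OF eP] L(2)[OF uN] L(2)[OF W] L(2)[OF eP]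
  let ?a = "\<lambda>v v' w w'. L2_inner v' w' + \<gamma> * L2_inner v w"
  have exact: "?a u u' e (deriv e) = L2_inner f e"
  proof -
    obtain p where p: "e = gauss_poly \<beta> p" using eP by (auto simp: P_hat_gauss_poly)
    have "L2_inner f e = (LINT x|lborel. - (u'' x * e x) + \<gamma> * (u x * e x))"
      unfolding L2_inner_def
    proof (rule integral_cong_AE)
      show "AE x in lborel. f x * e x = - (u'' x * e x) + \<gamma> * (u x * e x)"
        using pde
      proof eventually_elim
        case (elim x)
        then show ?case by (simp add: algebra_simps flip: elim)
      qed
    qed (use f u LL in \<open>auto dest!: L2_space_measurable\<close>)
    also have "\<dots> = - L2_inner u'' e + \<gamma> * L2_inner u e"
      using L2_space_mult_integrable[OF u(3) LL(4)] L2_space_mult_integrable[OF u(1) LL(4)] by (simp add: L2_inner_def)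
    also have "- L2_inner u'' e = L2_inner u' (deriv e)"
      using weak_deriv_gauss_poly[OF u(2,3,4) b, of p] by (simp add: p deriv_gauss_poly)
    finally show ?thesis by simp
  qed
  define A where "A = L2_norm e"
  define B where "B = L2_norm (deriv e)"
  define H where "H = sqrt (A^2 + B^2)"
  define r where "r = L2_norm (\<lambda>x. g x - f x)"
  define \<rho> where "\<rho> = L2_norm (\<lambda>x. u x - W x)"
  define \<rho>' where "\<rho>' = L2_norm (\<lambda>x. u' x - deriv W x)"
  have nn: "0 \<le> A" "0 \<le> B" "0 \<le> r" "0 \<le> \<rho>" "0 \<le> \<rho>'" "0 \<le> H" by (simp_all add: A_def B_def r_def \<rho>_def \<rho>'_def H_def)
  have AH: "A \<le> H" "B \<le> H" unfolding H_def by (auto intro!: real_le_rsqrt)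
  have "?a e (deriv e) e (deriv e) = ?a uN (deriv uN) e (deriv e) - ?a W (deriv W) e (deriv e)"
  proof -
    have e1: "L2_inner e e = L2_inner uN e - L2_inner W e"
      using L2_inner_diff_left[OF LL(1,2,4)] by (simp add: e_def[abs_def])
    have e2: "L2_inner (deriv e) (deriv e) = L2_inner (deriv uN) (deriv e) - L2_inner (deriv W) (deriv e)"
      using L2_inner_diff_left[OF LL(5,6,7)] by (simp flip: de)
    show ?thesis unfolding e1 e2 by (simp add: algebra_simps)
  qed
  also have "\<dots> = (L2_inner g e - L2_inner f e) + (?a u u' e (deriv e) - ?a W (deriv W) e (deriv e))"
    using gal[OF eP] exact by simp
  also have "\<dots> = L2_inner (\<lambda>x. g x - f x) e + (L2_inner (\<lambda>x. u' x - deriv W x) (deriv e) + \<gamma> * L2_inner (\<lambda>x. u x - W x) e)"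
    unfolding L2_inner_diff_left[OF LL(3) f LL(4)] L2_inner_diff_left[OF u(2) LL(6,7)] L2_inner_diff_left[OF u(1) LL(2,4)]
    by (simp add: algebra_simps)
  also have "\<dots> \<le> r * A + (\<rho>' * B + \<gamma> * (\<rho> * A))"
    unfolding r_def A_def B_def \<rho>_def \<rho>'_def
    using L2_cauchy_schwarz[OF L2_space_diff[OF LL(3) f] LL(4)] L2_cauchy_schwarz[OF L2_space_diff[OF u(2) LL(6)] LL(7)]
      L2_cauchy_schwarz[OF L2_space_diff[OF u(1) LL(2)] LL(4)] \<gamma>
    by (intro add_mono mult_left_mono) auto
  also have "\<dots> \<le> r * H + (\<rho>' * H + \<gamma> * (\<rho> * H))"
    using AH nn \<gamma> by (intro add_mono mult_left_mono) auto
  finally have coer: "B^2 + \<gamma> * A^2 \<le> (r + \<rho>' + \<gamma> * \<rho>) * H"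
    by (simp add: A_def B_def L2_norm_inner algebra_simps)
  let ?m = "min 1 \<gamma>"
  have m: "?m > 0" using \<gamma> by simp
  have "?m * H^2 = ?m * B^2 + ?m * A^2" by (simp add: H_def algebra_simps)
  also have "\<dots> \<le> 1 * B^2 + \<gamma> * A^2" by (intro add_mono mult_right_mono) auto
  finally have "(?m * H) * H \<le> (r + \<rho>' + \<gamma> * \<rho>) * H" using coer by (simp add: power2_eq_square)
  then have "?m * H \<le> r + \<rho>' + \<gamma> * \<rho>"
    using nn \<gamma> by (cases "H = 0") (auto simp: less_le)
  then have Hb: "H \<le> 1 / ?m * (r + \<rho>' + \<gamma> * \<rho>)" using m by (simp add: field_simps)
  have t1: "L2_norm (\<lambda>x. u x - uN x) \<le> \<rho> + A"
  proof -
    have "L2_norm (\<lambda>x. u x - uN x) \<le> L2_norm (\<lambda>x. u x - W x) + L2_norm (\<lambda>x. W x - uN x)"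
      by (rule L2_norm_triangle_diff[OF u(1) LL(2,1)])
    then show ?thesis by (simp add: \<rho>_def A_def e_def[abs_def] L2_norm_minus[of W])
  qed
  have t2: "L2_norm (\<lambda>x. u' x - deriv uN x) \<le> \<rho>' + B"
  proof -
    have "L2_norm (\<lambda>x. u' x - deriv uN x) \<le> L2_norm (\<lambda>x. u' x - deriv W x) + L2_norm (\<lambda>x. deriv W x - deriv uN x)"
      by (rule L2_norm_triangle_diff[OF u(2) LL(6,5)])
    then show ?thesis by (simp add: \<rho>'_def B_def de L2_norm_minus[of "deriv W"])
  qed
  have "H1_norm (\<lambda>x. u x - uN x) (\<lambda>x. u' x - deriv uN x) \<le> L2_norm (\<lambda>x. u x - uN x) + L2_norm (\<lambda>x. u' x - deriv uN x)"
    unfolding H1_norm_def by (rule sqrt_sum_squares_le_sum) auto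
  also have "\<dots> \<le> (\<rho> + A) + (\<rho>' + B)" by (intro add_mono t1 t2)
  also have "\<dots> \<le> \<rho> + \<rho>' + 2 * H" using AH by simp
  also have "\<dots> \<le> \<rho> + \<rho>' + 2 * (1 / ?m * (r + \<rho>' + \<gamma> * \<rho>))"
    by (intro add_left_mono mult_left_mono Hb) simp
  finally show ?thesis by (simp add: r_def \<rho>_def \<rho>'_def)
qed

text \<open>Continuity of f selects the representative of the H1 class whose nodal values define the
  interpolant. Weak derivatives are passed as explicit functions because the norms and
  \<open>E_err\<close> refer to them.\<close>

theorem theorem4p1:
  fixes \<gamma> :: real
  assumes "\<gamma> > 0"
  shows "\<exists>C. \<forall>(f::real \<Rightarrow> real) f' u u' u'' (N::nat) (\<beta>::real) uN.
    H1_with f f' \<and> continuous_on UNIV f \<and>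
    H2_with u u' u'' \<and>
    (AE x in lborel. - u'' x + \<gamma> * u x = f x) \<and>
    (u \<longlongrightarrow> 0) at_infinity \<and>
    N \<ge> 1 \<and> \<beta> > 0 \<and>
    uN \<in> P_hat N \<beta> \<and>
    (\<forall>v \<in> P_hat N \<beta>.
        L2_inner (deriv uN) (deriv v) + \<gamma> * L2_inner uN v = L2_inner (interp_hat N \<beta> f) v)
    \<longrightarrow>
    H1_norm (\<lambda>x. u x - uN x) (\<lambda>x. u' x - deriv uN x)
      \<le> C * (E_err N \<beta> u'
             + (1 + \<beta> * sqrt (real N)) * E_err N \<beta> u
             + (1 / \<beta>) * real N powr (-1/3) * E_err N \<beta> f'
             + real N powr (1/6) * E_err N \<beta> f)"
proof -
  obtain C :: real where C0: "C \<ge> 0"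
    and C1: "\<And>w N \<beta>. w \<in> L2_space \<Longrightarrow> N \<ge> 1 \<Longrightarrow> \<beta> > 0 \<Longrightarrow> L2_norm (\<lambda>x. w x - scaled_proj N \<beta> w x) \<le> C * E_err N \<beta> w"
    and C2: "\<And>w w1 N \<beta>. H1_with w w1 \<Longrightarrow> N \<ge> 1 \<Longrightarrow> \<beta> > 0 \<Longrightarrow>
      L2_norm (\<lambda>x. w1 x - deriv (scaled_proj N \<beta> w) x) \<le> C * E_err N \<beta> w1 + 2 * \<beta> * sqrt (real N) * (C * E_err N \<beta> w)"
    using scaled_approximation by blast
  let ?m = "min 1 \<gamma>"
  have m: "?m > 0" using assms by simp
  show ?thesis
  \<comment> \<open>3 collects the projection error of u (1) and of its derivative (2). In 18 +
    \<gamma>, the interpolation error contributes 16, the derivative 2 and the zeroth-order term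
    \<gamma>.\<close>
  proof (intro exI[of _ "C * (3 + 2 / ?m * (18 + \<gamma>))"] allI impI, elim conjE)
    fix f f' u u' u'' :: "real \<Rightarrow> real" and N :: nat and \<beta> :: real and uN :: "real \<Rightarrow> real"
    assume f: "H1_with f f'" "continuous_on UNIV f" and u: "H2_with u u' u''"
      and pde: "AE x in lborel. - u'' x + \<gamma> * u x = f x" and N: "1 \<le> N" and \<beta>: "0 < \<beta>" and uN: "uN \<in> P_hat N \<beta>"
      and gal: "\<forall>v\<in>P_hat N \<beta>. L2_inner (deriv uN) (deriv v) + \<gamma> * L2_inner uN v = L2_inner (interp_hat N \<beta> f) v"
    have b: "\<beta> \<noteq> 0" using \<beta> by simp
    have fL: "f \<in> L2_space" "f' \<in> L2_space" using f by (auto simp: H1_with_def)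
    have uL: "u \<in> L2_space" "u' \<in> L2_space" and u1: "H1_with u u'" using u by (auto simp: H2_with_def H1_with_def)
    let ?E = "E_err N \<beta>" and ?s = "\<beta> * sqrt (real N)" and ?n6 = "real N powr (1/6)" and ?n3 = "real N powr (-1/3)"
    have E: "0 \<le> ?E f" "0 \<le> ?E f'" "0 \<le> ?E u" "0 \<le> ?E u'" using fL uL by (auto intro: E_err_nonneg)
    define G where "G = ?E u' + (1 + ?s) * ?E u + (1 / \<beta>) * ?n3 * ?E f' + ?n6 * ?E f"
    have s0: "0 \<le> ?s" using \<beta> by simp
    have parts: "0 \<le> ?E u'" "0 \<le> ?E u" "0 \<le> ?s * ?E u" "0 \<le> (1 / \<beta>) * ?n3 * ?E f'" "0 \<le> ?n6 * ?E f"
      using E \<beta> by auto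
    have n6: "1 \<le> ?n6" using N by (simp add: ge_one_powr_ge_zero)
    let ?W = "scaled_proj N \<beta> u" and ?V = "scaled_proj N \<beta> f"
    have gP: "interp_hat N \<beta> f \<in> P_hat N \<beta>" using interp_hat_spec[OF \<beta>] by metis
    have \<rho>: "L2_norm (\<lambda>x. u x - ?W x) \<le> C * G"
    proof -
      have "?E u \<le> G" using parts by (simp add: G_def distrib_right)
      then show ?thesis using C1[OF uL(1) N \<beta>] mult_left_mono[OF _ C0] order_trans by blast
    qed
    have \<rho>': "L2_norm (\<lambda>x. u' x - deriv ?W x) \<le> 2 * C * G"
    proof -
      have "?E u' + 2 * (?s * ?E u) \<le> 2 * G" using parts by (simp add: G_def distrib_right)
      from mult_left_mono[OF this C0] C2[OF u1 N \<beta>] show ?thesis by (simp add: algebra_simps)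
    qed
    have r: "L2_norm (\<lambda>x. interp_hat N \<beta> f x - f x) \<le> 16 * C * G"
    proof -
      have D: "L2_norm (\<lambda>x. f x - ?V x) \<le> C * ?E f" by (rule C1[OF fL(1) N \<beta>])
      have D1: "L2_norm (\<lambda>x. f' x - deriv ?V x) \<le> C * ?E f' + 2 * \<beta> * sqrt (real N) * (C * ?E f)" by (rule C2[OF f(1) N \<beta>])
      have "L2_norm (\<lambda>x. interp_hat N \<beta> f x - f x) \<le> L2_norm (\<lambda>x. interp_hat N \<beta> f x - ?V x) + L2_norm (\<lambda>x. ?V x - f x)"
        using P_hat_L2[OF b gP] P_hat_L2[OF b scaled_proj_P_hat[OF b]] fL(1) by (rule L2_norm_triangle_diff)
      also have "\<dots> \<le> 5 * (?n6 * L2_norm (\<lambda>x. f x - ?V x) + 1 / \<beta> * ?n3 * L2_norm (\<lambda>x. f' x - deriv ?V x)) + L2_norm (\<lambda>x. f x - ?V x)"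
        using interpolation_error[OF f N \<beta>] by (simp add: L2_norm_minus[of ?V])
      also have "\<dots> \<le> 5 * (?n6 * (C * ?E f) + 1 / \<beta> * ?n3 * (C * ?E f' + 2 * \<beta> * sqrt (real N) * (C * ?E f))) + ?n6 * (C * ?E f)"
      proof (intro add_mono mult_left_mono D D1)
        have "1 * (C * ?E f) \<le> ?n6 * (C * ?E f)" using n6 C0 E by (intro mult_right_mono) auto
        then show "L2_norm (\<lambda>x. f x - ?V x) \<le> ?n6 * (C * ?E f)" using D by simp
      qed (use \<beta> in auto)
      also have "1 / \<beta> * ?n3 * (C * ?E f' + 2 * \<beta> * sqrt (real N) * (C * ?E f)) = C * ((1 / \<beta>) * ?n3 * ?E f') + 2 * C * (?n6 * ?E f)"
      proof -
        \<comment> \<open>The loss \<beta> sqrt N from differentiating the projection of f meets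
          \<beta>^(-1) N^(-1/3) and leaves N^(1/6), the power already carried by the error of
          f.\<close>
        have "?n3 * sqrt (real N) = ?n6"
        proof -
          have "?n3 * sqrt (real N) = ?n3 * real N powr (1/2)" using N by (simp add: powr_half_sqrt)
          also have "\<dots> = ?n6" by (simp flip: powr_add)
          finally show ?thesis .
        qed
        then have "1 / \<beta> * ?n3 * (2 * \<beta> * sqrt (real N) * (C * ?E f)) = 2 * C * (?n6 * ?E f)"
          using b by (simp add: field_simps)
        then show ?thesis by (simp add: distrib_left mult_ac)
      qed
      \<comment> \<open>16 = 5 + 10 + 1: the direct term, the derivative term and the triangle
        inequality through the projection.\<close>
      also have "5 * (?n6 * (C * ?E f) + (C * ((1 / \<beta>) * ?n3 * ?E f') + 2 * C * (?n6 * ?E f))) + ?n6 * (C * ?E f)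
        = C * (16 * (?n6 * ?E f) + 5 * ((1 / \<beta>) * ?n3 * ?E f'))" by (simp add: algebra_simps)
      also have "\<dots> \<le> C * (16 * G)"
      proof (rule mult_left_mono[OF _ C0])
        have "G = ?E u' + ?E u + ?s * ?E u + (1 / \<beta>) * ?n3 * ?E f' + ?n6 * ?E f" by (simp add: G_def distrib_right)
        then show "16 * (?n6 * ?E f) + 5 * ((1 / \<beta>) * ?n3 * ?E f') \<le> 16 * G" using parts by linarith
      qed
      finally show ?thesis by simp
    qed
    have "H1_norm (\<lambda>x. u x - uN x) (\<lambda>x. u' x - deriv uN x)
      \<le> L2_norm (\<lambda>x. u x - ?W x) + L2_norm (\<lambda>x. u' x - deriv ?W x)
        + 2 / ?m * (L2_norm (\<lambda>x. interp_hat N \<beta> f x - f x) + L2_norm (\<lambda>x. u' x - deriv ?W x) + \<gamma> * L2_norm (\<lambda>x. u x - ?W x))"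
      using gal by (intro galerkin_quasi_optimality[OF assms \<beta> u fL(1) pde uN scaled_proj_P_hat[OF b] gP]) auto
    also have "\<dots> \<le> C * G + 2 * C * G + 2 / ?m * (16 * C * G + 2 * C * G + \<gamma> * (C * G))"
      using \<rho> \<rho>' r m assms by (intro add_mono mult_left_mono) auto
    also have "\<dots> = C * (3 + 2 / ?m * (18 + \<gamma>)) * G" by (simp add: algebra_simps)
    finally show "H1_norm (\<lambda>x. u x - uN x) (\<lambda>x. u' x - deriv uN x)
      \<le> C * (3 + 2 / ?m * (18 + \<gamma>)) * (E_err N \<beta> u' + (1 + \<beta> * sqrt (real N)) * E_err N \<beta> u
             + (1 / \<beta>) * real N powr (-1/3) * E_err N \<beta> f' + real N powr (1/6) * E_err N \<beta> f)"
      unfolding G_def .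
  qed
qed

end
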